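(* Let $M$ be any closed manifold. Then for the connected sum $M\# M$ there exists a "centrally symmetric" free involution such that $M\# M$ is a BUT manifold.
   Context: $M\# M$ denotes the connected sum of $M$ with itself. A free involution on a space $N$ is a map $T:N\to N$ with $T^2(x)=x$ and $T(x)\ne x$ for all $x\in N$. A free involution $T$ on $N=M\# M$ is "centrally symmetric" if $N$ can be embedded in some Euclidean space $\mathbb{R}^k$ so that $A(N)=N$, where $A(x)=-x$ for $x\in\mathbb{R}^k$, and $T=A|_N$. A closed PL (piecewise linear) manifold $N^n$ of dimension $n$ with a free simplicial involution $T$ is called a BUT (Borsuk-Ulam Type) manifold if for any continuous $g:N^n\to\mathbb{R}^n$ there is a point $x\in N$ such that $g(T(x))=g(x)$. Equivalently, if a continuous map $f:N^n\to\mathbb{R}^n$ is antipodal, i.e. $f(T(x))=-f(x)$ for all $x\in N$, then its zero set $\{x\in N: f(x)=0\}$ is not empty. *)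

theory Defs
  imports "HOL-Analysis.Analysis"
begin

section \<open>Piecewise linear maps and closed PL manifolds\<close>

definition affine_map_on :: "'a::euclidean_space set \<Rightarrow> ('a \<Rightarrow> 'b::euclidean_space) \<Rightarrow> bool" where
  "affine_map_on C f \<longleftrightarrow> (\<exists>L b. linear L \<and> (\<forall>x\<in>C. f x = L x + b))"

definition compact_polyhedron :: "'a::euclidean_space set \<Rightarrow> bool" where
  "compact_polyhedron P \<longleftrightarrow> (\<exists>F. finite F \<and> (\<forall>C\<in>F. polytope C) \<and> P = \<Union>F)"

text \<open>The library's \<open>polyhedron\<close> is a finite intersection of half-spaces; here a compact polyhedron
  is a finite union of convex polytopes, as usual in PL topology.  A PL map is automatically
  continuous, because it is affine on each of finitely many closed pieces, and the inverse of an
  injective PL map is PL on the image.\<close>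

definition pl_map_on :: "'a::euclidean_space set \<Rightarrow> ('a \<Rightarrow> 'b::euclidean_space) \<Rightarrow> bool" where
  "pl_map_on P f \<longleftrightarrow>
     (\<exists>F. finite F \<and> (\<forall>C\<in>F. polytope C \<and> affine_map_on C f) \<and> P = \<Union>F)"

definition pl_embedding :: "'a::euclidean_space set \<Rightarrow> 'b::euclidean_space set \<Rightarrow> ('a \<Rightarrow> 'b) \<Rightarrow> bool" where
  "pl_embedding P Q f \<longleftrightarrow> pl_map_on P f \<and> inj_on f P \<and> f ` P \<subseteq> Q"

definition pl_homeomorphism :: "'a::euclidean_space set \<Rightarrow> 'b::euclidean_space set \<Rightarrow> ('a \<Rightarrow> 'b) \<Rightarrow> bool" where
  "pl_homeomorphism P Q f \<longleftrightarrow> pl_map_on P f \<and> bij_betw f P Q"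

text \<open>The standard PL ball and sphere are the cube and its boundary, i.e. the ball and sphere of the
  maximum norm.  The dimension of a manifold is \<open>CARD('n)\<close>, hence at least 1.\<close>

definition cube :: "real \<Rightarrow> (real^'n) set" where
  "cube r = {y. infnorm y \<le> r}"

definition open_cube :: "real \<Rightarrow> (real^'n) set" where
  "open_cube r = {y. infnorm y < r}"

definition cube_sphere :: "(real^'n) set" where
  "cube_sphere = {y. infnorm y = 1}"

text \<open>A chart defined on the cube of radius 2.  The embedded disc is the image of the cube of
  radius 1; the larger cube provides a collar, so the disc is bicollared in \<open>M\<close>.\<close>

definition pl_disc :: "'a::euclidean_space set \<Rightarrow> (real^'n \<Rightarrow> 'a) \<Rightarrow> bool" where
  "pl_disc M h \<longleftrightarrow>
     pl_embedding (cube 2) M h \<and> openin (top_of_set M) (h ` open_cube 2)"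

definition closed_pl_manifold :: "'n::finite itself \<Rightarrow> 'a::euclidean_space set \<Rightarrow> bool" where
  "closed_pl_manifold _ M \<longleftrightarrow>
     compact_polyhedron M \<and> (\<forall>x\<in>M. \<exists>h :: real^'n \<Rightarrow> 'a. pl_disc M h \<and> h 0 = x)"

lemma closed_pl_manifold_imp_pl_disc:
  fixes M :: "'a::euclidean_space set"
  assumes "closed_pl_manifold TYPE('n::finite) M" "M \<noteq> {}"
  shows "\<exists>h :: real^'n \<Rightarrow> 'a. pl_disc M h"
  using assms unfolding closed_pl_manifold_def by blast

section \<open>Connected sums\<close>

text \<open>\<open>N\<close> is the PL space obtained from \<open>M1\<close> and \<open>M2\<close> by deleting the interiors of the discs
  \<open>h1 ` cube 1\<close> and \<open>h2 ` cube 1\<close> and gluing the boundary spheres by \<open>h1 y \<mapsto> h2 (\<sigma> y)\<close>, where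
  \<open>\<sigma>\<close> is a PL homeomorphism of the standard sphere.  The maps \<open>j1\<close>, \<open>j2\<close> are the
  inclusions of the two punctured manifolds.  No orientations are involved: \<open>\<sigma>\<close> may preserve or
  reverse the orientation of the sphere.  For given discs and \<open>\<sigma>\<close> these conditions determine \<open>N\<close> up to PL
  homeomorphism.\<close>

definition connected_sum ::
  "'a::euclidean_space set \<Rightarrow> (real^'n \<Rightarrow> 'a) \<Rightarrow> 'b::euclidean_space set \<Rightarrow> (real^'n \<Rightarrow> 'b) \<Rightarrow>
   (real^'n \<Rightarrow> real^'n) \<Rightarrow> 'c::euclidean_space set \<Rightarrow> bool" where
  "connected_sum M1 h1 M2 h2 \<sigma> N \<longleftrightarrow>
     pl_disc M1 h1 \<and> pl_disc M2 h2 \<and> pl_homeomorphism cube_sphere cube_sphere \<sigma> \<and>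
     (\<exists>j1 j2. pl_embedding (M1 - h1 ` open_cube 1) N j1 \<and>
              pl_embedding (M2 - h2 ` open_cube 1) N j2 \<and>
              j1 ` (M1 - h1 ` open_cube 1) \<union> j2 ` (M2 - h2 ` open_cube 1) = N \<and>
              (\<forall>p \<in> M1 - h1 ` open_cube 1. \<forall>q \<in> M2 - h2 ` open_cube 1.
                 j1 p = j2 q \<longleftrightarrow> (\<exists>y\<in>cube_sphere. p = h1 y \<and> q = h2 (\<sigma> y))))"

section \<open>Free involutions and BUT manifolds\<close>

definition free_involution :: "'a::topological_space set \<Rightarrow> ('a \<Rightarrow> 'a) \<Rightarrow> bool" where
  "free_involution N T \<longleftrightarrow>
     continuous_on N T \<and> (\<forall>x\<in>N. T x \<in> N \<and> T (T x) = x \<and> T x \<noteq> x)"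

text \<open>\<open>Euclidean_space k\<close> is the subspace of sequences vanishing from index \<open>k\<close> on, so that the
  dimension \<open>k\<close> can be quantified existentially.\<close>

definition centrally_symmetric :: "'a::topological_space set \<Rightarrow> ('a \<Rightarrow> 'a) \<Rightarrow> bool" where
  "centrally_symmetric N T \<longleftrightarrow>
     (\<exists>k e. embedding_map (top_of_set N) (Euclidean_space k) e \<and>
            (\<lambda>v i. - v i) ` e ` N = e ` N \<and>
            (\<forall>x\<in>N. e (T x) = (\<lambda>i. - e x i)))"

text \<open>A map that is affine on each simplex of a complex and sends simplices onto simplices of the
  complex is a simplicial map (it sends vertices to vertices since these are the 0-simplices).\<close>

definition simplicial_self_map :: "'a::euclidean_space set \<Rightarrow> ('a \<Rightarrow> 'a) \<Rightarrow> bool" where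
  "simplicial_self_map N T \<longleftrightarrow>
     (\<exists>K. simplicial_complex K \<and> \<Union>K = N \<and> (\<forall>S\<in>K. affine_map_on S T \<and> T ` S \<in> K))"

definition BUT_manifold :: "'n::finite itself \<Rightarrow> 'a::euclidean_space set \<Rightarrow> ('a \<Rightarrow> 'a) \<Rightarrow> bool" where
  "BUT_manifold _ N T \<longleftrightarrow>
     closed_pl_manifold TYPE('n) N \<and> free_involution N T \<and> simplicial_self_map N T \<and>
     (\<forall>g :: 'a \<Rightarrow> real^'n. continuous_on N g \<longrightarrow> (\<exists>x\<in>N. g (T x) = g x))"

end

theory Submission
  imports Defs
begin

text \<open>Let \<open>M'\<close> be \<open>M\<close> without the open disc. It embeds in \<open>'a \<times> real^'n \<times> real\<close> with last
  coordinate (height) nonnegative, so that the boundary sphere \<open>h y\<close>, \<open>infnorm y = 1\<close>, goes to the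
  points \<open>(0, y, 0)\<close> and nothing else has height 0. The union \<open>N\<close> of this image and its negative is
  the connected sum for the gluing map \<open>y \<mapsto> - y\<close>, and \<open>T x = - x\<close>.

  For the Borsuk-Ulam property, let \<open>f x = g x - g (- x)\<close> have no zero on \<open>N\<close>. Label the vertices of
  a fine antipodally symmetric triangulation by the index and the sign of a largest component of
  \<open>f\<close>: antipodal vertices get opposite labels, and no edge has opposite labels at its ends.
  The triangulation is compatible with the flag of coordinate spheres
  \<open>S\<^sup>0 \<subseteq> S\<^sup>1 \<subseteq> \<dots> \<subseteq> S\<^sup>n\<^sup>-\<^sup>1 \<subseteq> N\<close>, each of which cuts the next one into two antipodal halves. By invariance of
  domain every simplex of codimension one in a closed manifold has exactly two cofaces, so Fan's
  parity argument runs up the flag and produces a simplex of \<open>N\<close> with \<open>n + 1\<close> labels of distinct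
  absolute values. But there are only \<open>n\<close> such values.\<close>

text \<open>The obstacle is that \<open>M\<close> and the disc \<open>h\<close> are arbitrary, while
  an induction over dimensions needs a standard place to start. The collar between the cubes of
  radius 1 and 2 is spent on straightening: along it the position in \<open>M\<close> is traded for
  a point of the standard cube sphere, so that only the last step of the flag involves
  \<open>M\<close>. The gluing map has to be \<open>y \<mapsto> - y\<close> because the antipode of
  \<open>(0, y, 0)\<close> is \<open>(0, - y, 0)\<close>. Alternating simplices are counted because
  their parity passes from one layer of the flag to the next; working modulo 2 makes orientability
  irrelevant. Two demands shape the triangulation: it must be invariant under the antipode, and no
  coordinate that cuts out the flag may change sign on a simplex. Both come from cutting with a
  finite family of hyperplanes that is closed under reflection. Charts must be piecewise linear at
  the waist too. Hence the sphere is the boundary of a cube, and the coordinate transversal to it is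
  a maximum of linear forms.\<close>

section \<open>Fan's combinatorial lemma\<close>

text \<open>Listed by increasing absolute value, the labels alternate in sign and begin with a
  positive one.\<close>

definition alternating :: "int set \<Rightarrow> bool" where
  "alternating B \<longleftrightarrow> (\<forall>x\<in>B. 0 < x \<longleftrightarrow> even (card {y\<in>B. \<bar>y\<bar> < \<bar>x\<bar>}))"

text \<open>A label of strictly largest absolute value comes last in the list, so its sign is tested
  against the number of labels before it.\<close>

lemma alternating_insert:
  assumes "finite B" "\<And>y. y \<in> B \<Longrightarrow> \<bar>y\<bar> < \<bar>m\<bar>"
  shows "alternating (insert m B) \<longleftrightarrow> alternating B \<and> (0 < m \<longleftrightarrow> even (card B))"
proof -
  have "{y \<in> insert m B. \<bar>y\<bar> < \<bar>m\<bar>} = B" using assms by auto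
  moreover have "{y \<in> insert m B. \<bar>y\<bar> < \<bar>x\<bar>} = {y \<in> B. \<bar>y\<bar> < \<bar>x\<bar>}" if "x \<in> B" for x
    using assms(2)[OF that] by auto
  ultimately show ?thesis unfolding alternating_def by (simp add: ball_simps) blast
qed

lemma alternating_empty [simp]: "alternating {}"
  by (simp add: alternating_def)

lemma alternating_Diff_parity:
  assumes "finite B" "inj_on abs B" "0 \<notin> B"
  shows "even (card {b\<in>B. alternating (B - {b})}) \<longleftrightarrow> (alternating B \<longleftrightarrow> alternating (uminus ` B))"
  using assms
proof (induction B rule: finite_ranking_induct[where f = abs])
  case empty
  show ?case by simp
next
  case (insert m B)
  show ?case
  proof (cases "m \<in> B")
    case True
    then show ?thesis using insert by (simp add: insert_absorb)
  next
    case mB: False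
    have lt: "\<bar>y\<bar> < \<bar>m\<bar>" if "y \<in> B" for y
    proof -
      have "\<bar>y\<bar> \<noteq> \<bar>m\<bar>" using insert.prems(1) mB that unfolding inj_on_def by auto
      then show ?thesis using insert.hyps(2)[OF that] by simp
    qed
    have m0: "m \<noteq> 0" using insert.prems by auto
    have IH: "even (card {b\<in>B. alternating (B - {b})}) \<longleftrightarrow> (alternating B \<longleftrightarrow> alternating (uminus ` B))"
      using insert by auto
    have a1: "alternating (insert m B) \<longleftrightarrow> alternating B \<and> (0 < m \<longleftrightarrow> even (card B))"
      using alternating_insert lt insert.hyps(1) by blast
    have "alternating (insert (-m) (uminus ` B)) \<longleftrightarrow>
        alternating (uminus ` B) \<and> (0 < -m \<longleftrightarrow> even (card (uminus ` B)))"
      by (rule alternating_insert) (use lt insert.hyps(1) in auto)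
    then have a2: "alternating (uminus ` insert m B) \<longleftrightarrow>
        alternating (uminus ` B) \<and> (0 < m \<longleftrightarrow> odd (card B))"
      using m0 by (auto simp: card_image)
    have a3: "alternating (insert m B - {b}) \<longleftrightarrow> alternating (B - {b}) \<and> (0 < m \<longleftrightarrow> odd (card B))"
      if "b \<in> B" for b
    proof -
      have "insert m B - {b} = insert m (B - {b})" using that mB by auto
      moreover have "card B = Suc (card (B - {b}))" using that insert.hyps(1)
        by (metis card.remove)
      ultimately show ?thesis using alternating_insert[of "B - {b}" m] lt insert.hyps(1) by auto
    qed
    have a4: "insert m B - {m} = B" using mB by auto
    show ?thesis
    \<comment> \<open>After the removal of some \<open>b\<close> in \<open>B\<close> the label
      \<open>m\<close> stands one place earlier. Its sign fits either there or in the old place,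
      never in both.\<close>
    proof (cases "0 < m \<longleftrightarrow> odd (card B)")
      case True
      have eq: "{b \<in> insert m B. alternating (insert m B - {b})} =
          (if alternating B then {m} else {}) \<union> {b\<in>B. alternating (B - {b})}"
        using a3 a4 True by auto
      have "card {b \<in> insert m B. alternating (insert m B - {b})} =
          (if alternating B then 1 else 0) + card {b\<in>B. alternating (B - {b})}"
        unfolding eq using mB insert.hyps(1) by (subst card_Un_disjoint) auto
      then show ?thesis using IH a1 a2 True by auto
    next
      case False
      have eq: "{b \<in> insert m B. alternating (insert m B - {b})} =
          (if alternating B then {m} else {})"
        using a3 a4 False by auto
      show ?thesis unfolding eq using a1 a2 False by auto
    qed
  qed
qed

definition fan_simplex :: "('v \<Rightarrow> int) \<Rightarrow> 'v set \<Rightarrow> bool" where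
  "fan_simplex l s \<longleftrightarrow> inj_on l s \<and> alternating (l ` s)"

definition no_complementary :: "('v \<Rightarrow> int) \<Rightarrow> 'v set \<Rightarrow> bool" where
  "no_complementary l s \<longleftrightarrow> (\<forall>u\<in>s. l u \<noteq> 0 \<and> (\<forall>v\<in>s. l u \<noteq> - l v))"

lemma no_complementary_inj_abs: "no_complementary l s \<Longrightarrow> inj_on abs (l ` s)"
  unfolding no_complementary_def inj_on_def by (auto simp: abs_eq_iff)

text \<open>The label of least absolute value begins both lists and would have to be positive in
  both.\<close>

lemma alternating_uminus_disjoint:
  assumes "finite B" "inj_on abs B" "0 \<notin> B" "B \<noteq> {}"
  shows "\<not> (alternating B \<and> alternating (uminus ` B))"
proof
  assume a: "alternating B \<and> alternating (uminus ` B)"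
  obtain m where m: "m \<in> B" "\<And>y. y \<in> B \<Longrightarrow> \<bar>m\<bar> \<le> \<bar>y\<bar>"
    using assms(1,4) arg_min_if_finite[of B abs] by (metis linorder_not_less)
  then have "{y\<in>B. \<bar>y\<bar> < \<bar>m\<bar>} = {}" "{y\<in>uminus ` B. \<bar>y\<bar> < \<bar>-m\<bar>} = {}" by force+
  then have "0 < m" "0 < - m" using a m(1) unfolding alternating_def
    by (metis card.empty even_zero, metis card.empty even_zero imageI)
  then show False by simp
qed

text \<open>If the labels are distinct, facets correspond to removed labels and
  \<open>alternating_Diff_parity\<close> applies. If \<open>u\<close> and \<open>v\<close> share a
  label, a facet with distinct labels must drop one of them; these two facets carry the same labels,
  so both qualify or neither does.\<close>

lemma fan_simplex_facet_parity:
  assumes fin: "finite s" and nc: "no_complementary l s" and ne: "s \<noteq> {}"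
  shows "odd (card {v\<in>s. fan_simplex l (s - {v})}) \<longleftrightarrow> fan_simplex l s \<or> fan_simplex (\<lambda>v. - l v) s"
proof (cases "inj_on l s")
  case True
  have img: "l ` (s - {v}) = l ` s - {l v}" if "v \<in> s" for v
    using True that by (auto simp: inj_on_def)
  have "inj_on l (s - {v})" for v using True by (rule inj_on_subset) auto
  then have "bij_betw l {v\<in>s. fan_simplex l (s - {v})} {b\<in>l ` s. alternating (l ` s - {b})}"
    using True img unfolding bij_betw_def fan_simplex_def
    by (auto simp: inj_on_def image_iff)
  then have "card {v\<in>s. fan_simplex l (s - {v})} = card {b\<in>l ` s. alternating (l ` s - {b})}"
    by (rule bij_betw_same_card)
  moreover have ab: "inj_on abs (l ` s)" "0 \<notin> l ` s"
    using no_complementary_inj_abs[OF nc] nc by (auto simp: no_complementary_def)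
  ultimately have "odd (card {v\<in>s. fan_simplex l (s - {v})}) \<longleftrightarrow>
      alternating (l ` s) \<or> alternating (uminus ` l ` s)"
    using alternating_Diff_parity[of "l ` s"] alternating_uminus_disjoint[of "l ` s"] fin ne by auto
  moreover have "inj_on (\<lambda>v. - l v) s" using True by (auto simp: inj_on_def)
  ultimately show ?thesis using True unfolding fan_simplex_def by (simp add: image_image)
next
  case False
  then obtain u v where uv: "u \<in> s" "v \<in> s" "u \<noteq> v" "l u = l v" by (auto simp: inj_on_def)
  have sub: "{w\<in>s. fan_simplex l (s - {w})} \<subseteq> {u, v}"
    using uv unfolding fan_simplex_def inj_on_def by blast
  have img: "l ` (s - {u}) = l ` (s - {v})"
  proof -
    have "l ` (s - {a}) \<subseteq> l ` (s - {b})" if "a \<in> s" "b \<in> s" "a \<noteq> b" "l a = l b" for a b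
    proof
      fix x assume "x \<in> l ` (s - {a})"
      then obtain w where w: "w \<in> s" "x = l w" by blast
      show "x \<in> l ` (s - {b})"
      proof (cases "w = b")
        case True
        then show ?thesis using that w by (intro image_eqI[of x l a]) auto
      next
        case False
        then show ?thesis using w by blast
      qed
    qed
    from this[of u v] this[of v u] uv show ?thesis by auto
  qed
  have "inj_on l (s - {u}) \<longleftrightarrow> inj_on l (s - {v})"
    using img fin uv by (simp add: inj_on_iff_eq_card)
  then have "fan_simplex l (s - {u}) \<longleftrightarrow> fan_simplex l (s - {v})"
    using img by (simp add: fan_simplex_def)
  then have "{w\<in>s. fan_simplex l (s - {w})} = {} \<or> {w\<in>s. fan_simplex l (s - {w})} = {u, v}"
    using sub uv by auto
  then have "even (card {w\<in>s. fan_simplex l (s - {w})})"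
    using uv(3) by (elim disjE) (simp_all only: card.empty card_2_iff' even_zero card_insert_if, auto)
  moreover have "\<not> inj_on (\<lambda>v. - l v) s" using uv by (auto simp: inj_on_def)
  ultimately show ?thesis using False by (auto simp: fan_simplex_def)
qed

text \<open>\<open>H d\<close> stands for one half of the \<open>d\<close>-th layer, and
  \<open>bd\<close> says that modulo 2 its boundary is the whole layer below. The induction counts
  incidences between simplices of the upper half and their Fan facets. Sorted by facet, the parity
  is that of the Fan simplices one layer down; sorted by simplex, it is that of the simplices which
  are Fan for \<open>l\<close> or for the reversed labels, and the antipodes of the latter are the
  Fan simplices of the other half.\<close>

lemma Fan_lemma:
  fixes H :: "nat \<Rightarrow> 'v::real_vector set set"
  assumes finH: "\<And>d. d \<le> n \<Longrightarrow> finite (H d)"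
    and cardH: "\<And>d s. d \<le> n \<Longrightarrow> s \<in> H d \<Longrightarrow> card s = Suc d"
    and nc: "\<And>d s. d \<le> n \<Longrightarrow> s \<in> H d \<Longrightarrow> no_complementary l s"
    and odd: "\<And>d s v. d \<le> n \<Longrightarrow> s \<in> H d \<Longrightarrow> v \<in> s \<Longrightarrow> l (- v) = - l v"
    and bd: "\<And>d r. 1 \<le> d \<Longrightarrow> d \<le> n \<Longrightarrow> card r = d \<Longrightarrow>
        odd (card {s\<in>H d. r \<subseteq> s}) \<longleftrightarrow> r \<in> H (d - 1) \<union> (`) uminus ` H (d - 1)"
    and disj: "\<And>d. d \<le> n \<Longrightarrow> H d \<inter> (`) uminus ` H d = {}"
    and H0: "H 0 = {{p}}"
    and d: "d \<le> n"
  shows "odd (card {s \<in> H d \<union> (`) uminus ` H d. fan_simplex l s})"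
  using d
proof (induction d)
  case 0
  \<comment> \<open>Of the two antipodal points exactly one has a positive label.\<close>
  have "l (-p) = - l p" "l p \<noteq> 0" using odd[of 0 "{p}" p] nc[of 0 "{p}"] H0
    by (auto simp: no_complementary_def)
  moreover have "alternating {x} \<longleftrightarrow> 0 < x" for x
    using alternating_insert[of "{}" x] by simp
  ultimately have f: "fan_simplex l {p} \<longleftrightarrow> 0 < l p" "fan_simplex l {-p} \<longleftrightarrow> \<not> 0 < l p"
    unfolding fan_simplex_def by (simp, simp, linarith)
  have "card {s \<in> {a, b}. P s} = 1" if "P a \<longleftrightarrow> c" "P b \<longleftrightarrow> \<not> c" for P c and a b :: "'v set"
  proof -
    have "{s \<in> {a, b}. P s} = (if c then {a} else {b})" using that by auto
    then show ?thesis by simp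
  qed
  from this[OF f] have "card {s \<in> {{p}, {-p}}. fan_simplex l s} = 1" .
  moreover have "H 0 \<union> (`) uminus ` H 0 = {{p}, {-p}}" unfolding H0 by auto
  ultimately show ?case by simp
next
  case (Suc d)
  let ?S = "\<lambda>d. H d \<union> (`) uminus ` H d"
  let ?D = "Suc d"
  have fins: "finite s" if "s \<in> H ?D" for s
    using cardH[OF Suc.prems that] card.infinite by fastforce
  have neg: "fan_simplex l (uminus ` s) \<longleftrightarrow> fan_simplex (\<lambda>v. - l v) s" if "s \<in> H ?D" for s
  proof -
    have "l ` uminus ` s = (\<lambda>v. - l v) ` s"
      using odd[OF Suc.prems that] by (auto simp: image_image)
    moreover have "inj_on l (uminus ` s) \<longleftrightarrow> inj_on (\<lambda>v. - l v) s"
      using odd[OF Suc.prems that] by (force simp: inj_on_def)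
    ultimately show ?thesis by (simp add: fan_simplex_def)
  qed
  define R where "R = {r. (\<exists>s\<in>H ?D. r \<subseteq> s) \<and> card r = ?D \<and> fan_simplex l r}"
  have finR: "finite R"
  proof -
    have "R \<subseteq> (\<Union>s\<in>H ?D. Pow s)" unfolding R_def by auto
    then show ?thesis by (rule finite_subset) (use finH[OF Suc.prems] fins in auto)
  qed
  have facets: "card {r\<in>R. r \<subseteq> s} = card {v\<in>s. fan_simplex l (s - {v})}" if s: "s \<in> H ?D" for s
  proof -
    have "{r\<in>R. r \<subseteq> s} = (\<lambda>v. s - {v}) ` {v\<in>s. fan_simplex l (s - {v})}"
    proof (intro set_eqI iffI)
      fix r assume r: "r \<in> {r\<in>R. r \<subseteq> s}"
      then have "card (s - r) = 1" using cardH[OF Suc.prems s] fins[OF s]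
        by (auto simp: R_def card_Diff_subset finite_subset)
      then obtain v where "s - r = {v}" by (auto simp: card_1_singleton_iff)
      then have "v \<in> s" "r = s - {v}" using r by auto
      then show "r \<in> (\<lambda>v. s - {v}) ` {v\<in>s. fan_simplex l (s - {v})}"
        using r by (auto simp: R_def)
    next
      fix r assume "r \<in> (\<lambda>v. s - {v}) ` {v\<in>s. fan_simplex l (s - {v})}"
      then obtain v where "v \<in> s" "r = s - {v}" "fan_simplex l r" by auto
      then show "r \<in> {r\<in>R. r \<subseteq> s}" using s cardH[OF Suc.prems s] fins[OF s]
        by (auto simp: R_def)
    qed
    moreover have "inj_on (\<lambda>v. s - {v}) {v\<in>s. fan_simplex l (s - {v})}"
      by (auto simp: inj_on_def)
    ultimately show ?thesis by (simp add: card_image)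
  qed
  have sum2: "(\<Sum>s\<in>H ?D. card {r\<in>R. r \<subseteq> s}) = (\<Sum>r\<in>R. card {s\<in>H ?D. r \<subseteq> s})"
    using finR finH[OF Suc.prems] by (intro sum_multicount_gen) auto
  \<comment> \<open>Modulo 2 only the facets in an odd number of simplices count, and by
    \<open>bd\<close> these are the ones on the lower layer.\<close>
  have "odd (\<Sum>r\<in>R. card {s\<in>H ?D. r \<subseteq> s}) \<longleftrightarrow> odd (card {r\<in>R. odd (card {s\<in>H ?D. r \<subseteq> s})})"
    using finR by (rule even_sum_iff[THEN arg_cong[where f = Not]])
  moreover have "{r\<in>R. odd (card {s\<in>H ?D. r \<subseteq> s})} = {s \<in> ?S d. fan_simplex l s}"
  proof (intro set_eqI iffI)
    fix r assume "r \<in> {r\<in>R. odd (card {s\<in>H ?D. r \<subseteq> s})}"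
    then show "r \<in> {s \<in> ?S d. fan_simplex l s}" using bd[of ?D r] Suc.prems by (auto simp: R_def)
  next
    fix r assume r: "r \<in> {s \<in> ?S d. fan_simplex l s}"
    then have c: "card r = ?D" using cardH[of d] Suc.prems by (auto simp: card_image)
    then have o: "odd (card {s\<in>H ?D. r \<subseteq> s})" using bd[of ?D r] Suc.prems r by auto
    then have "{s\<in>H ?D. r \<subseteq> s} \<noteq> {}" by (metis card.empty even_zero)
    then show "r \<in> {r\<in>R. odd (card {s\<in>H ?D. r \<subseteq> s})}" using r c o by (auto simp: R_def)
  qed
  ultimately have o1: "odd (\<Sum>s\<in>H ?D. card {r\<in>R. r \<subseteq> s})" using Suc sum2 by simp
  have "odd (\<Sum>s\<in>H ?D. card {r\<in>R. r \<subseteq> s}) \<longleftrightarrow> odd (card {s\<in>H ?D. odd (card {r\<in>R. r \<subseteq> s})})"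
    using finH[OF Suc.prems] by (rule even_sum_iff[THEN arg_cong[where f = Not]])
  moreover have "{s\<in>H ?D. odd (card {r\<in>R. r \<subseteq> s})} =
      {s\<in>H ?D. fan_simplex l s \<or> fan_simplex (\<lambda>v. - l v) s}"
  proof -
    have "odd (card {r\<in>R. r \<subseteq> s}) \<longleftrightarrow> fan_simplex l s \<or> fan_simplex (\<lambda>v. - l v) s"
      if "s \<in> H ?D" for s
      unfolding facets[OF that]
      using fins[OF that] nc[OF Suc.prems that] cardH[OF Suc.prems that]
      by (intro fan_simplex_facet_parity) auto
    then show ?thesis by blast
  qed
  ultimately have o2: "odd (card {s\<in>H ?D. fan_simplex l s \<or> fan_simplex (\<lambda>v. - l v) s})"
    using o1 by simp
  let ?A = "{s\<in>H ?D. fan_simplex l s}" and ?B = "{s\<in>H ?D. fan_simplex (\<lambda>v. - l v) s}"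
  have fAB: "finite ?A" "finite ?B" using finH[OF Suc.prems] by auto
  have "?A \<inter> ?B = {}"
  proof -
    have False if s: "s \<in> H ?D" "fan_simplex l s" "fan_simplex (\<lambda>v. - l v) s" for s
    proof -
      have "s \<noteq> {}" using cardH[OF Suc.prems s(1)] by auto
      moreover have "(\<lambda>v. - l v) ` s = uminus ` l ` s" by (auto simp: image_image)
      moreover have "0 \<notin> l ` s"
        using nc[OF Suc.prems s(1)] by (force simp: no_complementary_def)
      ultimately show False
        using alternating_uminus_disjoint[of "l ` s"] fins[OF s(1)] s
          no_complementary_inj_abs[OF nc[OF Suc.prems s(1)]]
        by (auto simp only: fan_simplex_def finite_imageI image_is_empty)
    qed
    then show ?thesis by auto
  qed
  then have "card {s\<in>H ?D. fan_simplex l s \<or> fan_simplex (\<lambda>v. - l v) s} = card ?A + card ?B"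
    using fAB by (subst card_Un_disjoint[symmetric]) (auto intro: arg_cong[where f = card])
  \<comment> \<open>Reflection carries \<open>?B\<close> to the Fan simplices of the opposite half,
    and \<open>disj\<close> keeps the two counts apart.\<close>
  moreover have "card {s \<in> ?S ?D. fan_simplex l s} = card ?A + card ?B"
  proof -
    have eq: "{s \<in> ?S ?D. fan_simplex l s} = ?A \<union> (`) uminus ` ?B" using neg by auto
    have "?A \<inter> (`) uminus ` ?B = {}" using disj[OF Suc.prems] by blast
    moreover have "inj_on ((`) uminus) ?B" by (auto simp: inj_on_def inj_image_eq_iff)
    ultimately show ?thesis unfolding eq using fAB by (simp add: card_Un_disjoint card_image)
  qed
  ultimately show ?case using o2 by simp
qed

section \<open>Simplices of codimension one in a locally Euclidean complex\<close>

lemma aff_dim_Times_real: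
  fixes A :: "'a::euclidean_space set"
  assumes "affine A" "A \<noteq> {}"
  shows "aff_dim (A \<times> (UNIV::real set)) = aff_dim A + 1"
proof -
  obtain a where a: "a \<in> A" using assms by blast
  define S where "S = (\<lambda>x. - a + x) ` A"
  have S: "subspace S" unfolding S_def using assms(1) a by (rule affine_diffs_subspace)
  have A: "A = (\<lambda>x. a + x) ` S" by (auto simp: S_def image_image)
  have "A \<times> (UNIV::real set) = (\<lambda>z. (a, 0) + z) ` (S \<times> UNIV)"
    unfolding A by (force simp: image_iff)
  then have "aff_dim (A \<times> (UNIV::real set)) = aff_dim (S \<times> (UNIV::real set))"
    by (simp add: aff_dim_translation_eq)
  also have "\<dots> = dim (S \<times> (UNIV::real set))"
    by (rule aff_dim_subspace) (use S in \<open>simp add: subspace_Times\<close>)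
  also have "\<dots> = dim S + 1" using S by (simp add: dim_Times)
  finally have "aff_dim (A \<times> (UNIV::real set)) = int (dim S) + 1" by simp
  moreover have "int (dim S) = aff_dim A" unfolding A using S
    by (simp add: aff_dim_translation_eq aff_dim_subspace)
  ultimately show ?thesis by simp
qed

lemma affine_Times: "affine S \<Longrightarrow> affine T \<Longrightarrow> affine (S \<times> T)"
  by (auto simp: affine_def)

text \<open>The dimension \<open>d\<close> runs through the flag, while a type such as
  \<open>real^'n\<close> has a fixed dimension. The charts therefore end in
  \<open>d\<close>-dimensional affine subspaces of one fixed type.\<close>

definition locally_euclidean :: "'b::euclidean_space itself \<Rightarrow> nat \<Rightarrow> 'a::euclidean_space set \<Rightarrow> bool" where
  "locally_euclidean _ d X \<longleftrightarrow> (\<forall>x\<in>X. \<exists>W (U::'b set) Q. x \<in> W \<and> openin (top_of_set X) W \<and>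
     affine U \<and> aff_dim U = int d \<and> openin (top_of_set U) Q \<and> W homeomorphic Q)"

lemma locally_euclideanE:
  assumes "locally_euclidean TYPE('b::euclidean_space) d X" "x \<in> X"
  obtains W Q f g and U :: "'b::euclidean_space set" where "x \<in> W" "openin (top_of_set X) W" "affine U" "aff_dim U = int d"
    "openin (top_of_set U) Q" "homeomorphism W Q f g"
  using assms unfolding locally_euclidean_def homeomorphic_def by metis

text \<open>Invariance of domain speaks of maps between affine sets, so an injective map into
  \<open>X\<close> is restricted and followed by a chart.\<close>

lemma locally_euclidean_pull_chart:
  fixes f :: "'c::euclidean_space \<Rightarrow> 'a::euclidean_space"
  assumes X: "locally_euclidean TYPE('b::euclidean_space) d X" and D: "openin (top_of_set A) D" "z \<in> D"
    and f: "continuous_on D f" "f ` D \<subseteq> X" "inj_on f D"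
  obtains W Q D' p q and U :: "'b::euclidean_space set" where "openin (top_of_set X) W" "affine U" "aff_dim U = int d"
    "openin (top_of_set U) Q" "homeomorphism W Q p q" "z \<in> D'" "D' \<subseteq> D" "openin (top_of_set A) D'" "f ` D' \<subseteq> W"
    "continuous_on D' (p \<circ> f)" "p \<circ> f \<in> D' \<rightarrow> U" "inj_on (p \<circ> f) D'"
proof -
  obtain W Q p q and U :: "'b set" where W: "f z \<in> W" "openin (top_of_set X) W" "affine U" "aff_dim U = int d"
    "openin (top_of_set U) Q" "homeomorphism W Q p q"
    using locally_euclideanE[OF X] f(2) D(2) by (metis imageI subsetD)
  define D' where "D' = D \<inter> f -` W"
  have D'D: "D' \<subseteq> D" by (auto simp: D'_def)
  have "openin (top_of_set D) D'" unfolding D'_def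
    by (rule continuous_openin_preimage[OF f(1) _ W(2)]) (use f in auto)
  then have o: "openin (top_of_set A) D'" using D(1) by (rule openin_trans)
  have fW: "f ` D' \<subseteq> W" by (auto simp: D'_def)
  have "continuous_on D' (p \<circ> f)"
    by (intro continuous_on_compose continuous_on_subset[OF f(1) D'D]
        continuous_on_subset[OF homeomorphism_cont1[OF W(6)] fW])
  moreover have "p \<circ> f \<in> D' \<rightarrow> U"
    using fW homeomorphism_image1[OF W(6)] openin_imp_subset[OF W(5)] by fastforce
  moreover have "inj_on (p \<circ> f) D'"
  proof (rule comp_inj_on)
    show "inj_on f D'" using f(3) D'D by (rule inj_on_subset)
    show "inj_on p (f ` D')"
      by (rule inj_on_inverseI[of _ q]) (use fW homeomorphism_apply1[OF W(6)] in auto)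
  qed
  moreover have "z \<in> D'" using W(1) D(2) by (simp add: D'_def)
  ultimately show ?thesis using that[OF W(2-6) _ D'D o fW] by blast
qed

lemma locally_euclidean_dim_le:
  fixes f :: "'c::euclidean_space \<Rightarrow> 'a::euclidean_space"
  assumes X: "locally_euclidean TYPE('b::euclidean_space) d X"
    and A: "affine A" and D: "openin (top_of_set A) D" "D \<noteq> {}"
    and f: "continuous_on D f" "f ` D \<subseteq> X" "inj_on f D"
  shows "aff_dim A \<le> int d"
proof -
  obtain z where z: "z \<in> D" using D by blast
  obtain W Q D' p q and U :: "'b set" where W: "openin (top_of_set X) W" "affine U" "aff_dim U = int d"
    "openin (top_of_set U) Q" "homeomorphism W Q p q" "z \<in> D'" "D' \<subseteq> D" "openin (top_of_set A) D'" "f ` D' \<subseteq> W"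
    "continuous_on D' (p \<circ> f)" "p \<circ> f \<in> D' \<rightarrow> U" "inj_on (p \<circ> f) D'"
    by (rule locally_euclidean_pull_chart[OF X D(1) z f]) (rule that)
  have "D' \<noteq> {}" using W(6) by blast
  then have "aff_dim A \<le> aff_dim U"
    by (rule invariance_of_dimension_affine_sets[OF W(8) A W(2,10-12)])
  then show ?thesis using W(3) by simp
qed

lemma locally_euclidean_open_image:
  fixes f :: "'c::euclidean_space \<Rightarrow> 'a::euclidean_space"
  assumes X: "locally_euclidean TYPE('b::euclidean_space) d X"
    and A: "affine A" "int d \<le> aff_dim A" and D: "openin (top_of_set A) D"
    and f: "continuous_on D f" "f ` D \<subseteq> X" "inj_on f D"
  shows "openin (top_of_set X) (f ` D)"
proof -
  have "\<exists>T. openin (top_of_set X) T \<and> f z \<in> T \<and> T \<subseteq> f ` D" if z: "z \<in> D" for z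
  proof -
    obtain W Q D' p q and U :: "'b set" where W: "openin (top_of_set X) W" "affine U" "aff_dim U = int d"
      "openin (top_of_set U) Q" "homeomorphism W Q p q" "z \<in> D'" "D' \<subseteq> D" "openin (top_of_set A) D'" "f ` D' \<subseteq> W"
      "continuous_on D' (p \<circ> f)" "p \<circ> f \<in> D' \<rightarrow> U" "inj_on (p \<circ> f) D'"
      by (rule locally_euclidean_pull_chart[OF X D z f]) (rule that)
    have "openin (top_of_set U) ((p \<circ> f) ` D')"
      by (rule invariance_of_domain_affine_sets[OF W(8) A(1) W(2) _ W(10-12)]) (use A(2) W(3) in simp)
    then have "openin (top_of_set Q) ((p \<circ> f) ` D')"
      by (rule openin_subset_trans)
        (use W(9) homeomorphism_image1[OF W(5)] openin_imp_subset[OF W(4)] in fastforce)+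
    then have "openin (top_of_set W) (q ` (p \<circ> f) ` D')"
      by (rule homeomorphism_imp_open_map[OF homeomorphism_symD[OF W(5)]])
    moreover have "q ` (p \<circ> f) ` D' = f ` D'"
      using homeomorphism_apply1[OF W(5)] W(9) by (force simp: image_image image_iff)
    ultimately have "openin (top_of_set X) (f ` D')" using W(1) openin_trans by auto
    then show ?thesis using W(6,7) by blast
  qed
  then show ?thesis by (subst openin_subopen) blast
qed

text \<open>Here a chart is used backwards: its inverse embeds an open piece of \<open>U\<close>
  into \<open>A\<close>, which bounds the dimension from below and, for equal dimensions, has an
  image open in \<open>A\<close>.\<close>

lemma locally_euclidean_in_affine:
  assumes X: "locally_euclidean TYPE('b::euclidean_space) d X"
    and G: "openin (top_of_set X) G" "x \<in> G" "G \<subseteq> A" and A: "affine A"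
  shows "int d \<le> aff_dim A" "aff_dim A \<le> int d \<Longrightarrow> \<exists>G'. x \<in> G' \<and> G' \<subseteq> G \<and> openin (top_of_set A) G'"
proof -
  have "x \<in> X" using G openin_imp_subset by blast
  then obtain W Q p q and U :: "'b set" where W: "x \<in> W" "openin (top_of_set X) W" "affine U" "aff_dim U = int d"
    "openin (top_of_set U) Q" "homeomorphism W Q p q"
    using locally_euclideanE[OF X] by metis
  define G' where "G' = W \<inter> G"
  have "openin (top_of_set W) G'" unfolding G'_def
    using G(1) openin_imp_subset[OF W(2)] by (meson W(2) inf_le1 openin_Int openin_subset_trans)
  then have "openin (top_of_set Q) (p ` G')" by (rule homeomorphism_imp_open_map[OF W(6)])
  then have o: "openin (top_of_set U) (p ` G')" using W(5) by (rule openin_trans)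
  have sub: "p ` G' \<subseteq> Q" using homeomorphism_image1[OF W(6)] by (auto simp: G'_def)
  have c: "continuous_on (p ` G') q"
    using continuous_on_subset[OF homeomorphism_cont2[OF W(6)] sub] .
  have im: "q ` p ` G' = G'" using homeomorphism_apply1[OF W(6)]
    by (force simp: image_image image_iff G'_def)
  have fi: "q \<in> p ` G' \<rightarrow> A" using im G(3) by (auto simp: G'_def)
  have inj: "inj_on q (p ` G')" 
    by (rule inj_on_inverseI[of _ p]) (use sub homeomorphism_apply2[OF W(6)] in auto)
  have x: "x \<in> G'" using W G by (simp add: G'_def)
  show "int d \<le> aff_dim A"
    using invariance_of_dimension_affine_sets[OF o W(3) A c fi inj] x W(4) by auto
  show "\<exists>G'. x \<in> G' \<and> G' \<subseteq> G \<and> openin (top_of_set A) G'" if "aff_dim A \<le> int d"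
    using invariance_of_domain_affine_sets[OF o W(3) A _ c fi inj] that x W(4) im
    by (auto simp: G'_def)
qed

section \<open>Geometric simplicial complexes and cofaces\<close>

text \<open>Simplices are recorded by their vertex sets, the form in which \<open>Fan_lemma\<close>
  counts them; the empty face is included.\<close>

definition geometric_complex :: "'a::euclidean_space set set \<Rightarrow> bool" where
  "geometric_complex V \<longleftrightarrow> finite V \<and> (\<forall>A\<in>V. \<not> affine_dependent A \<and> Pow A \<subseteq> V) \<and>
     (\<forall>A\<in>V. \<forall>B\<in>V. convex hull A \<inter> convex hull B \<subseteq> convex hull (A \<inter> B))"

definition body :: "'a::euclidean_space set set \<Rightarrow> 'a set" where
  "body V = (\<Union>A\<in>V. convex hull A)"

text \<open>Equal hulls have equal affine dimension, which for independent sets determines the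
  number of vertices.\<close>

lemma convex_hull_inj_affine_independent:
  fixes A :: "'a::euclidean_space set"
  assumes "\<not> affine_dependent A" "c \<subseteq> A" "convex hull c = convex hull A"
  shows "c = A"
proof -
  have "\<not> affine_dependent c" using assms affine_dependent_subset by blast
  moreover have "aff_dim c = aff_dim A" using assms(3) by (metis aff_dim_convex_hull)
  ultimately have "card c = card A" using assms(1) aff_dim_affine_independent[of c] aff_dim_affine_independent[of A] by simp
  then show ?thesis using assms aff_independent_finite card_subset_eq by blast
qed

lemma proper_face_avoids_rel_interior:
  fixes A :: "'a::euclidean_space set"
  assumes "\<not> affine_dependent A" "c \<subset> A"
  shows "convex hull c \<inter> rel_interior (convex hull A) = {}"
proof (rule face_of_disjoint_rel_interior)
  show "convex hull c face_of convex hull A"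
    using face_of_convex_hull_affine_independent[OF assms(1)] assms(2) by blast
  show "convex hull c \<noteq> convex hull A" using convex_hull_inj_affine_independent assms by blast
qed

text \<open>Deleting the finitely many closed simplices that miss \<open>x\<close> leaves a
  neighbourhood of \<open>x\<close>. A simplex through \<open>x\<close> meets \<open>r\<close> in a
  face that contains a relative interior point of \<open>r\<close>, so it contains all of
  \<open>r\<close>.\<close>

lemma geometric_complex_star:
  fixes V :: "'a::euclidean_space set set"
  assumes V: "geometric_complex V" and r: "r \<in> V" and x: "x \<in> rel_interior (convex hull r)"
  obtains G where "openin (top_of_set (body V)) G" "x \<in> G" "\<And>y. y \<in> G \<Longrightarrow> \<exists>A\<in>V. r \<subseteq> A \<and> y \<in> convex hull A"
proof
  let ?C = "\<Union>A\<in>{A\<in>V. x \<notin> convex hull A}. convex hull A"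
  have fin: "finite V" and ind: "\<And>A. A \<in> V \<Longrightarrow> \<not> affine_dependent A"
    and int: "\<And>A B. A \<in> V \<Longrightarrow> B \<in> V \<Longrightarrow> convex hull A \<inter> convex hull B \<subseteq> convex hull (A \<inter> B)"
    using V by (auto simp: geometric_complex_def)
  have "closed (convex hull A)" if "A \<in> V" for A
    using aff_independent_finite[OF ind[OF that]] by (simp add: compact_imp_closed finite_imp_compact_convex_hull)
  then have "closed ?C" using fin by (intro closed_UN) auto
  then have "open (- ?C)" by (rule open_Compl)
  then show "openin (top_of_set (body V)) (body V - ?C)"
    unfolding Diff_eq by (rule openin_open_Int)
  show "x \<in> body V - ?C" using x r rel_interior_subset unfolding body_def by blast
  fix y assume "y \<in> body V - ?C"
  then obtain A where A: "A \<in> V" "y \<in> convex hull A" "x \<in> convex hull A" by (auto simp: body_def)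
  then have "x \<in> convex hull (r \<inter> A)" using int[OF r A(1)] x rel_interior_subset by blast
  then have "\<not> r \<inter> A \<subset> r" using proper_face_avoids_rel_interior[OF ind[OF r]] x by blast
  then show "\<exists>A\<in>V. r \<subseteq> A \<and> y \<in> convex hull A" using A by blast
qed

text \<open>Solving for \<open>v\<close> gives the coefficients \<open>b/s\<close> and
  \<open>- a/s\<close>, whose sum is 1. This is how a point of a coface that lies in the hull of
  \<open>r\<close> forces the extra vertex into that hull.\<close>

lemma affine_combination_outside:
  fixes v x y :: "'a::real_vector"
  assumes "a *\<^sub>R x + s *\<^sub>R v = b *\<^sub>R y" "a + s = b" "s \<noteq> 0" "x \<in> affine hull R" "y \<in> affine hull R"
  shows "v \<in> affine hull R"
proof -
  have "s *\<^sub>R v = b *\<^sub>R y - a *\<^sub>R x" using assms(1) by (simp add: algebra_simps)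
  then have "(1/s) *\<^sub>R (s *\<^sub>R v) = (1/s) *\<^sub>R (b *\<^sub>R y - a *\<^sub>R x)" by simp
  then have "v = (1/s) *\<^sub>R (b *\<^sub>R y - a *\<^sub>R x)" using assms(3) by simp
  then have "v = (b/s) *\<^sub>R y + (- a/s) *\<^sub>R x" by (simp add: algebra_simps)
  moreover have "b/s + - a/s = 1" using assms by (simp add: field_simps)
  ultimately show ?thesis using affine_affine_hull[of R] assms(4,5) unfolding affine_def by blast
qed

context
  fixes V :: "'a::euclidean_space set set" and d :: nat
  assumes V: "geometric_complex V"
    and X: "locally_euclidean TYPE('b::euclidean_space) d (body V)"
begin

private lemma ind: "A \<in> V \<Longrightarrow> \<not> affine_dependent A"
  using V by (simp add: geometric_complex_def)

private lemma finA: "A \<in> V \<Longrightarrow> finite A"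
  using ind aff_independent_finite by blast

private lemma Int: "A \<in> V \<Longrightarrow> B \<in> V \<Longrightarrow> convex hull A \<inter> convex hull B \<subseteq> convex hull (A \<inter> B)"
  using V by (simp add: geometric_complex_def)

text \<open>The relative interior of a simplex sits injectively in a \<open>d\<close>-dimensional
  set.\<close>

lemma geometric_complex_card_le:
  assumes "A \<in> V"
  shows "card A \<le> Suc d"
proof (cases "A = {}")
  case False
  have "aff_dim (affine hull (convex hull A)) \<le> int d"
  proof (rule locally_euclidean_dim_le[OF X affine_affine_hull openin_rel_interior, where f = id])
    show "rel_interior (convex hull A) \<noteq> {}" using False by (simp add: rel_interior_eq_empty)
    show "id ` rel_interior (convex hull A) \<subseteq> body V"
      using assms rel_interior_subset by (auto simp: body_def)
  qed auto
  then show ?thesis using aff_dim_affine_independent[OF ind[OF assms]] by (simp add: aff_dim_convex_hull)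
qed simp

text \<open>Two cofaces glued along \<open>r\<close> contain an injective image of a
  \<open>d\<close>-dimensional open set, which invariance of domain makes a neighbourhood of the
  interior points of \<open>r\<close>. A small step from \<open>r\<close> towards \<open>v3\<close>
  would then land in one of these two cofaces, although cofaces meet only in
  \<open>r\<close>.\<close>

lemma not_three_cofaces:
  assumes r: "r \<in> V" "card r = d" "r \<noteq> {}"
    and v: "insert v1 r \<in> V" "insert v2 r \<in> V" "insert v3 r \<in> V" "v1 \<notin> r" "v2 \<notin> r" "v3 \<notin> r"
    and ne: "v1 \<noteq> v2" "v1 \<noteq> v3" "v2 \<noteq> v3"
  shows False
proof -
  let ?R = "rel_interior (convex hull r)"
  have out: "v \<notin> affine hull r" if "insert v r \<in> V" "v \<notin> r" for v
  proof
    assume "v \<in> affine hull r"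
    then have "aff_dim (insert v r) = aff_dim r" by (metis aff_dim_affine_hull hull_redundant)
    then show False using aff_dim_affine_independent[OF ind[OF that(1)]]
      aff_dim_affine_independent[OF ind[OF r(1)]] finA[OF r(1)] that(2) by simp
  qed
  have Rr: "?R \<subseteq> convex hull r" by (rule rel_interior_subset)
  have ra: "convex hull r \<subseteq> affine hull r" by (rule convex_hull_subset_affine_hull)
  have in_hull: "(1 - s) *\<^sub>R x + s *\<^sub>R v \<in> convex hull (insert v r)" if "x \<in> convex hull r" "0 \<le> s" "s \<le> 1" for x s v
  proof -
    have "x \<in> convex hull (insert v r)" using that hull_mono[of r "insert v r" convex] by blast
    moreover have "v \<in> convex hull (insert v r)" by (simp add: hull_inc)
    ultimately show ?thesis using that convex_convex_hull[of "insert v r"]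
      by (simp add: convex_alt)
  qed
  have sep: False if "insert v r \<in> V" "insert w r \<in> V" "v \<noteq> w" "v \<notin> r" "w \<notin> r" "x \<in> convex hull r" "0 < s"
    "(1 - s) *\<^sub>R x + s *\<^sub>R v \<in> convex hull (insert w r)" "s \<le> 1" for v w x s
  proof -
    have "(1 - s) *\<^sub>R x + s *\<^sub>R v \<in> convex hull (insert v r)" using in_hull that by simp
    then have "(1 - s) *\<^sub>R x + s *\<^sub>R v \<in> convex hull (insert v r \<inter> insert w r)"
      using Int[OF that(1,2)] that(8) by blast
    moreover have "insert v r \<inter> insert w r = r" using that by auto
    ultimately have "(1 - s) *\<^sub>R x + s *\<^sub>R v \<in> affine hull r" using ra by auto
    then have "v \<in> affine hull r"
      by (intro affine_combination_outside[of "1 - s" x s v 1 "(1 - s) *\<^sub>R x + s *\<^sub>R v"])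
        (use that ra in auto)
    then show False using out that by blast
  qed
  \<comment> \<open>\<open>F\<close> is bent along \<open>r\<close>: positive parameters lead
    towards \<open>v1\<close>, negative ones towards \<open>v2\<close>. The parameter supplies the
    dimension that \<open>r\<close> lacks.\<close>
  define F where "F = (\<lambda>(x, s). (1 - \<bar>s\<bar>) *\<^sub>R x + max s 0 *\<^sub>R v1 + max (-s) 0 *\<^sub>R v2 :: 'a)"
  define D where "D = ?R \<times> {-1<..<1::real}"
  have Fpos: "F (x, s) = (1 - s) *\<^sub>R x + s *\<^sub>R v1" if "0 \<le> s" for x s using that by (simp add: F_def max_def)
  have Fneg: "F (x, s) = (1 - (-s)) *\<^sub>R x + (-s) *\<^sub>R v2" if "s \<le> 0" for x s using that by (simp add: F_def max_def)
  have Fim: "F (x, s) \<in> convex hull (insert v1 r) \<union> convex hull (insert v2 r)" if "(x, s) \<in> D" for x s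
    using in_hull[of x s v1] in_hull[of x "-s" v2] Fpos[of s x] Fneg[of s x] that Rr
    by (cases "0 \<le> s") (auto simp: D_def)
  have same: "x = y \<and> s = t" if "(1 - s) *\<^sub>R x + s *\<^sub>R v = (1 - t) *\<^sub>R y + t *\<^sub>R v" "s < 1" "t < 1"
     "x \<in> convex hull r" "y \<in> convex hull r" "insert v r \<in> V" "v \<notin> r" for x y s t v
  proof -
    have "s = t"
    proof (rule ccontr)
      assume "s \<noteq> t"
      then have "v \<in> affine hull r"
        by (intro affine_combination_outside[of "1 - s" x "s - t" v "1 - t" y])
          (use that ra in \<open>auto simp: algebra_simps\<close>)
      then show False using out that by blast
    qed
    then show ?thesis using that by simp
  qed
  have inj: "inj_on F D"
  proof (rule inj_onI)
    fix p q assume pq: "p \<in> D" "q \<in> D" "F p = F q"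
    obtain x s y t where xy: "p = (x, s)" "q = (y, t)" by fastforce
    have D: "x \<in> convex hull r" "y \<in> convex hull r" "\<bar>s\<bar> < 1" "\<bar>t\<bar> < 1" using pq Rr xy by (auto simp: D_def)
    consider "0 \<le> s \<and> 0 \<le> t" | "s \<le> 0 \<and> t \<le> 0" | "0 < s \<and> t < 0" | "s < 0 \<and> 0 < t" by linarith
    then show "p = q"
    proof cases
      case 1
      then show ?thesis using same[of s x v1 t y] D pq(3) v xy by (simp add: Fpos)
    next
      case 2
      then have "x = y \<and> -s = -t" using same[of "-s" x v2 "-t" y] D pq(3) v xy Fneg[of s x] Fneg[of t y] by simp
      then show ?thesis using xy by simp
    next
      case 3
      then have "(1 - s) *\<^sub>R x + s *\<^sub>R v1 \<in> convex hull (insert v2 r)"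
        using in_hull[of y "-t" v2] D pq(3) xy Fpos[of s x] Fneg[of t y] by simp
      then show ?thesis using sep[of v1 v2 x s] 3 v ne D by auto
    next
      case 4
      then have "(1 - (-s)) *\<^sub>R x + (-s) *\<^sub>R v2 \<in> convex hull (insert v1 r)"
        using in_hull[of y t v1] D pq(3) xy Fpos[of t y] Fneg[of s x] by simp
      then show ?thesis using sep[of v2 v1 x "-s"] 4 v ne D by auto
    qed
  qed
  have cont: "continuous_on D F" unfolding F_def case_prod_unfold by (intro continuous_intros)
  have dim: "aff_dim ((affine hull r) \<times> (UNIV::real set)) = int d"
    using aff_dim_affine_independent[OF ind[OF r(1)]] r by (simp add: aff_dim_Times_real)
  have "openin (top_of_set (body V)) (F ` D)"
  proof (rule locally_euclidean_open_image[OF X _ _ _ cont _ inj])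
    show "affine ((affine hull r) \<times> (UNIV::real set))" by (simp add: affine_Times)
    show "int d \<le> aff_dim ((affine hull r) \<times> (UNIV::real set))" using dim by simp
    have "openin (top_of_set (affine hull r)) ?R"
      using openin_rel_interior[of "convex hull r"] by simp
    then show "openin (top_of_set ((affine hull r) \<times> (UNIV::real set))) D"
      unfolding D_def by (intro openin_Times) auto
    show "F ` D \<subseteq> body V" using Fim v by (force simp: body_def)
  qed
  then obtain T where T: "open T" "F ` D = body V \<inter> T" by (auto simp: openin_open)
  obtain x where x: "x \<in> ?R" using r(3) rel_interior_eq_empty[of "convex hull r"] by auto
  have "x = F (x, 0)" by (simp add: F_def)
  moreover have "(x, 0) \<in> D" using x by (simp add: D_def)
  ultimately have "x \<in> T" using T(2) by blast
  then obtain e where e: "e > 0" "ball x e \<subseteq> T" using T(1) open_contains_ball by blast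
  \<comment> \<open>The step must stay below \<open>e\<close> in length and below 1 as a convex
    coefficient; the summand 1 keeps the denominator positive.\<close>
  define s where "s = min 1 (e / (2 * (norm (v3 - x) + 1)))"
  have s: "0 < s" "s \<le> 1" using e by (auto simp: s_def add_nonneg_pos)
  let ?y = "(1 - s) *\<^sub>R x + s *\<^sub>R v3"
  have "?y - x = s *\<^sub>R (v3 - x)" by (simp add: algebra_simps)
  then have "dist x ?y = s * norm (v3 - x)" using s by (metis abs_of_pos dist_commute dist_norm norm_scaleR)
  also have "\<dots> \<le> (e / (2 * (norm (v3 - x) + 1))) * norm (v3 - x)"
    by (intro mult_right_mono) (auto simp: s_def)
  also have "\<dots> < e"
  proof -
    have "norm (v3 - x) / (norm (v3 - x) + 1) < 2" by (simp add: divide_simps add_nonneg_pos)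
    then have "e / 2 * (norm (v3 - x) / (norm (v3 - x) + 1)) < e / 2 * 2"
      using e by (intro mult_strict_left_mono) auto
    then show ?thesis by simp
  qed
  finally have "?y \<in> T" using e by auto
  moreover have y3: "?y \<in> convex hull (insert v3 r)" using in_hull s x Rr by auto
  ultimately have "?y \<in> F ` D" using T(2) v(3) by (auto simp: body_def)
  then obtain z t where "(z, t) \<in> D" "?y = F (z, t)" by (metis imageE surj_pair)
  then have "?y \<in> convex hull (insert v1 r) \<union> convex hull (insert v2 r)" using Fim[of z t] by (simp only:)
  then show False using sep[of v3 v1 x s] sep[of v3 v2 x s] v ne s x Rr by auto
qed

text \<open>More than two cofaces are excluded by \<open>not_three_cofaces\<close>. Without any
  coface, the star of an interior point \<open>x\<close> of \<open>r\<close> would lie in an affine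
  set of dimension \<open>d - 1\<close>. With a single one, the star would lie in that simplex and
  be open in its affine hull near \<open>x\<close>, so \<open>x\<close> would be a relative interior
  point of a simplex of which \<open>r\<close> is a proper face.\<close>

theorem exactly_two_cofaces:
  assumes r: "r \<in> V" "card r = d" "1 \<le> d"
  shows "card {A\<in>V. card A = Suc d \<and> r \<subseteq> A} = 2"
proof -
  have rne: "r \<noteq> {}" using r by auto
  define L where "L = {v. v \<notin> r \<and> insert v r \<in> V}"
  have eq: "{A\<in>V. card A = Suc d \<and> r \<subseteq> A} = (\<lambda>v. insert v r) ` L"
  proof (intro set_eqI iffI)
    fix A assume A: "A \<in> {A\<in>V. card A = Suc d \<and> r \<subseteq> A}"
    then have "card (A - r) = 1" using r finA[OF r(1)] by (simp add: card_Diff_subset)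
    then obtain v where "A - r = {v}" by (auto simp: card_1_singleton_iff)
    then have "A = insert v r" "v \<notin> r" using A by auto
    then show "A \<in> (\<lambda>v. insert v r) ` L" using A by (auto simp: L_def)
  next
    fix A assume "A \<in> (\<lambda>v. insert v r) ` L"
    then show "A \<in> {A\<in>V. card A = Suc d \<and> r \<subseteq> A}" using r finA[OF r(1)] by (auto simp: L_def)
  qed
  have injL: "inj_on (\<lambda>v. insert v r) L" by (auto simp: inj_on_def L_def)
  have "finite ((\<lambda>v. insert v r) ` L)" using V unfolding eq[symmetric] by (simp add: geometric_complex_def)
  then have finL: "finite L" using injL finite_imageD by blast
  have le: "card L \<le> 2"
  proof (rule ccontr)
    assume "\<not> card L \<le> 2"
    then obtain T where "T \<subseteq> L" "card T = 3" using obtain_subset_with_card_n[of 3 L] by auto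
    then obtain a b c where "T = {a, b, c}" "a \<noteq> b" "a \<noteq> c" "b \<noteq> c" by (auto simp: card_3_iff)
    then show False using not_three_cofaces[OF r(1,2) rne, of a b c] \<open>T \<subseteq> L\<close> by (auto simp: L_def)
  qed
  obtain x where x: "x \<in> rel_interior (convex hull r)"
    using rne rel_interior_eq_empty[of "convex hull r"] by auto
  obtain G where G: "openin (top_of_set (body V)) G" "x \<in> G" "\<And>y. y \<in> G \<Longrightarrow> \<exists>A\<in>V. r \<subseteq> A \<and> y \<in> convex hull A"
    using geometric_complex_star[OF V r(1) x] by blast
  have cof: "A = r \<or> (\<exists>v\<in>L. A = insert v r)" if A: "A \<in> V" "r \<subseteq> A" for A
  proof (cases "card A = Suc d")
    case True
    then show ?thesis using that eq by blast
  next
    case False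
    then have "card A \<le> card r" using geometric_complex_card_le[OF A(1)] r by simp
    then show ?thesis using A finA card_seteq by blast
  qed
  have "\<not> L \<subseteq> {v}" for v
  proof
    assume L: "L \<subseteq> {v}"
    show False
    proof (cases "L = {}")
      case True
      have "G \<subseteq> affine hull r"
      proof
        fix y assume "y \<in> G"
        then obtain B where "B \<in> V" "r \<subseteq> B" "y \<in> convex hull B" using G(3) by blast
        then show "y \<in> affine hull r"
          using cof[of B] True convex_hull_subset_affine_hull[of r] by auto
      qed
      then have "int d \<le> aff_dim (affine hull r)"
        using locally_euclidean_in_affine(1)[OF X G(1,2)] affine_affine_hull by blast
      then show False using aff_dim_affine_independent[OF ind[OF r(1)]] r by simp
    next
      case False
      then have Lv: "L = {v}" using L by auto
      let ?A = "insert v r"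
      have A: "?A \<in> V" "v \<notin> r" using Lv by (auto simp: L_def)
      have sub: "G \<subseteq> convex hull ?A"
      proof
        fix y assume "y \<in> G"
        then obtain B where "B \<in> V" "r \<subseteq> B" "y \<in> convex hull B" using G(3) by blast
        then show "y \<in> convex hull ?A" using cof[of B] Lv hull_mono[of r ?A convex] by auto
      qed
      have dimA: "aff_dim (affine hull ?A) = int d"
        using aff_dim_affine_independent[OF ind[OF A(1)]] r A finA[OF r(1)] by simp
      have "G \<subseteq> affine hull ?A" using sub convex_hull_subset_affine_hull by blast
      then obtain G' where G': "x \<in> G'" "G' \<subseteq> G" "openin (top_of_set (affine hull ?A)) G'"
        using locally_euclidean_in_affine(2)[OF X G(1,2) _ affine_affine_hull] dimA by (metis order_refl)
      then have "G' \<subseteq> rel_interior (convex hull ?A)"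
        by (intro rel_interior_maximal) (use sub in auto)
      moreover have "x \<in> convex hull r" using x rel_interior_subset by blast
      ultimately show False using proper_face_avoids_rel_interior[OF ind[OF A(1)], of r] G'(1) A(2) by blast
    qed
  qed
  then have "L \<noteq> {}" "\<not> (\<exists>v. L = {v})" by blast+
  then have "card L \<noteq> 0" "card L \<noteq> 1" using finL by (auto simp: card_1_singleton_iff)
  then show ?thesis unfolding eq using le injL by (simp add: card_image)
qed

end

section \<open>Symmetric triangulations\<close>

definition cell_chain :: "'a set set \<Rightarrow> 'a set set \<Rightarrow> bool" where
  "cell_chain \<C> A \<longleftrightarrow> A \<subseteq> \<C> \<and> (\<forall>X\<in>A. \<forall>Y\<in>A. X \<subseteq> Y \<or> Y \<subseteq> X)"

lemma cell_chain_mono: "cell_chain \<C> A \<Longrightarrow> B \<subseteq> A \<Longrightarrow> cell_chain \<C> B"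
  unfolding cell_chain_def by (meson subsetD subset_trans)

lemma cell_chain_mem: "cell_chain \<C> A \<Longrightarrow> X \<in> A \<Longrightarrow> X \<in> \<C>"
  unfolding cell_chain_def by (meson subsetD)

lemma cell_chain_linear: "cell_chain \<C> A \<Longrightarrow> X \<in> A \<Longrightarrow> Y \<in> A \<Longrightarrow> X \<subseteq> Y \<or> Y \<subseteq> X"
  unfolding cell_chain_def by meson

lemma cell_chain_insert: "cell_chain \<C> A \<Longrightarrow> X \<in> \<C> \<Longrightarrow> (\<And>Y. Y \<in> A \<Longrightarrow> Y \<subseteq> X) \<Longrightarrow> cell_chain \<C> (insert X A)"
  unfolding cell_chain_def by (simp add: ball_simps)

lemma cell_chain_finite: "finite \<C> \<Longrightarrow> cell_chain \<C> A \<Longrightarrow> finite A"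
  unfolding cell_chain_def by (meson finite_subset)

text \<open>The barycentres \<open>p X\<close> may be any relative interior points of the cells;
  this freedom is later used to choose them antipodally.\<close>

definition barycentric_complex :: "('a::euclidean_space set \<Rightarrow> 'a) \<Rightarrow> 'a set set \<Rightarrow> 'a set set" where
  "barycentric_complex p \<C> = {p ` A |A. cell_chain \<C> A}"

context
  fixes \<C> :: "'a::euclidean_space set set" and p :: "'a set \<Rightarrow> 'a"
  assumes fin: "finite \<C>"
    and cvx: "\<And>X. X \<in> \<C> \<Longrightarrow> convex X"
    and cpt: "\<And>X. X \<in> \<C> \<Longrightarrow> compact X"
    and cov: "\<And>x. x \<in> \<Union>\<C> \<Longrightarrow> \<exists>X\<in>\<C>. x \<in> rel_interior X"
    and face: "\<And>X Y. X \<in> \<C> \<Longrightarrow> Y \<in> \<C> \<Longrightarrow> rel_interior X \<inter> Y \<noteq> {} \<Longrightarrow> X face_of Y"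
    and p: "\<And>X. X \<in> \<C> \<Longrightarrow> p X \<in> rel_interior X"
begin

private lemma pX: "X \<in> \<C> \<Longrightarrow> p X \<in> X"
  using p rel_interior_subset by blast

text \<open>Together with \<open>cov\<close> this makes the relative interiors of the cells a
  partition of their union.\<close>

private lemma cell_eqI: "X \<in> \<C> \<Longrightarrow> Y \<in> \<C> \<Longrightarrow> x \<in> rel_interior X \<Longrightarrow> x \<in> rel_interior Y \<Longrightarrow> X = Y"
  using face[of X Y] face[of Y X] rel_interior_subset[of X] rel_interior_subset[of Y]
    face_of_imp_subset[of X Y] face_of_imp_subset[of Y X] by blast

private lemma p_inj: "inj_on p \<C>"
  using p by (metis cell_eqI inj_onI)

private lemma subset_face: "X \<in> \<C> \<Longrightarrow> Y \<in> \<C> \<Longrightarrow> X \<subseteq> Y \<Longrightarrow> X face_of Y"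
  using face[of X Y] p[of X] pX[of X] by blast

text \<open>The barycentres of the smaller cells all lie in the second largest cell, a proper face
  of the top cell \<open>X\<close>. The last clause is about the affine hull, not only the convex
  one, because independence of the barycentres depends on it.\<close>

private lemma chain_max:
  assumes "cell_chain \<C> A" "A \<noteq> {}"
  obtains X where "X \<in> A" "\<And>Y. Y \<in> A \<Longrightarrow> Y \<subseteq> X" "convex hull (p ` A) \<subseteq> X"
    "affine hull (p ` (A - {X})) \<inter> rel_interior X = {}"
proof -
  have *: "\<exists>X\<in>A. \<forall>Y\<in>A. Y \<subseteq> X" if ch: "cell_chain \<C> A" and ne: "A \<noteq> {}" for A
  proof -
    have "finite A" using cell_chain_finite[OF fin ch] .
    then obtain X where X: "X \<in> A" "\<And>Y. Y \<in> A \<Longrightarrow> X \<subseteq> Y \<Longrightarrow> X = Y"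
      using finite_has_maximal[OF \<open>finite A\<close> ne] by blast
    have "Y \<subseteq> X" if "Y \<in> A" for Y
      using X that cell_chain_linear[OF ch] by blast
    then show ?thesis using X(1) by blast
  qed
  obtain X where X: "X \<in> A" "\<And>Y. Y \<in> A \<Longrightarrow> Y \<subseteq> X" using *[OF assms] by blast
  have AC: "\<And>Y. Y \<in> A \<Longrightarrow> Y \<in> \<C>" using cell_chain_mem[OF assms(1)] .
  have XC: "X \<in> \<C>" using X AC by blast
  have "p ` A \<subseteq> X" using X pX AC by blast
  then have hull: "convex hull (p ` A) \<subseteq> X" using cvx[OF XC] by (simp add: hull_minimal)
  have "affine hull (p ` (A - {X})) \<inter> rel_interior X = {}"
  proof (cases "A - {X} = {}")
    case False
    have "cell_chain \<C> (A - {X})" using cell_chain_mono[OF assms(1)] by blast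
    then obtain Y where Y: "Y \<in> A - {X}" "\<forall>Z\<in>A - {X}. Z \<subseteq> Y" using *[OF _ False] by blast
    then have "p ` (A - {X}) \<subseteq> Y" using pX AC by blast
    then have "affine hull (p ` (A - {X})) \<subseteq> affine hull Y" by (rule hull_mono)
    moreover have "Y face_of X" using subset_face[of Y X] X Y AC by blast
    then have "affine hull Y \<inter> rel_interior X = {}"
      using affine_hull_face_of_disjoint_rel_interior[of X Y] cvx[OF XC] Y by blast
    ultimately show ?thesis by blast
  next
    case True
    show ?thesis unfolding True by simp
  qed
  then show ?thesis using that X hull by blast
qed

text \<open>The barycentre of the top cell lies outside the affine hull of the others.\<close>

private lemma chain_independent:
  assumes "cell_chain \<C> A"
  shows "\<not> affine_dependent (p ` A)"
proof -
  have "finite A" using cell_chain_finite[OF fin assms] .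
  then show ?thesis using assms
  proof (induction A rule: finite_psubset_induct)
    case (psubset A)
    show ?case
    proof (cases "A = {}")
      case False
      obtain X where X: "X \<in> A" "\<And>Z. Z \<in> A \<Longrightarrow> Z \<subseteq> X" "convex hull (p ` A) \<subseteq> X"
        "affine hull (p ` (A - {X})) \<inter> rel_interior X = {}"
        by (rule chain_max[OF psubset.prems False]) (rule that)
      have "\<not> affine_dependent (p ` (A - {X}))" 

        by (rule psubset.IH) (use X(1) cell_chain_mono[OF psubset.prems, of "A - {X}"] in auto)
      moreover have "p X \<notin> affine hull (p ` (A - {X}))"
        using X(1,4) p[OF cell_chain_mem[OF psubset.prems]] by blast
      ultimately have "\<not> affine_dependent (insert (p X) (p ` (A - {X})))"
        by (rule affine_independent_insert)
      moreover have "insert (p X) (p ` (A - {X})) = p ` A" using X(1) by blast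
      ultimately show ?thesis by simp
    qed simp
  qed
qed

text \<open>The simplex is a cone with apex \<open>p X\<close>. A point strictly between apex and
  base is in the relative interior of \<open>X\<close>, because the apex is and the base lies in
  \<open>X\<close>.\<close>

private lemma chain_hull_cases:
  assumes A: "cell_chain \<C> A" and X: "X \<in> A" "convex hull (p ` A) \<subseteq> X" and x: "x \<in> convex hull (p ` A)"
  obtains "x \<in> convex hull (p ` (A - {X}))" | "x = p X" |
    t z where "0 < t" "t < 1" "z \<in> convex hull (p ` (A - {X}))" "x = (1 - t) *\<^sub>R p X + t *\<^sub>R z"
      "x \<in> rel_interior X"
proof -
  have XC: "X \<in> \<C>" using X(1) cell_chain_mem[OF A] by blast
  have eq: "p ` A = insert (p X) (p ` (A - {X}))" using X by blast
  show ?thesis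
  proof (cases "A - {X} = {}")
    case True
    then have "x = p X" using x eq by (metis convex_hull_singleton image_empty singletonD)
    then show ?thesis using that by blast
  next
    case False
    then have "p ` (A - {X}) \<noteq> {}" by blast
    then obtain u v b where b: "0 \<le> u" "0 \<le> v" "u + v = 1" "b \<in> convex hull (p ` (A - {X}))"
      "x = u *\<^sub>R p X + v *\<^sub>R b"
      using x unfolding eq convex_hull_insert[OF \<open>p ` (A - {X}) \<noteq> {}\<close>] by blast
    show ?thesis
    proof (cases "u = 0 \<or> v = 0")
      case True
      then show ?thesis using that b by fastforce
    next
      case False
      have "b \<in> X" using b(4) X(2) hull_mono[of "p ` (A - {X})" "p ` A" convex] by blast
      then have "b \<in> closure X" using closure_subset by blast
      moreover have "x = b - u *\<^sub>R (b - p X)"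
      proof -
        have v: "v = 1 - u" using b by simp
        show ?thesis unfolding b(5) v by (simp add: algebra_simps)
      qed
      ultimately have "x \<in> rel_interior X"
        using rel_interior_closure_convex_shrink[OF cvx[OF XC] p[OF XC], of b u] b False by auto
      then show ?thesis using that(3)[of v b] b False by (simp add: eq_diff_eq)
    qed
  qed
qed

text \<open>A common point outside both bases lies in the relative interiors of both top cells,
  which therefore coincide. Projecting from the common apex moves the point into both bases: a ray
  from the apex contains only one point of \<open>X\<close> outside the relative interior, so the
  two projections agree and induction applies to the bases.\<close>

private lemma chain_hull_Int:
  assumes "cell_chain \<C> A" "cell_chain \<C> B"
  shows "convex hull (p ` A) \<inter> convex hull (p ` B) \<subseteq> convex hull (p ` (A \<inter> B))"
  using assms
proof (induction "card A + card B" arbitrary: A B rule: less_induct)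
  case less
  have fAB: "finite A" "finite B" using cell_chain_finite[OF fin] less.prems by blast+
  show ?case
  proof
    fix x assume x: "x \<in> convex hull (p ` A) \<inter> convex hull (p ` B)"
    then have ne: "A \<noteq> {}" "B \<noteq> {}" by auto
    obtain X where X': "X \<in> A" "\<And>Z. Z \<in> A \<Longrightarrow> Z \<subseteq> X" "convex hull (p ` A) \<subseteq> X"
        "affine hull (p ` (A - {X})) \<inter> rel_interior X = {}"
      by (rule chain_max[OF less.prems(1) ne(1)]) (rule that)
    note X = X'(1,3,4)
    obtain Y where Y': "Y \<in> B" "\<And>Z. Z \<in> B \<Longrightarrow> Z \<subseteq> Y" "convex hull (p ` B) \<subseteq> Y"
        "affine hull (p ` (B - {Y})) \<inter> rel_interior Y = {}"
      by (rule chain_max[OF less.prems(2) ne(2)]) (rule that)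
    note Y = Y'(1,3,4)
    have XY: "X \<in> \<C>" "Y \<in> \<C>" using X(1) Y(1) less.prems cell_chain_mem by blast+
    have cA: "cell_chain \<C> (A - {X})" and cB: "cell_chain \<C> (B - {Y})"
      using less.prems cell_chain_mono by (metis Diff_subset)+
    have ltA: "card (A - {X}) < card A" and ltB: "card (B - {Y}) < card B"
      using X Y fAB by (simp_all add: card_Diff1_less del: card_Diff_insert)
    have IHA: "convex hull (p ` (A - {X})) \<inter> convex hull (p ` B) \<subseteq> convex hull (p ` ((A - {X}) \<inter> B))"
      using less.hyps[OF _ cA less.prems(2)] ltA by simp
    have IHB: "convex hull (p ` A) \<inter> convex hull (p ` (B - {Y})) \<subseteq> convex hull (p ` (A \<inter> (B - {Y})))"
      using less.hyps[OF _ less.prems(1) cB] ltB by simp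
    have IHAB: "convex hull (p ` (A - {X})) \<inter> convex hull (p ` (B - {Y})) \<subseteq> convex hull (p ` ((A - {X}) \<inter> (B - {Y})))"
      using less.hyps[OF _ cA cB] ltA ltB by simp
    have mono: "convex hull (p ` C) \<subseteq> convex hull (p ` (A \<inter> B))" if "C \<subseteq> A \<inter> B" for C
      using that by (intro hull_mono image_mono)
    show "x \<in> convex hull (p ` (A \<inter> B))"
    proof (cases "x \<in> convex hull (p ` (A - {X})) \<or> x \<in> convex hull (p ` (B - {Y}))")
      case True
      then show ?thesis using IHA IHB mono[of "(A - {X}) \<inter> B"] mono[of "A \<inter> (B - {Y})"] x by blast
    next
      case False
      have xX: "x \<in> rel_interior X"
        by (rule chain_hull_cases[OF less.prems(1) X(1,2), of x]) (use x False p XY in blast)+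
      have xY: "x \<in> rel_interior Y"
        by (rule chain_hull_cases[OF less.prems(2) Y(1,2), of x]) (use x False p XY in blast)+
      have eq: "X = Y" using cell_eqI xX xY XY by blast
      have pin: "p X \<in> convex hull (p ` (A \<inter> B))" using X(1) Y(1) eq by (simp add: hull_inc)
      show ?thesis
      proof (cases "x = p X")
        case False
        obtain t z where z: "0 < t" "t < 1" "z \<in> convex hull (p ` (A - {X}))" "x = (1 - t) *\<^sub>R p X + t *\<^sub>R z"
          by (rule chain_hull_cases[OF less.prems(1) X(1,2), of x])
            (use x False \<open>\<not> (x \<in> convex hull (p ` (A - {X})) \<or> x \<in> convex hull (p ` (B - {Y})))\<close> in blast)+
        obtain s w where w: "0 < s" "s < 1" "w \<in> convex hull (p ` (B - {X}))" "x = (1 - s) *\<^sub>R p X + s *\<^sub>R w"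
          by (rule chain_hull_cases[OF less.prems(2) Y(1,2), of x])
            (use x eq False \<open>\<not> (x \<in> convex hull (p ` (A - {X})) \<or> x \<in> convex hull (p ` (B - {Y})))\<close> in blast)+
        have zX: "z \<in> X" "z \<notin> rel_interior X"
          using z(3) X hull_mono[of "p ` (A - {X})" "p ` A" convex] convex_hull_subset_affine_hull by blast+
        have wX: "w \<in> X" "w \<notin> rel_interior X"
          using w(3) Y eq hull_mono[of "p ` (B - {X})" "p ` B" convex] convex_hull_subset_affine_hull by blast+
        have tz: "t *\<^sub>R (z - p X) = s *\<^sub>R (w - p X)" using z(4) w(4) by (simp add: algebra_simps)
        \<comment> \<open>Of two points of \<open>X\<close> on a ray from \<open>p X\<close>, the
          nearer one is in the relative interior.\<close>
        have no: False if "0 < a" "a < b" "a *\<^sub>R (u - p X) = b *\<^sub>R (v - p X)" "u \<in> X" "v \<notin> rel_interior X" for a b u v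
        proof -
          have "v - p X = (1/b) *\<^sub>R (b *\<^sub>R (v - p X))" using that(1,2) by simp
          also have "\<dots> = (a/b) *\<^sub>R (u - p X)" unfolding that(3)[symmetric] by simp
          finally have "v - p X = (a/b) *\<^sub>R (u - p X)" .
          then have "v = u - (1 - a/b) *\<^sub>R (u - p X)" by (simp add: algebra_simps)
          moreover have "u \<in> closure X" using that closure_subset by blast
          ultimately have "v \<in> rel_interior X"
            using rel_interior_closure_convex_shrink[OF cvx[OF XY(1)] p[OF XY(1)], of u "1 - a/b"] that
            by (simp add: divide_simps)
          then show False using that by blast
        qed
        have "t = s" using no[of t s z w] no[of s t w z] tz z w zX wX by (metis linorder_neqE_linordered_idom)
        then have "z = w" using tz z by simp
        then have "z \<in> convex hull (p ` (A \<inter> B))" using IHAB z w eq mono[of "(A - {X}) \<inter> (B - {X})"] by blast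
        then show ?thesis using pin z convex_convex_hull[of "p ` (A \<inter> B)"] by (simp add: convex_alt)
      qed (use pin in simp)
    qed
  qed
qed

text \<open>The ray from \<open>p X\<close> through \<open>x\<close> leaves the cell at a point
  \<open>z\<close> in the relative interior of a proper face. The chain that covers \<open>z\<close>
  is extended by \<open>X\<close>; the induction is on the number of cells below.\<close>

private lemma chain_cover:
  assumes "X \<in> \<C>" "x \<in> rel_interior X"
  shows "\<exists>A. cell_chain \<C> A \<and> (\<forall>Y\<in>A. Y \<subseteq> X) \<and> x \<in> convex hull (p ` A)"
  using assms
proof (induction "card {Y\<in>\<C>. Y \<subset> X}" arbitrary: x X rule: less_induct)
  case less
  show ?case
  proof (cases "x = p X")
    case True
    then show ?thesis using less.prems by (intro exI[of _ "{X}"]) (auto simp: cell_chain_def)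
  next
    case False
    have "p X + (x - p X) \<in> affine hull X"
      using less.prems(2) rel_interior_subset hull_subset[of X affine] by fastforce
    then obtain d where d: "0 < d" "p X + d *\<^sub>R (x - p X) \<in> rel_frontier X"
      using ray_to_rel_frontier[OF compact_imp_bounded[OF cpt[OF less.prems(1)]] p[OF less.prems(1)], of "x - p X"] False
      by auto
    define z where "z = p X + d *\<^sub>R (x - p X)"
    have z: "z \<in> X" "z \<notin> rel_interior X"
      using d(2) cpt[OF less.prems(1)] by (auto simp: z_def rel_frontier_def compact_imp_closed)
    \<comment> \<open>The segment from \<open>p X\<close> to \<open>x\<close> stays in the relative
      interior, so the frontier is reached only beyond \<open>x\<close>.\<close>
    have d1: "1 < d"
    proof (rule ccontr)
      assume "\<not> 1 < d"
      then have "z = (1 - d) *\<^sub>R p X + d *\<^sub>R x" "d \<le> 1" by (auto simp: z_def algebra_simps)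
      then have "z \<in> rel_interior X"
        using p[OF less.prems(1)] less.prems(2) d(1) convex_rel_interior[OF cvx[OF less.prems(1)]]
        by (auto simp: convex_alt)
      then show False using z by blast
    qed
    obtain Y where Y: "Y \<in> \<C>" "z \<in> rel_interior Y" using cov z less.prems by blast
    then have "Y face_of X" using face[of Y X] z less.prems by blast
    then have YX: "Y \<subset> X" using Y(2) z(2) face_of_imp_subset by blast
    have "card {Z\<in>\<C>. Z \<subset> Y} < card {Z\<in>\<C>. Z \<subset> X}"
      by (rule psubset_card_mono) (use fin YX Y in auto)
    from less.hyps[OF this Y] obtain A
      where "cell_chain \<C> A \<and> (\<forall>Z\<in>A. Z \<subseteq> Y) \<and> z \<in> convex hull (p ` A)" ..
    then have A: "cell_chain \<C> A" "\<forall>Z\<in>A. Z \<subseteq> Y" "z \<in> convex hull (p ` A)" by simp_all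
    have "x = (1 - 1/d) *\<^sub>R p X + (1/d) *\<^sub>R z"
    proof -
      have "(1/d) *\<^sub>R (d *\<^sub>R (x - p X)) = x - p X" using d(1) by simp
      then show ?thesis unfolding z_def by (simp only: scaleR_add_right) (simp add: algebra_simps)
    qed
    moreover have "p X \<in> convex hull (p ` insert X A)" by (simp add: hull_inc)
    moreover have "z \<in> convex hull (p ` insert X A)"
      using A(3) hull_mono[of "p ` A" "p ` insert X A" convex] by blast
    ultimately have "x \<in> convex hull (p ` insert X A)"
      using d1 convex_convex_hull[of "p ` insert X A"] by (simp add: convex_alt)
    moreover have "cell_chain \<C> (insert X A)" "\<forall>Z\<in>insert X A. Z \<subseteq> X"
      using A YX less.prems by (auto intro!: cell_chain_insert)
    ultimately show ?thesis by blast
  qed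
qed

theorem geometric_barycentric_complex: "geometric_complex (barycentric_complex p \<C>)"
proof -
  have "barycentric_complex p \<C> \<subseteq> (\<lambda>A. p ` A) ` Pow \<C>" by (auto simp: barycentric_complex_def cell_chain_def)
  then have "finite (barycentric_complex p \<C>)" using fin finite_subset by blast
  moreover have "\<not> affine_dependent s \<and> Pow s \<subseteq> barycentric_complex p \<C>" if "s \<in> barycentric_complex p \<C>" for s
  proof -
    obtain A where A: "s = p ` A" "cell_chain \<C> A" using \<open>s \<in> _\<close> unfolding barycentric_complex_def by blast
    have "s' \<in> barycentric_complex p \<C>" if "s' \<subseteq> s" for s'
    proof -
      obtain B where B: "B \<subseteq> A" "s' = p ` B" using \<open>s' \<subseteq> s\<close> A(1) by (auto simp: subset_image_iff)
      then have "cell_chain \<C> B" using A(2) cell_chain_mono by blast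
      then show ?thesis unfolding barycentric_complex_def using B by blast
    qed
    then have "Pow s \<subseteq> barycentric_complex p \<C>" by blast
    then show ?thesis using chain_independent[OF A(2)] A(1) by simp
  qed
  moreover have "convex hull s \<inter> convex hull s' \<subseteq> convex hull (s \<inter> s')"
    if s: "s \<in> barycentric_complex p \<C>" and s': "s' \<in> barycentric_complex p \<C>" for s s'
  proof -
    obtain A where A: "s = p ` A" "cell_chain \<C> A" using s unfolding barycentric_complex_def by blast
    obtain B where B: "s' = p ` B" "cell_chain \<C> B" using s' unfolding barycentric_complex_def by blast
    have "p ` A \<inter> p ` B = p ` (A \<inter> B)" 
      by (rule inj_on_image_Int[OF p_inj, symmetric]) (use A B in \<open>auto simp: cell_chain_def\<close>)
    then show ?thesis using chain_hull_Int[OF A(2) B(2)] A(1) B(1) by simp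
  qed
  ultimately show ?thesis unfolding geometric_complex_def by blast
qed

theorem barycentric_complex_subset_cell:
  assumes "s \<in> barycentric_complex p \<C>" "s \<noteq> {}"
  shows "\<exists>X\<in>\<C>. convex hull s \<subseteq> X"
proof -
  obtain A where A: "s = p ` A" "cell_chain \<C> A" using assms(1) unfolding barycentric_complex_def by blast
  have "A \<noteq> {}" using A assms by blast
  obtain X where X: "X \<in> A" "\<And>Z. Z \<in> A \<Longrightarrow> Z \<subseteq> X" "convex hull (p ` A) \<subseteq> X"
        "affine hull (p ` (A - {X})) \<inter> rel_interior X = {}"
    by (rule chain_max[OF A(2) \<open>A \<noteq> {}\<close>]) (rule that)
  then show ?thesis using A(1) cell_chain_mem[OF A(2) X(1)] X(3) by auto
qed

theorem body_barycentric_complex: "body (barycentric_complex p \<C>) = \<Union>\<C>"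
proof
  show "body (barycentric_complex p \<C>) \<subseteq> \<Union>\<C>"
    using barycentric_complex_subset_cell unfolding body_def by fastforce
  show "\<Union>\<C> \<subseteq> body (barycentric_complex p \<C>)"
  proof
    fix x assume "x \<in> \<Union>\<C>"
    then obtain X where X: "X \<in> \<C>" "x \<in> rel_interior X" using cov by blast
    from chain_cover[OF X] obtain A
      where "cell_chain \<C> A \<and> (\<forall>Z\<in>A. Z \<subseteq> X) \<and> x \<in> convex hull (p ` A)" ..
    then have "p ` A \<in> barycentric_complex p \<C>" "x \<in> convex hull (p ` A)"
      unfolding barycentric_complex_def by blast+
    then show "x \<in> body (barycentric_complex p \<C>)" unfolding body_def by blast
  qed
qed

end

section \<open>Cells of a hyperplane arrangement\<close>

text \<open>The closed cell of the arrangement of hyperplanes \<open>a \<bullet> z = b\<close> in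
  which \<open>x\<close> is a relative interior point. If \<open>x\<close> lies on a hyperplane,
  both implications fire and force equality.\<close>

definition sign_cell :: "('a::euclidean_space \<times> real) set \<Rightarrow> 'a \<Rightarrow> 'a set" where
  "sign_cell H x = {z. \<forall>(a, b)\<in>H. (a \<bullet> x \<le> b \<longrightarrow> a \<bullet> z \<le> b) \<and> (b \<le> a \<bullet> x \<longrightarrow> b \<le> a \<bullet> z)}"

lemma sign_cell_self: "x \<in> sign_cell H x"
  by (auto simp: sign_cell_def)

lemma sign_cell_mono: "z \<in> sign_cell H x \<Longrightarrow> sign_cell H z \<subseteq> sign_cell H x"
  by (fastforce simp: sign_cell_def)

lemma sign_cell_eq_Inter:
  "sign_cell H x = (\<Inter>(a, b)\<in>{(a, b)\<in>H. a \<bullet> x \<le> b}. {z. a \<bullet> z \<le> b}) \<inter> (\<Inter>(a, b)\<in>{(a, b)\<in>H. b \<le> a \<bullet> x}. {z. a \<bullet> z \<ge> b})"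
  by (auto simp: sign_cell_def)

lemma convex_sign_cell: "convex (sign_cell H x)"
  unfolding sign_cell_eq_Inter
  by (intro convex_Int convex_INT) (auto intro: convex_halfspace_le convex_halfspace_ge)

lemma closed_sign_cell: "closed (sign_cell H x)"
  unfolding sign_cell_eq_Inter
  by (intro closed_Int closed_INT) (auto intro: closed_halfspace_le closed_halfspace_ge)

text \<open>Inside the cell of \<open>y\<close>, both ends of a segment lie weakly on the same side
  of each hyperplane. If an inner point lies on the hyperplane, so do both ends.\<close>

lemma sign_cell_face:
  assumes "z \<in> sign_cell H y"
  shows "sign_cell H z face_of sign_cell H y"
  unfolding face_of_def
proof (intro conjI ballI impI)
  show "sign_cell H z \<subseteq> sign_cell H y" using assms by (rule sign_cell_mono)
  show "convex (sign_cell H z)" by (rule convex_sign_cell)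
  have *: "u \<in> sign_cell H z" if u: "u \<in> sign_cell H y" and v: "v \<in> sign_cell H y" and w: "w \<in> sign_cell H z"
    and t: "w = (1 - t) *\<^sub>R u + t *\<^sub>R v" "0 < t" "t < 1" for u v w t
    unfolding sign_cell_def
  proof (clarify)
    fix a b assume ab: "(a, b) \<in> H"
    have tw: "a \<bullet> w = (1 - t) * (a \<bullet> u) + t * (a \<bullet> v)" by (simp add: t inner_add_right)
    have Y: "(a \<bullet> y \<le> b \<longrightarrow> a \<bullet> u \<le> b \<and> a \<bullet> v \<le> b \<and> a \<bullet> z \<le> b) \<and> (b \<le> a \<bullet> y \<longrightarrow> b \<le> a \<bullet> u \<and> b \<le> a \<bullet> v \<and> b \<le> a \<bullet> z)"
      using u v assms ab by (auto simp: sign_cell_def)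
    have Z: "(a \<bullet> z \<le> b \<longrightarrow> a \<bullet> w \<le> b) \<and> (b \<le> a \<bullet> z \<longrightarrow> b \<le> a \<bullet> w)"
      using w ab by (auto simp: sign_cell_def)
    have eq: "a \<bullet> u = b" if "a \<bullet> z = b"
    proof -
      have wb: "(1 - t) * (a \<bullet> u) + t * (a \<bullet> v) = b" using Z that tw by auto
      have *: "(1 - t) * (a \<bullet> u - b) + t * (a \<bullet> v - b) = 0" using wb by (simp add: algebra_simps)
      show ?thesis
      proof (cases "a \<bullet> y \<le> b")
        case True
        then have "(1 - t) * (a \<bullet> u - b) \<le> 0" "t * (a \<bullet> v - b) \<le> 0" using Y t
          by (auto simp: mult_le_0_iff)
        then have "(1 - t) * (a \<bullet> u - b) = 0" using * by linarith
        then show ?thesis using t by simp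
      next
        case False
        then have "(1 - t) * (a \<bullet> u - b) \<ge> 0" "t * (a \<bullet> v - b) \<ge> 0" using Y t by auto
        then have "(1 - t) * (a \<bullet> u - b) = 0" using * by linarith
        then show ?thesis using t by simp
      qed
    qed
    show "(a \<bullet> z \<le> b \<longrightarrow> a \<bullet> u \<le> b) \<and> (b \<le> a \<bullet> z \<longrightarrow> b \<le> a \<bullet> u)"
      using eq Y by (cases "a \<bullet> z" b rule: linorder_cases; cases "a \<bullet> y" b rule: linorder_cases) auto
  qed
  fix u v w assume uv: "u \<in> sign_cell H y" "v \<in> sign_cell H y" "w \<in> sign_cell H z" "w \<in> open_segment u v"
  then obtain t where t: "w = (1 - t) *\<^sub>R u + t *\<^sub>R v" "0 < t" "t < 1" by (auto simp: in_segment)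
  show "u \<in> sign_cell H z" using *[OF uv(1-3) t] .
  have "w = (1 - (1 - t)) *\<^sub>R v + (1 - t) *\<^sub>R u" using t by simp
  then show "v \<in> sign_cell H z" using *[OF uv(2,1,3), of "1 - t"] t by simp
qed

text \<open>The inequalities strict at \<open>x\<close> are open conditions, and the equalities
  persist on the affine hull.\<close>

lemma rel_interior_sign_cell:
  assumes "finite H"
  shows "x \<in> rel_interior (sign_cell H x)"
proof -
  let ?O = "(\<Inter>(a, b)\<in>{(a, b)\<in>H. a \<bullet> x < b}. {z. a \<bullet> z < b}) \<inter> (\<Inter>(a, b)\<in>{(a, b)\<in>H. b < a \<bullet> x}. {z. a \<bullet> z > b})"
  have "finite {(a, b)\<in>H. a \<bullet> x < b}" "finite {(a, b)\<in>H. b < a \<bullet> x}"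
    using assms by (auto intro: finite_subset[of _ H])
  then have "open ?O"
    by (intro open_Int open_INT) (auto intro: open_halfspace_lt open_halfspace_gt)
  moreover have "x \<in> ?O" by auto
  moreover have "?O \<inter> affine hull (sign_cell H x) \<subseteq> sign_cell H x"
  proof
    fix z assume z: "z \<in> ?O \<inter> affine hull (sign_cell H x)"
    have "a \<bullet> z = b" if "(a, b) \<in> H" "a \<bullet> x = b" for a b
    proof -
      have "affine hull (sign_cell H x) \<subseteq> {z. a \<bullet> z = b}"
        by (rule hull_minimal) (use that in \<open>force simp: sign_cell_def affine_hyperplane\<close>)+
      then show ?thesis using z by blast
    qed
    then show "z \<in> sign_cell H x" using z by (force simp: sign_cell_def)
  qed
  ultimately show ?thesis using sign_cell_self unfolding mem_rel_interior by blast
qed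

text \<open>The segment from \<open>x\<close> to \<open>z\<close> can be prolonged beyond
  \<open>z\<close> within the cell. An affine function that obeyed a stronger sign condition at
  \<open>z\<close> than at \<open>x\<close> would violate the condition of the cell at the prolonged
  end.\<close>

lemma sign_cell_rel_interior_eq:
  assumes "z \<in> rel_interior (sign_cell H x)"
  shows "sign_cell H z = sign_cell H x"
proof
  show "sign_cell H z \<subseteq> sign_cell H x"
    using assms rel_interior_subset by (intro sign_cell_mono) blast
  have "\<exists>m>1. (1 - m) *\<^sub>R x + m *\<^sub>R z \<in> sign_cell H x"
    using convex_rel_interior_if2[OF convex_sign_cell assms] sign_cell_self hull_subset
    by (metis subsetD)
  then obtain m where m: "m > 1" "(1 - m) *\<^sub>R x + m *\<^sub>R z \<in> sign_cell H x" by blast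
  have "x \<in> sign_cell H z" unfolding sign_cell_def
  proof clarify
    fix a b assume ab: "(a, b) \<in> H"
    have "a \<bullet> ((1 - m) *\<^sub>R x + m *\<^sub>R z) = m * (a \<bullet> z - a \<bullet> x) + a \<bullet> x"
      by (simp add: inner_add_right algebra_simps)
    then have "(a \<bullet> x \<le> b \<longrightarrow> m * (a \<bullet> z - a \<bullet> x) + a \<bullet> x \<le> b) \<and> (b \<le> a \<bullet> x \<longrightarrow> b \<le> m * (a \<bullet> z - a \<bullet> x) + a \<bullet> x)"
      using m(2) ab by (fastforce simp: sign_cell_def)
    moreover have "m * (a \<bullet> z - a \<bullet> x) > 0" if "a \<bullet> z > a \<bullet> x" using that m by simp
    moreover have "m * (a \<bullet> z - a \<bullet> x) < 0" if "a \<bullet> z < a \<bullet> x" using that m by (simp add: mult_less_0_iff)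
    moreover have "m * (a \<bullet> z - a \<bullet> x) \<ge> (a \<bullet> z - a \<bullet> x)" if "a \<bullet> z \<ge> a \<bullet> x"
      using that m mult_right_mono[of 1 m "a \<bullet> z - a \<bullet> x"] by simp
    moreover have "m * (a \<bullet> z - a \<bullet> x) > (a \<bullet> z - a \<bullet> x)" if "a \<bullet> z > a \<bullet> x" using that m by simp
    moreover have "m * (a \<bullet> z - a \<bullet> x) < (a \<bullet> z - a \<bullet> x)" if "a \<bullet> z < a \<bullet> x" using that m by (simp add: mult_less_cancel_right1)
    ultimately show "(a \<bullet> z \<le> b \<longrightarrow> a \<bullet> x \<le> b) \<and> (b \<le> a \<bullet> z \<longrightarrow> b \<le> a \<bullet> x)" by (smt (verit))
  qed
  then show "sign_cell H x \<subseteq> sign_cell H z" by (rule sign_cell_mono)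
qed

text \<open>A cell depends only on two subsets of \<open>H\<close>: the hyperplanes with
  \<open>x\<close> weakly below and those with \<open>x\<close> weakly above.\<close>

lemma finite_sign_cells:
  assumes "finite H"
  shows "finite (range (sign_cell H))"
proof -
  have "sign_cell H x = (\<lambda>(P, Q). (\<Inter>(a, b)\<in>P. {z. a \<bullet> z \<le> b}) \<inter> (\<Inter>(a, b)\<in>Q. {z. a \<bullet> z \<ge> b}))
      ({(a, b)\<in>H. a \<bullet> x \<le> b}, {(a, b)\<in>H. b \<le> a \<bullet> x})" for x
    unfolding sign_cell_eq_Inter by simp
  then have "range (sign_cell H) \<subseteq> (\<lambda>(P, Q). (\<Inter>(a, b)\<in>P. {z. a \<bullet> z \<le> b}) \<inter> (\<Inter>(a, b)\<in>Q. {z. a \<bullet> z \<ge> b})) ` (Pow H \<times> Pow H)"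
    by (intro image_subsetI) (simp add: image_iff, blast)
  then show ?thesis using assms by (meson finite_Pow_iff finite_SigmaI finite_imageI finite_subset)
qed

lemma sign_cell_uminus:
  assumes "\<And>a b. (a, b) \<in> H \<Longrightarrow> (a, - b) \<in> H"
  shows "uminus ` sign_cell H x = sign_cell H (- x)"
proof -
  have *: "- z \<in> sign_cell H (- x)" if "z \<in> sign_cell H x" for x z
    using that assms unfolding sign_cell_def by (fastforce simp: minus_le_iff le_minus_iff)
  show ?thesis
  proof
    show "uminus ` sign_cell H x \<subseteq> sign_cell H (- x)" using * by blast
    show "sign_cell H (- x) \<subseteq> uminus ` sign_cell H x"
    proof
      fix z assume "z \<in> sign_cell H (- x)"
      then have "- z \<in> sign_cell H x" using *[of z "- x"] by simp
      then show "z \<in> uminus ` sign_cell H x" by (intro image_eqI[of z uminus "- z"]) simp_all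
    qed
  qed
qed

section \<open>From a symmetric polyhedron to a symmetric triangulation\<close>

lemma polytope_halfspaces:
  assumes "polytope D"
  obtains H :: "('a::euclidean_space \<times> real) set" where "finite H" "D = {z. \<forall>(a, b)\<in>H. a \<bullet> z \<le> b}"
proof -
  obtain F where F: "finite F" "D = \<Inter>F" "\<And>h. h \<in> F \<Longrightarrow> \<exists>a b. a \<noteq> 0 \<and> h = {x. a \<bullet> x \<le> b}"
    using polytope_imp_polyhedron[OF assms] unfolding polyhedron_def by metis
  then have "\<forall>h\<in>F. \<exists>ab. h = {x. fst ab \<bullet> x \<le> snd ab}" by (metis fst_conv snd_conv)
  then obtain f where f: "\<And>h. h \<in> F \<Longrightarrow> h = {x. fst (f h) \<bullet> x \<le> snd (f h)}" by metis
  show ?thesis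
  proof
    show "finite (f ` F)" using F by simp
    have "x \<in> h \<longleftrightarrow> fst (f h) \<bullet> x \<le> snd (f h)" if "h \<in> F" for h x using f[OF that] by auto
    then show "D = {z. \<forall>(a, b)\<in>f ` F. a \<bullet> z \<le> b}" unfolding F(2) by (auto simp: case_prod_unfold)
  qed
qed

text \<open>Each polytope is subdivided by itself, starting from the complex of its faces. Pieces of
  different polytopes may still overlap; the later cutting by hyperplanes repairs this.\<close>

lemma compact_polyhedron_fine:
  fixes N :: "'a::euclidean_space set"
  assumes "compact_polyhedron N" "0 < e"
  obtains F where "finite F" "N = \<Union>F" "\<And>D. D \<in> F \<Longrightarrow> polytope D" "\<And>D. D \<in> F \<Longrightarrow> diameter D < e"
proof -
  obtain G where G: "finite G" "\<forall>C\<in>G. polytope C" "N = \<Union>G" using assms by (auto simp: compact_polyhedron_def)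
  have "\<exists>F. finite F \<and> \<Union>F = C \<and> (\<forall>D\<in>F. polytope D \<and> diameter D < e)" if "C \<in> G" for C
  proof -
    have C: "polytope C" using that G by blast
    have *: "\<exists>F. finite F \<and> \<Union>F = U \<and> (\<forall>D\<in>F. polytope D \<and> diameter D < e)"
      if "finite F'" "\<Union>F' = U" "\<And>X. X \<in> F' \<Longrightarrow> diameter X < e" "\<And>X. X \<in> F' \<Longrightarrow> polytope X"
      for F' and U :: "'a set"
      using that by (intro exI[of _ F']) simp
    have "\<exists>F. finite F \<and> \<Union>F = \<Union>{f. f face_of C} \<and> (\<forall>D\<in>F. polytope D \<and> diameter D < e)"
    proof (rule cell_complex_subdivision_exists[OF assms(2) finite_polytope_faces[OF C], where d = "DIM('a)"])
      show "polytope X" if "X \<in> {f. f face_of C}" for X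
        using face_of_polytope_polytope[OF C] that by blast
      show "aff_dim X \<le> int DIM('a)" for X :: "'a set" by (rule aff_dim_le_DIM)
      show "X \<inter> Y face_of X" if "X \<in> {f. f face_of C}" "Y \<in> {f. f face_of C}" for X Y
        using that by (metis face_of_Int_Int face_of_Int inf_le1 face_of_subset face_of_imp_subset mem_Collect_eq)
    qed (rule *, assumption, assumption, simp, simp)
    moreover have "\<Union>{f. f face_of C} = C"
      using face_of_refl[OF polytope_imp_convex[OF C]] face_of_imp_subset by blast
    ultimately show ?thesis by simp
  qed
  then obtain F where F: "\<And>C. C \<in> G \<Longrightarrow> finite (F C) \<and> \<Union>(F C) = C \<and> (\<forall>D\<in>F C. polytope D \<and> diameter D < e)"
    by metis
  show ?thesis
  proof
    show "finite (\<Union>C\<in>G. F C)" using G F by blast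
    show "N = \<Union>(\<Union>C\<in>G. F C)" unfolding G(3) using F by (fastforce simp: Union_eq)
  qed (use F in blast)+
qed

text \<open>All bounding hyperplanes of the small polytopes, the hyperplanes with normals in
  \<open>L\<close>, and the mirror images of these cut \<open>N\<close> into cells. Each cell lies
  in one small polytope and on one side of every hyperplane from \<open>L\<close>; the barycentric
  subdivision inherits both properties.\<close>

theorem symmetric_triangulation:
  fixes N :: "'a::euclidean_space set"
  assumes N: "compact_polyhedron N" "uminus ` N = N" "0 \<notin> N" and e: "0 < e" and L: "finite L"
  obtains V where "geometric_complex V" "body V = N" "\<And>s. s \<in> V \<Longrightarrow> uminus ` s \<in> V"
    "\<And>s u v. s \<in> V \<Longrightarrow> u \<in> s \<Longrightarrow> v \<in> s \<Longrightarrow> dist u v < e"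
    "\<And>s a. s \<in> V \<Longrightarrow> a \<in> L \<Longrightarrow> (\<forall>v\<in>s. 0 \<le> a \<bullet> v) \<or> (\<forall>v\<in>s. a \<bullet> v \<le> 0)"
proof -
  obtain F where F: "finite F" "N = \<Union>F" "\<And>D. D \<in> F \<Longrightarrow> polytope D" "\<And>D. D \<in> F \<Longrightarrow> diameter D < e"
    by (rule compact_polyhedron_fine[OF N(1) e]) (rule that)
  have "\<exists>H. finite H \<and> D = {z. \<forall>(a, b)\<in>H. a \<bullet> z \<le> b}" if "D \<in> F" for D
    by (rule polytope_halfspaces[OF F(3)[OF that]]) blast
  then have "\<forall>D\<in>F. \<exists>H. finite H \<and> D = {z. \<forall>(a, b)\<in>H. a \<bullet> z \<le> b}" ..
  from bchoice[OF this] obtain h where "\<forall>D\<in>F. finite (h D) \<and> D = {z. \<forall>(a, b)\<in>h D. a \<bullet> z \<le> b}" ..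
  then have h: "finite (h D)" "D = {z. \<forall>(a, b)\<in>h D. a \<bullet> z \<le> b}" if "D \<in> F" for D
    using that by blast+
  \<comment> \<open>The hyperplanes from \<open>L\<close> pass through the origin; \<open>H\<close>
    adds the reflected hyperplane \<open>(a, - b)\<close> to each \<open>(a, b)\<close>.\<close>
  define H0 where "H0 = (\<Union>D\<in>F. h D) \<union> (\<lambda>a. (a, 0)) ` L"
  define H where "H = H0 \<union> (\<lambda>(a, b). (a, - b)) ` H0"
  have finH: "finite H" using F(1) h(1) L by (simp add: H_def H0_def)
  have symH: "(a, - b) \<in> H" if "(a, b) \<in> H" for a b
    using that unfolding H_def by (auto simp: image_iff; force)
  define \<C> where "\<C> = sign_cell H ` N"
  have sub: "\<exists>D\<in>F. sign_cell H x \<subseteq> D" if x: "x \<in> N" for x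
  proof -
    obtain D where D: "D \<in> F" "x \<in> D" using x F by blast
    have hDH: "h D \<subseteq> H" using D by (auto simp: H_def H0_def)
    have "x \<in> {z. \<forall>(a, b)\<in>h D. a \<bullet> z \<le> b}" by (rule subst[OF h(2)[OF D(1)], of "\<lambda>S. x \<in> S", OF D(2)])
    then have "\<forall>(a, b)\<in>h D. a \<bullet> x \<le> b" by (rule CollectD)
    then have "sign_cell H x \<subseteq> {z. \<forall>(a, b)\<in>h D. a \<bullet> z \<le> b}" using hDH by (fastforce simp: sign_cell_def)
    from subset_trans[OF this eq_refl[OF h(2)[OF D(1), symmetric]]] show ?thesis using D(1) ..
  qed
  have fin: "finite \<C>" unfolding \<C>_def
    by (rule finite_subset[OF image_mono[OF subset_UNIV] finite_sign_cells[OF finH]])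
  have UC: "\<Union>\<C> = N"
  proof
    show "\<Union>\<C> \<subseteq> N"
    proof
      fix z assume "z \<in> \<Union>\<C>"
      then obtain x where "x \<in> N" "z \<in> sign_cell H x" by (auto simp: \<C>_def)
      then show "z \<in> N" using sub[of x] F(2) by blast
    qed
    show "N \<subseteq> \<Union>\<C>" using sign_cell_self unfolding \<C>_def by blast
  qed
  have cvx: "convex X" if "X \<in> \<C>" for X using that convex_sign_cell by (auto simp: \<C>_def)
  have CF: "\<exists>D\<in>F. X \<subseteq> D" if "X \<in> \<C>" for X using that sub by (auto simp: \<C>_def)
  have cpt: "compact X" if "X \<in> \<C>" for X
  proof -
    have "closed X" using that closed_sign_cell by (auto simp: \<C>_def)
    moreover have "bounded X" using CF[OF that] F(3) polytope_imp_bounded bounded_subset by blast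
    ultimately show ?thesis by (simp add: compact_eq_bounded_closed)
  qed
  have cov: "\<exists>X\<in>\<C>. x \<in> rel_interior X" if "x \<in> \<Union>\<C>" for x
    using that rel_interior_sign_cell[OF finH] unfolding UC by (auto simp: \<C>_def)
  have face: "X face_of Y" if "X \<in> \<C>" "Y \<in> \<C>" "rel_interior X \<inter> Y \<noteq> {}" for X Y
  proof -
    obtain x y where xy: "X = sign_cell H x" "Y = sign_cell H y" using \<open>X \<in> \<C>\<close> \<open>Y \<in> \<C>\<close> by (auto simp: \<C>_def)
    obtain z where z: "z \<in> rel_interior X" "z \<in> Y" using \<open>rel_interior X \<inter> Y \<noteq> {}\<close> by blast
    then show ?thesis using sign_cell_face[of z H y] sign_cell_rel_interior_eq[of z H x] xy by simp
  qed
  have negC: "uminus ` X \<in> \<C>" if "X \<in> \<C>" for X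
  proof -
    obtain x where "x \<in> N" "X = sign_cell H x" using \<open>X \<in> \<C>\<close> by (auto simp: \<C>_def)
    then show ?thesis using sign_cell_uminus[OF symH, of x] N(2) by (auto simp: \<C>_def)
  qed
  define q where "q X = (SOME x. x \<in> rel_interior X)" for X :: "'a set"
  have q: "q X \<in> rel_interior X" if "X \<in> \<C>" for X
  proof -
    have "rel_interior X \<noteq> {}"
      using that sign_cell_self rel_interior_eq_empty[OF cvx[OF that]] by (auto simp: \<C>_def)
    then show ?thesis unfolding q_def by (metis all_not_in_conv someI_ex)
  qed
  \<comment> \<open>Averaging the chosen point of \<open>X\<close> with the reflected chosen point
    of the opposite cell makes the barycentres antipodal; convexity keeps them in the relative
    interior.\<close>
  define p where "p X = (1/2) *\<^sub>R (q X - q (uminus ` X))" for X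
  have p: "p X \<in> rel_interior X" if "X \<in> \<C>" for X
  proof -
    have "rel_interior (uminus ` X) = uminus ` rel_interior X"
      by (rule rel_interior_injective_linear_image) (auto intro: bounded_linear_minus bounded_linear_ident inj_onI)
    then have "- q (uminus ` X) \<in> rel_interior X" using q[OF negC[OF that]] by auto
    then have "(1 - 1/2) *\<^sub>R q X + (1/2) *\<^sub>R (- q (uminus ` X)) \<in> rel_interior X"
      using q[OF that] by (intro convexD_alt convex_rel_interior cvx[OF that]) auto
    then show ?thesis by (simp add: p_def algebra_simps)
  qed
  have p_neg: "p (uminus ` X) = - p X" for X by (simp add: p_def image_image algebra_simps)
  let ?V = "barycentric_complex p \<C>"
  have bary1: "geometric_complex ?V"
    by (rule geometric_barycentric_complex[where \<C> = \<C> and p = p]) (fact fin cvx cpt cov face p)+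
  have bary2: "body ?V = \<Union>\<C>"
    by (rule body_barycentric_complex[where \<C> = \<C> and p = p]) (fact fin cvx cpt cov face p)+
  have in_cell: "\<exists>X\<in>\<C>. s \<subseteq> X" if "s \<in> ?V" "s \<noteq> {}" for s
  proof -
    have "\<exists>X\<in>\<C>. convex hull s \<subseteq> X"
      by (rule barycentric_complex_subset_cell[where \<C> = \<C> and p = p]) (fact fin cvx cpt cov face p that)+
    then show ?thesis using hull_subset[of s convex] by blast
  qed
  show ?thesis
  proof
    show "geometric_complex ?V" by (rule bary1)
    show "body ?V = N" using bary2 UC by simp
    show "uminus ` s \<in> ?V" if "s \<in> ?V" for s
    proof -
      obtain A where A: "s = p ` A" "cell_chain \<C> A" using \<open>s \<in> ?V\<close> by (auto simp: barycentric_complex_def)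
      have "uminus ` s = p ` ((`) uminus ` A)" unfolding A(1) image_image p_neg ..
      moreover have "cell_chain \<C> ((`) uminus ` A)"
        using A(2) negC unfolding cell_chain_def by (auto 4 4 simp: image_mono)
      ultimately show ?thesis unfolding barycentric_complex_def by blast
    qed
    show "dist u v < e" if "s \<in> ?V" "u \<in> s" "v \<in> s" for s u v
    proof -
      have "s \<noteq> {}" using \<open>u \<in> s\<close> by blast
      then obtain X where "X \<in> \<C>" "s \<subseteq> X" using in_cell \<open>s \<in> ?V\<close> by blast
      moreover from CF[OF this(1)] obtain D where "D \<in> F" "X \<subseteq> D" ..
      ultimately have D: "D \<in> F" "u \<in> D" "v \<in> D" using \<open>u \<in> s\<close> \<open>v \<in> s\<close> by auto
      then have "dist u v \<le> diameter D"
        by (intro diameter_bounded_bound polytope_imp_bounded F(3))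
      then show ?thesis using F(4)[OF D(1)] by simp
    qed
    show "(\<forall>v\<in>s. 0 \<le> a \<bullet> v) \<or> (\<forall>v\<in>s. a \<bullet> v \<le> 0)" if "s \<in> ?V" "a \<in> L" for s a
    proof (cases "s = {}")
      case False
      then obtain x where x: "s \<subseteq> sign_cell H x" using in_cell[of s] \<open>s \<in> ?V\<close> by (auto simp: \<C>_def)
      have "(a, 0) \<in> H" using \<open>a \<in> L\<close> by (auto simp: H_def H0_def)
      then show ?thesis using x by (cases "a \<bullet> x \<le> 0") (fastforce simp: sign_cell_def)+
    qed simp
  qed
qed

section \<open>Piecewise linear maps\<close>

lemma affine_map_on_subset: "affine_map_on C f \<Longrightarrow> D \<subseteq> C \<Longrightarrow> affine_map_on D f"
  unfolding affine_map_on_def by (meson subsetD)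

lemma affine_map_on_cong: "affine_map_on C f \<Longrightarrow> (\<And>x. x \<in> C \<Longrightarrow> f x = g x) \<Longrightarrow> affine_map_on C g"
  unfolding affine_map_on_def by metis

lemma affine_map_on_linear: "linear L \<Longrightarrow> affine_map_on C (\<lambda>x. L x + b)"
  unfolding affine_map_on_def by blast

lemma affine_map_on_compose:
  assumes "affine_map_on C f" "affine_map_on D g" "f ` C \<subseteq> D"
  shows "affine_map_on C (\<lambda>x. g (f x))"
proof -
  obtain L b where L: "linear L" "\<And>x. x \<in> C \<Longrightarrow> f x = L x + b" using assms(1) unfolding affine_map_on_def by blast
  obtain K c where K: "linear K" "\<And>x. x \<in> D \<Longrightarrow> g x = K x + c" using assms(2) unfolding affine_map_on_def by blast
  have "g (f x) = (K \<circ> L) x + (K b + c)" if "x \<in> C" for x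
  proof -
    have "g (f x) = K (L x + b) + c" using K(2)[of "f x"] L(2)[OF that] assms(3) that by auto
    then show ?thesis using linear_add[OF K(1)] by (simp add: algebra_simps)
  qed
  moreover have "linear (K \<circ> L)" using L K by (simp add: linear_compose)
  ultimately show ?thesis unfolding affine_map_on_def by blast
qed

lemma affine_map_on_Pair:
  assumes "affine_map_on C f" "affine_map_on C g"
  shows "affine_map_on C (\<lambda>x. (f x, g x))"
proof -
  obtain L b where L: "linear L" "\<And>x. x \<in> C \<Longrightarrow> f x = L x + b" using assms(1) unfolding affine_map_on_def by blast
  obtain K c where K: "linear K" "\<And>x. x \<in> C \<Longrightarrow> g x = K x + c" using assms(2) unfolding affine_map_on_def by blast
  have "linear (\<lambda>x. (L x, K x))" using L K by (simp add: linear_iff)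
  moreover have "(f x, g x) = (L x, K x) + (b, c)" if "x \<in> C" for x using L K that by simp
  ultimately show ?thesis unfolding affine_map_on_def by blast
qed

lemma affine_map_on_real:
  assumes "affine_map_on C (f :: 'a::euclidean_space \<Rightarrow> real)"
  obtains a b where "\<And>x. x \<in> C \<Longrightarrow> f x = a \<bullet> x + b"
proof -
  obtain L b where L: "linear L" "\<And>x. x \<in> C \<Longrightarrow> f x = L x + b" using assms(1) unfolding affine_map_on_def by blast
  have "L x = adjoint L 1 \<bullet> x" for x using adjoint_works[OF L(1), of x 1] by (simp add: inner_commute)
  then show ?thesis using that L by metis
qed

lemma polytope_le:
  assumes "polytope C" "affine_map_on C f" "affine_map_on C g"
  shows "polytope {x\<in>C. f x \<le> (g x :: real)}"
proof -
  obtain a b where a: "\<And>x. x \<in> C \<Longrightarrow> f x = a \<bullet> x + b" using affine_map_on_real[OF assms(2)] by blast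
  obtain c d where c: "\<And>x. x \<in> C \<Longrightarrow> g x = c \<bullet> x + d" using affine_map_on_real[OF assms(3)] by blast
  have "{x\<in>C. f x \<le> g x} = C \<inter> {x. (a - c) \<bullet> x \<le> d - b}"
    using a c by (auto simp: inner_diff_left)
  then show ?thesis using assms(1) by (simp add: polytope_Int_polyhedron polyhedron_halfspace_le)
qed

lemma polytope_affine_preimage:
  assumes "polytope C" "affine_map_on C f" "polytope D"
  shows "polytope {x\<in>C. f x \<in> D}"
proof -
  obtain F where F: "finite F" "D = \<Inter>F" "\<And>h. h \<in> F \<Longrightarrow> \<exists>a b. a \<noteq> 0 \<and> h = {x. a \<bullet> x \<le> b}"
    using polytope_imp_polyhedron[OF assms(3)] unfolding polyhedron_def by metis
  have "polytope {x\<in>C. f x \<in> \<Inter>F}" using F(1,3)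
  proof (induction F)
    case empty
    then show ?case using assms by simp
  next
    case (insert h F)
    obtain a b where h: "h = {x. a \<bullet> x \<le> b}" using insert.prems by blast
    have eq: "{x\<in>C. f x \<in> \<Inter>(insert h F)} = {x\<in>C. f x \<in> \<Inter>F} \<inter> {x\<in>C. a \<bullet> f x \<le> b}"
      using h by auto
    have "affine_map_on UNIV (\<lambda>y. a \<bullet> y + 0)" by (rule affine_map_on_linear) (simp add: linear_iff inner_add_right)
    then have "affine_map_on C (\<lambda>x. a \<bullet> f x)" 
      using affine_map_on_compose[OF assms(2), of UNIV "\<lambda>y. a \<bullet> y"] by simp
    moreover have "affine_map_on C (\<lambda>x. b)"
      using affine_map_on_linear[of "\<lambda>x. 0" C b] by (simp add: linear_iff)
    ultimately have "polytope {x\<in>C. a \<bullet> f x \<le> b}" using polytope_le[OF assms(1)] by blast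
    then show ?case unfolding eq using insert by (intro polytope_Int) auto
  qed
  then show ?thesis using F(2) by simp
qed

lemma pl_map_onI: "finite F \<Longrightarrow> (\<And>C. C \<in> F \<Longrightarrow> polytope C) \<Longrightarrow> (\<And>C. C \<in> F \<Longrightarrow> affine_map_on C f) \<Longrightarrow> P = \<Union>F \<Longrightarrow> pl_map_on P f"
  unfolding pl_map_on_def by blast

lemma pl_map_onE:
  assumes "pl_map_on P f"
  obtains F where "finite F" "\<And>C. C \<in> F \<Longrightarrow> polytope C" "\<And>C. C \<in> F \<Longrightarrow> affine_map_on C f" "P = \<Union>F"
  using assms unfolding pl_map_on_def by blast

lemma pl_map_on_imp_compact_polyhedron: "pl_map_on P f \<Longrightarrow> compact_polyhedron P"
  unfolding pl_map_on_def compact_polyhedron_def by blast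

lemma compact_polyhedron_imp_compact: "compact_polyhedron P \<Longrightarrow> compact P"
  unfolding compact_polyhedron_def by (auto intro!: compact_Union dest: polytope_imp_compact)

lemma pl_map_on_cong:
  assumes "pl_map_on P f" "\<And>x. x \<in> P \<Longrightarrow> f x = g x"
  shows "pl_map_on P g"
proof -
  obtain F where F: "finite F" "\<And>C. C \<in> F \<Longrightarrow> polytope C" "\<And>C. C \<in> F \<Longrightarrow> affine_map_on C f" "P = \<Union>F"
    by (rule pl_map_onE[OF assms(1)]) (rule that)
  show ?thesis
  proof (rule pl_map_onI[OF F(1,2) _ F(4)])
    show "affine_map_on C g" if "C \<in> F" for C
      by (rule affine_map_on_cong[OF F(3)[OF that]]) (use that F(4) assms(2) in auto)
  qed
qed

lemma pl_map_on_affine: "compact_polyhedron P \<Longrightarrow> affine_map_on P f \<Longrightarrow> pl_map_on P f"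
  unfolding compact_polyhedron_def
  by (elim exE conjE, rule pl_map_onI) (auto intro: affine_map_on_subset)

lemma pl_map_on_Un:
  assumes "pl_map_on P f" "pl_map_on Q f"
  shows "pl_map_on (P \<union> Q) f"
proof -
  obtain F where F: "finite F" "\<And>C. C \<in> F \<Longrightarrow> polytope C" "\<And>C. C \<in> F \<Longrightarrow> affine_map_on C f" "P = \<Union>F"
    by (rule pl_map_onE[OF assms(1)]) (rule that)
  obtain G where G: "finite G" "\<And>C. C \<in> G \<Longrightarrow> polytope C" "\<And>C. C \<in> G \<Longrightarrow> affine_map_on C f" "Q = \<Union>G"
    by (rule pl_map_onE[OF assms(2)]) (rule that)
  show ?thesis by (rule pl_map_onI[of "F \<union> G"]) (use F G in auto)
qed

lemma pl_map_on_compose: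
  assumes "pl_map_on P f" "pl_map_on Q g" "f ` P \<subseteq> Q"
  shows "pl_map_on P (\<lambda>x. g (f x))"
proof -
  obtain F where F: "finite F" "\<And>C. C \<in> F \<Longrightarrow> polytope C" "\<And>C. C \<in> F \<Longrightarrow> affine_map_on C f" "P = \<Union>F"
    by (rule pl_map_onE[OF assms(1)]) (rule that)
  obtain G where G: "finite G" "\<And>C. C \<in> G \<Longrightarrow> polytope C" "\<And>C. C \<in> G \<Longrightarrow> affine_map_on C g" "Q = \<Union>G"
    by (rule pl_map_onE[OF assms(2)]) (rule that)
  show ?thesis
  proof (rule pl_map_onI[of "(\<lambda>(C, D). {x\<in>C. f x \<in> D}) ` (F \<times> G)"])
    show "P = \<Union>((\<lambda>(C, D). {x\<in>C. f x \<in> D}) ` (F \<times> G))" using F(4) G(4) assms(3) by fastforce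
    fix E assume "E \<in> (\<lambda>(C, D). {x\<in>C. f x \<in> D}) ` (F \<times> G)"
    then obtain C D where CD: "C \<in> F" "D \<in> G" "E = {x\<in>C. f x \<in> D}" by auto
    show "polytope E" unfolding CD(3) using F G CD by (intro polytope_affine_preimage) auto
    have "affine_map_on E f" unfolding CD(3)
      by (rule affine_map_on_subset[OF F(3)[OF CD(1)]]) auto
    then show "affine_map_on E (\<lambda>x. g (f x))"
      by (rule affine_map_on_compose[OF _ G(3)[OF CD(2)]]) (use CD in auto)
  qed (use F G in auto)
qed

lemma pl_map_on_common_pieces:
  assumes "pl_map_on P f" "pl_map_on P g"
  obtains F where "finite F" "\<And>C. C \<in> F \<Longrightarrow> polytope C" "\<And>C. C \<in> F \<Longrightarrow> affine_map_on C f"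
    "\<And>C. C \<in> F \<Longrightarrow> affine_map_on C g" "P = \<Union>F"
proof -
  obtain F where F: "finite F" "\<And>C. C \<in> F \<Longrightarrow> polytope C" "\<And>C. C \<in> F \<Longrightarrow> affine_map_on C f" "P = \<Union>F"
    by (rule pl_map_onE[OF assms(1)]) (rule that)
  obtain G where G: "finite G" "\<And>C. C \<in> G \<Longrightarrow> polytope C" "\<And>C. C \<in> G \<Longrightarrow> affine_map_on C g" "P = \<Union>G"
    by (rule pl_map_onE[OF assms(2)]) (rule that)
  show ?thesis
  proof (rule that[of "(\<lambda>(C, D). C \<inter> D) ` (F \<times> G)"])
    show "P = \<Union>((\<lambda>(C, D). C \<inter> D) ` (F \<times> G))" using F(4) G(4) by fastforce
    fix E assume "E \<in> (\<lambda>(C, D). C \<inter> D) ` (F \<times> G)"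
    then obtain C D where CD: "C \<in> F" "D \<in> G" "E = C \<inter> D" by auto
    show "polytope E" using CD F G by (simp add: polytope_Int)
    show "affine_map_on E f" unfolding CD(3) by (rule affine_map_on_subset[OF F(3)[OF CD(1)]]) simp
    show "affine_map_on E g" unfolding CD(3) by (rule affine_map_on_subset[OF G(3)[OF CD(2)]]) simp
  qed (use F G in auto)
qed

lemma pl_map_on_Pair:
  assumes "pl_map_on P f" "pl_map_on P g"
  shows "pl_map_on P (\<lambda>x. (f x, g x))"
  by (rule pl_map_on_common_pieces[OF assms]) (rule pl_map_onI, auto intro: affine_map_on_Pair)

lemma pl_map_on_linear_compose:
  assumes "pl_map_on P f" "linear L"
  shows "pl_map_on P (\<lambda>x. L (f x) + b)"
proof -
  obtain F where F: "finite F" "\<And>C. C \<in> F \<Longrightarrow> polytope C" "\<And>C. C \<in> F \<Longrightarrow> affine_map_on C f" "P = \<Union>F"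
    by (rule pl_map_onE[OF assms(1)]) (rule that)
  show ?thesis
  proof (rule pl_map_onI[OF F(1,2)])
    show "affine_map_on C (\<lambda>x. L (f x) + b)" if "C \<in> F" for C
      by (rule affine_map_on_compose[OF F(3)[OF that] affine_map_on_linear[OF assms(2), of UNIV b]]) simp
  qed (use F in auto)
qed

lemma pl_map_on_add: "pl_map_on P f \<Longrightarrow> pl_map_on P g \<Longrightarrow> pl_map_on P (\<lambda>x. f x + g x)"
  using pl_map_on_linear_compose[OF pl_map_on_Pair, of P f g "\<lambda>z. fst z + snd z" 0]
  by (simp add: linear_iff algebra_simps)

lemma pl_map_on_diff: "pl_map_on P f \<Longrightarrow> pl_map_on P g \<Longrightarrow> pl_map_on P (\<lambda>x. f x - g x)"
  using pl_map_on_linear_compose[OF pl_map_on_Pair, of P f g "\<lambda>z. fst z - snd z" 0]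
  by (simp add: linear_iff algebra_simps)

lemma pl_map_on_const: "compact_polyhedron P \<Longrightarrow> pl_map_on P (\<lambda>x. c)"
  using pl_map_on_affine[of P "\<lambda>x. c"] affine_map_on_linear[of "\<lambda>x. 0" P c] by (simp add: linear_iff)

lemma pl_map_on_id: "compact_polyhedron P \<Longrightarrow> pl_map_on P (\<lambda>x. x)"
  using pl_map_on_affine[of P "\<lambda>x. x"] affine_map_on_linear[of "\<lambda>x. x" P 0] by (simp add: linear_iff)

lemma pl_map_on_uminus: "pl_map_on P f \<Longrightarrow> pl_map_on P (\<lambda>x. - f x)"
  using pl_map_on_linear_compose[of P f uminus 0] by (simp add: linear_iff)

lemma pl_map_on_scaleR: "pl_map_on P f \<Longrightarrow> pl_map_on P (\<lambda>x. c *\<^sub>R f x)"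
  using pl_map_on_linear_compose[of P f "\<lambda>x. c *\<^sub>R x" 0] by (simp add: linear_iff algebra_simps)

lemma pl_map_on_real_scaleR: "pl_map_on P f \<Longrightarrow> pl_map_on P (\<lambda>x. f x *\<^sub>R c)"
  using pl_map_on_linear_compose[of P f "\<lambda>x. x *\<^sub>R c" 0] by (simp add: linear_iff algebra_simps)

lemma pl_map_on_subset:
  assumes "pl_map_on P f" "compact_polyhedron Q" "Q \<subseteq> P"
  shows "pl_map_on Q f"
  using pl_map_on_compose[OF pl_map_on_id[OF assms(2)] assms(1)] assms(3) by simp

lemma pl_map_on_max:
  fixes f g :: "'a::euclidean_space \<Rightarrow> real"
  assumes "pl_map_on P f" "pl_map_on P g"
  shows "pl_map_on P (\<lambda>x. max (f x) (g x))"
proof -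
  obtain F where F: "finite F" "\<And>C. C \<in> F \<Longrightarrow> polytope C" "\<And>C. C \<in> F \<Longrightarrow> affine_map_on C f"
    "\<And>C. C \<in> F \<Longrightarrow> affine_map_on C g" "P = \<Union>F"
    by (rule pl_map_on_common_pieces[OF assms]) (rule that)
  note fg = F(3,4)
  show ?thesis
  proof (rule pl_map_onI[of "(\<lambda>C. {x\<in>C. f x \<le> g x}) ` F \<union> (\<lambda>C. {x\<in>C. g x \<le> f x}) ` F"])
    fix E assume "E \<in> (\<lambda>C. {x\<in>C. f x \<le> g x}) ` F \<union> (\<lambda>C. {x\<in>C. g x \<le> f x}) ` F"
    then obtain C where C: "C \<in> F" and E: "E = {x\<in>C. f x \<le> g x} \<or> E = {x\<in>C. g x \<le> f x}" by auto
    show "polytope E" using E polytope_le F(2)[OF C] fg[OF C] by blast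
    show "affine_map_on E (\<lambda>x. max (f x) (g x))"
    proof (cases "E = {x\<in>C. f x \<le> g x}")
      case True
      have "affine_map_on E g" by (rule affine_map_on_subset[OF fg(2)[OF C]]) (use True in auto)
      then show ?thesis by (rule affine_map_on_cong) (use True in auto)
    next
      case False
      have "affine_map_on E f" by (rule affine_map_on_subset[OF fg(1)[OF C]]) (use E False in auto)
      then show ?thesis by (rule affine_map_on_cong) (use E False in auto)
    qed
  qed (use F in fastforce)+
qed

lemma pl_map_on_min:
  fixes f g :: "'a::euclidean_space \<Rightarrow> real"
  assumes "pl_map_on P f" "pl_map_on P g"
  shows "pl_map_on P (\<lambda>x. min (f x) (g x))"
proof -
  have "min (f x) (g x) = - max (- f x) (- g x)" for x by (simp add: minus_max_eq_min)
  then show ?thesis using pl_map_on_uminus[OF pl_map_on_max[OF assms[THEN pl_map_on_uminus]]] by simp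
qed

lemma pl_map_on_Max:
  fixes f :: "'i \<Rightarrow> 'a::euclidean_space \<Rightarrow> real"
  assumes "finite I" "I \<noteq> {}" "\<And>i. i \<in> I \<Longrightarrow> pl_map_on P (f i)"
  shows "pl_map_on P (\<lambda>x. Max ((\<lambda>i. f i x) ` I))"
  using assms
proof (induction I rule: finite_ne_induct)
  case (insert i I)
  then show ?case by (simp add: pl_map_on_max)
qed simp

lemma pl_map_on_sum:
  assumes "finite I" "compact_polyhedron P" "\<And>i. i \<in> I \<Longrightarrow> pl_map_on P (f i)"
  shows "pl_map_on P (\<lambda>x. \<Sum>i\<in>I. f i x)"
  using assms by (induction I rule: finite_induct) (auto intro: pl_map_on_const pl_map_on_add)

lemma pl_map_on_vec:
  fixes f :: "'a::euclidean_space \<Rightarrow> real^'n"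
  assumes "compact_polyhedron P" "\<And>i. pl_map_on P (\<lambda>x. f x $ i)"
  shows "pl_map_on P f"
proof -
  have "f x = (\<Sum>i\<in>UNIV. f x $ i *\<^sub>R axis i 1)" for x
    using basis_expansion[of "f x"] by (simp add: scalar_mult_eq_scaleR)
  moreover have "pl_map_on P (\<lambda>x. \<Sum>i\<in>UNIV. f x $ i *\<^sub>R (axis i 1 :: real^'n))"
    by (intro pl_map_on_sum pl_map_on_real_scaleR assms) simp
  ultimately show ?thesis by simp
qed

lemma pl_map_on_nth:
  fixes f :: "'a::euclidean_space \<Rightarrow> real^'n"
  shows "pl_map_on P f \<Longrightarrow> pl_map_on P (\<lambda>x. f x $ i)"
  using pl_map_on_linear_compose[of P f "\<lambda>y. y $ i" 0] by (simp add: linear_iff)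

lemma pl_map_on_infnorm:
  fixes f :: "'a::euclidean_space \<Rightarrow> 'b::euclidean_space"
  assumes "pl_map_on P f"
  shows "pl_map_on P (\<lambda>x. infnorm (f x))"
  unfolding infnorm_Max
proof (rule pl_map_on_Max)
  fix b :: 'b
  have "pl_map_on P (\<lambda>x. f x \<bullet> b)"
    using pl_map_on_linear_compose[OF assms, of "\<lambda>y. y \<bullet> b" 0] by (simp add: linear_iff inner_add_left)
  moreover have "\<bar>f x \<bullet> b\<bar> = max (f x \<bullet> b) (- (f x \<bullet> b))" for x by linarith
  ultimately show "pl_map_on P (\<lambda>x. \<bar>f x \<bullet> b\<bar>)" by (simp add: pl_map_on_max pl_map_on_uminus)
qed auto

lemma pl_map_on_continuous:
  assumes "pl_map_on P f"
  shows "continuous_on P f"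
proof -
  obtain F where F: "finite F" "\<And>C. C \<in> F \<Longrightarrow> polytope C" "\<And>C. C \<in> F \<Longrightarrow> affine_map_on C f" "P = \<Union>F"
    by (rule pl_map_onE[OF assms(1)]) (rule that)
  have "continuous_on C f" if "C \<in> F" for C
  proof -
    obtain L b where L: "linear L" "\<And>x. x \<in> C \<Longrightarrow> f x = L x + b"
      using F(3)[OF \<open>C \<in> F\<close>] unfolding affine_map_on_def by blast
    have "continuous_on C L" using L(1) by (simp add: linear_continuous_on linear_conv_bounded_linear)
    then have "continuous_on C (\<lambda>x. L x + b)" by (intro continuous_intros)
    then show ?thesis using L(2) by (simp cong: continuous_on_cong)
  qed
  then have "continuous_on (\<Union>C\<in>F. C) f"
    using F(1,2) by (intro continuous_on_closed_Union) (auto simp: polytope_imp_closed)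
  then show ?thesis using F(4) by simp
qed

section \<open>Images and inverses of piecewise linear maps\<close>

lemma polytope_affine_image:
  assumes "polytope C" "affine_map_on C f"
  shows "polytope (f ` C)"
proof -
  obtain L b where L: "linear L" "\<And>x. x \<in> C \<Longrightarrow> f x = L x + b"
    using assms(2) unfolding affine_map_on_def by blast
  have "f ` C = (+) b ` L ` C" using L(2) by (force simp: image_iff add.commute)
  then show ?thesis using polytope_linear_image[OF L(1) assms(1)] by (simp add: polytope_translation_eq)
qed

text \<open>The linear part need not be injective on the whole space, only on the directions
  \<open>S\<close> of the affine hull of \<open>C\<close>. A kernel vector there, scaled down, could
  be added to a relative interior point without leaving \<open>C\<close>, against injectivity. A
  left inverse on \<open>S\<close> then gives the affine formula.\<close>

lemma affine_map_on_inverse: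
  assumes C: "convex C" and f: "affine_map_on C f" and inj: "inj_on f C" and g: "\<And>x. x \<in> C \<Longrightarrow> g (f x) = x"
  shows "affine_map_on (f ` C) g"
proof (cases "C = {}")
  case True
  then show ?thesis using affine_map_on_linear[of "\<lambda>x. 0" "{}" 0] by (auto simp: affine_map_on_def linear_iff)
next
  case False
  then obtain c where c: "c \<in> rel_interior C" using rel_interior_eq_empty[OF C] by blast
  then have cC: "c \<in> C" using rel_interior_subset by blast
  obtain L b where L: "linear L" "\<And>x. x \<in> C \<Longrightarrow> f x = L x + b"
    using f unfolding affine_map_on_def by blast
  define S where "S = (\<lambda>x. - c + x) ` (affine hull C)"
  have S: "subspace S" unfolding S_def using cC by (intro affine_diffs_subspace) (simp_all add: hull_inc)
  have ker: "w = 0" if w: "w \<in> S" "L w = 0" for w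
  proof (rule ccontr)
    assume "w \<noteq> 0"
    obtain e where e: "e > 0" "cball c e \<inter> affine hull C \<subseteq> C" using c by (auto simp: mem_rel_interior_cball)
    let ?w = "(e / norm w) *\<^sub>R w"
    have "?w \<in> S" using S w subspace_scale by blast
    then have "c + ?w \<in> affine hull C" by (auto simp: S_def algebra_simps)
    moreover have "dist c (c + ?w) = e" using e \<open>w \<noteq> 0\<close> by (simp add: dist_norm)
    ultimately have "c + ?w \<in> C" using e(2) by auto
    moreover have "L ?w = 0" using linear_scale[OF L(1)] w(2) by simp
    then have "L (c + ?w) = L c" using linear_add[OF L(1)] by simp
    ultimately have "c + ?w = c" using inj L(2) cC by (metis inj_onD)
    then show False using e(1) \<open>w \<noteq> 0\<close> by simp
  qed
  have "inj_on L S"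
    by (rule inj_onI) (metis L(1) S eq_iff_diff_eq_0 ker linear_diff subspace_diff)
  then obtain K where K: "linear K" "\<And>v. v \<in> S \<Longrightarrow> K (L v) = v"
    using linear_exists_left_inverse_on[OF L(1) S] by blast
  have "g y = K y + (c - K (f c))" if "y \<in> f ` C" for y
  proof -
    obtain x where x: "x \<in> C" "y = f x" using \<open>y \<in> f ` C\<close> by blast
    have "x - c \<in> S" unfolding S_def using x hull_inc[of x C affine] by force
    then have "x - c = K (L (x - c))" using K(2) by simp
    also have "L (x - c) = f x - f c" using L x cC linear_diff[OF L(1)] by simp
    also have "K \<dots> = K y - K (f c)" using linear_diff[OF K(1)] x by simp
    finally show ?thesis using g[OF x(1)] x(2) by (simp add: algebra_simps)
  qed
  then show ?thesis unfolding affine_map_on_def using K(1) by blast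
qed

lemma compact_polyhedron_image: "pl_map_on P f \<Longrightarrow> compact_polyhedron (f ` P)"
proof (erule pl_map_onE)
  fix F assume F: "finite F" "\<And>C. C \<in> F \<Longrightarrow> polytope C" "\<And>C. C \<in> F \<Longrightarrow> affine_map_on C f" "P = \<Union>F"
  then show ?thesis unfolding compact_polyhedron_def
    by (intro exI[of _ "(`) f ` F"]) (auto intro: polytope_affine_image)
qed

lemma pl_map_on_inverse:
  assumes "pl_map_on P f" "inj_on f P" "\<And>x. x \<in> P \<Longrightarrow> g (f x) = x"
  shows "pl_map_on (f ` P) g"
proof -
  obtain F where F: "finite F" "\<And>C. C \<in> F \<Longrightarrow> polytope C" "\<And>C. C \<in> F \<Longrightarrow> affine_map_on C f" "P = \<Union>F"
    by (rule pl_map_onE[OF assms(1)]) (rule that)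
  show ?thesis
  proof (rule pl_map_onI[of "(`) f ` F"])
    fix E assume "E \<in> (`) f ` F"
    then obtain C where C: "C \<in> F" "E = f ` C" by blast
    have "C \<subseteq> P" using C F(4) by blast
    then have "inj_on f C" using assms(2) inj_on_subset by blast
    then show "affine_map_on E g" unfolding C(2)
      by (intro affine_map_on_inverse polytope_imp_convex F C) (use \<open>C \<subseteq> P\<close> assms(3) in auto)
    show "polytope E" unfolding C(2) using F C by (intro polytope_affine_image) auto
  qed (use F in auto)
qed

lemma compact_polyhedron_Un: "compact_polyhedron P \<Longrightarrow> compact_polyhedron Q \<Longrightarrow> compact_polyhedron (P \<union> Q)"
  using pl_map_on_Un[OF pl_map_on_id pl_map_on_id] pl_map_on_imp_compact_polyhedron by blast

lemma compact_polyhedron_UN: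
  assumes "finite I" "\<And>i. i \<in> I \<Longrightarrow> compact_polyhedron (P i)"
  shows "compact_polyhedron (\<Union>i\<in>I. P i)"
  using assms
proof (induction I)
  case empty
  then show ?case unfolding compact_polyhedron_def by (intro exI[of _ "{}"]) simp
qed (simp add: compact_polyhedron_Un)

lemma polytope_imp_compact_polyhedron: "polytope C \<Longrightarrow> compact_polyhedron C"
  unfolding compact_polyhedron_def by (intro exI[of _ "{C}"]) simp

section \<open>Closures of differences of polyhedra\<close>

definition open_cell :: "'a::euclidean_space set \<Rightarrow> ('a \<times> real) set \<Rightarrow> 'a set" where
  "open_cell C H = {x\<in>C. \<forall>(a, b)\<in>H. b < a \<bullet> x}"

text \<open>For a nonempty cell, taking the closure turns strict inequalities into weak ones: the
  segment from a point of the weak system to a point \<open>y\<close> of the cell lies in the cell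
  except possibly at its start.\<close>

lemma compact_polyhedron_closure_open_cell:
  assumes "polytope C" "finite H"
  shows "compact_polyhedron (closure (open_cell C H))"
proof (cases "open_cell C H = {}")
  case True
  then show ?thesis unfolding compact_polyhedron_def by (intro exI[of _ "{}"]) simp
next
  case False
  then obtain y where y: "y \<in> open_cell C H" by blast
  let ?K = "C \<inter> (\<Inter>(a, b)\<in>H. {x. a \<bullet> x \<ge> b})"
  have K: "polyhedron (\<Inter>(a, b)\<in>H. {x. a \<bullet> x \<ge> b})"
    using assms(2) by (intro polyhedron_Inter) (auto intro: polyhedron_halfspace_ge)
  then have pK: "polytope ?K" using assms(1) polytope_Int_polyhedron by blast
  have "closure (open_cell C H) = ?K"
  proof
    show "closure (open_cell C H) \<subseteq> ?K"
      by (rule closure_minimal) (use polytope_imp_closed[OF pK] in \<open>auto simp: open_cell_def\<close>)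
    show "?K \<subseteq> closure (open_cell C H)"
    proof
      fix x assume x: "x \<in> ?K"
      show "x \<in> closure (open_cell C H)"
      proof (cases "x = y")
        case True
        then show ?thesis using y closure_subset by blast
      next
        case False
        have "open_segment x y \<subseteq> open_cell C H"
        proof
          fix z assume "z \<in> open_segment x y"
          then obtain t where t: "z = (1 - t) *\<^sub>R x + t *\<^sub>R y" "0 < t" "t < 1" by (auto simp: in_segment)
          have "z \<in> C" using x y t polytope_imp_convex[OF assms(1)] by (auto simp: convex_alt open_cell_def)
          moreover have "b < a \<bullet> z" if "(a, b) \<in> H" for a b
          proof -
            have "b \<le> a \<bullet> x" "b < a \<bullet> y" using x y that by (auto simp: open_cell_def)
            then have "(1 - t) * b + t * b < (1 - t) * (a \<bullet> x) + t * (a \<bullet> y)"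
              using t by (intro add_le_less_mono mult_left_mono mult_strict_left_mono) auto
            then show ?thesis by (simp add: t(1) inner_add_right algebra_simps)
          qed
          ultimately show "z \<in> open_cell C H" by (auto simp: open_cell_def)
        qed
        then have "closure (open_segment x y) \<subseteq> closure (open_cell C H)" by (rule closure_mono)
        then show ?thesis using False by auto
      qed
    qed
  qed
  then show ?thesis using pK polytope_imp_compact_polyhedron by simp
qed

lemma compact_polyhedron_le:
  assumes "pl_map_on P f" "pl_map_on P g"
  shows "compact_polyhedron {x\<in>P. f x \<le> (g x :: real)}"
proof (rule pl_map_on_common_pieces[OF assms])
  fix F assume F: "finite F" "\<And>C. C \<in> F \<Longrightarrow> polytope C" "\<And>C. C \<in> F \<Longrightarrow> affine_map_on C f"
    "\<And>C. C \<in> F \<Longrightarrow> affine_map_on C g" "P = \<Union>F"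
  have "{x\<in>P. f x \<le> g x} = (\<Union>C\<in>F. {x\<in>C. f x \<le> g x})" using F(5) by auto
  moreover have "compact_polyhedron (\<Union>C\<in>F. {x\<in>C. f x \<le> g x})"
    using F(1) by (rule compact_polyhedron_UN) (intro polytope_imp_compact_polyhedron polytope_le F)
  ultimately show ?thesis by simp
qed

lemma closure_finite_UN: "finite I \<Longrightarrow> closure (\<Union>i\<in>I. P i) = (\<Union>i\<in>I. closure (P i))"
  by (induction I rule: finite_induct) simp_all

text \<open>Being outside a polytope means violating one of its inequalities, so removing polytopes
  one at a time leaves a finite union of cells of the form \<open>open_cell\<close>. The result is
  needed for the complement of the disc in \<open>M\<close>.\<close>

lemma compact_polyhedron_closure_Diff:
  fixes P Q :: "'a::euclidean_space set"
  assumes "compact_polyhedron P" "compact_polyhedron Q"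
  shows "compact_polyhedron (closure (P - Q))"
proof -
  obtain F where F: "finite F" "\<And>C. C \<in> F \<Longrightarrow> polytope C" "P = \<Union>F"
    using assms(1) unfolding compact_polyhedron_def by blast
  obtain G where G: "finite G" "\<And>C. C \<in> G \<Longrightarrow> polytope C" "Q = \<Union>G"
    using assms(2) unfolding compact_polyhedron_def by blast
  have "\<exists>E. finite E \<and> (\<forall>(C, H)\<in>E. polytope C \<and> finite H) \<and> P - \<Union>G = (\<Union>(C, H)\<in>E. open_cell C H)"
    using G(1,2)
  proof (induction G)
    case empty
    show ?case
      by (rule exI[of _ "(\<lambda>C. (C, {})) ` F"]) (use F in \<open>auto simp: open_cell_def\<close>)
  next
    case (insert D G)
    then obtain E where E: "finite E" "\<forall>(C, H)\<in>E. polytope C \<and> finite H" "P - \<Union>G = (\<Union>(C, H)\<in>E. open_cell C H)"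
      by auto
    obtain K :: "('a \<times> real) set" where K: "finite K" "D = {z. \<forall>(a, b)\<in>K. a \<bullet> z \<le> b}"
      using polytope_halfspaces[of D] insert.prems by blast
    let ?E = "(\<lambda>((C, H), k). (C, insert k H)) ` (E \<times> K)"
    have "P - \<Union>(insert D G) = (\<Union>(C, H)\<in>E. open_cell C H) - D" using E(3) by blast
    also have "\<dots> = (\<Union>(C, H)\<in>?E. open_cell C H)"
    proof (intro set_eqI iffI)
      fix x assume "x \<in> (\<Union>(C, H)\<in>E. open_cell C H) - D"
      then obtain C H where CH: "(C, H) \<in> E" "x \<in> open_cell C H" "x \<notin> D" by blast
      then obtain a b where ab: "(a, b) \<in> K" "b < a \<bullet> x" using K(2) by fastforce
      then have "x \<in> open_cell C (insert (a, b) H)" using CH by (auto simp: open_cell_def)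
      moreover have "(C, insert (a, b) H) \<in> ?E" using CH(1) ab(1) by force
      ultimately show "x \<in> (\<Union>(C, H)\<in>?E. open_cell C H)" by blast
    next
      fix x assume "x \<in> (\<Union>(C, H)\<in>?E. open_cell C H)"
      then obtain C H a b where "(C, H) \<in> E" "(a, b) \<in> K" "x \<in> open_cell C (insert (a, b) H)" by auto
      then show "x \<in> (\<Union>(C, H)\<in>E. open_cell C H) - D" using K(2) by (fastforce simp: open_cell_def)
    qed
    finally show ?case using E(1,2) K(1) by (intro exI[of _ ?E]) fastforce
  qed
  then obtain E where E: "finite E" "\<forall>(C, H)\<in>E. polytope C \<and> finite H" "P - Q = (\<Union>(C, H)\<in>E. open_cell C H)"
    using G(3) by blast
  have "closure (P - Q) = (\<Union>(C, H)\<in>E. closure (open_cell C H))"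
    unfolding E(3) using E(1) by (simp add: closure_finite_UN case_prod_unfold)
  moreover have "compact_polyhedron (\<Union>(C, H)\<in>E. closure (open_cell C H))"
    using E(1,2) by (intro compact_polyhedron_UN) (auto intro: compact_polyhedron_closure_open_cell)
  ultimately show ?thesis by simp
qed

subsection \<open>Cubes\<close>

lemma infnorm_le_cart: "infnorm (y :: real^'n) \<le> r \<longleftrightarrow> (\<forall>i. \<bar>y $ i\<bar> \<le> r)"
  unfolding infnorm_Max by (simp add: Basis_vec_def inner_axis ball_UN)

lemma infnorm_less_cart: "infnorm (y :: real^'n) < r \<longleftrightarrow> (\<forall>i. \<bar>y $ i\<bar> < r)"
  unfolding infnorm_Max by (simp add: Basis_vec_def inner_axis ball_UN)

lemma le_infnorm_cart: "r \<le> infnorm (y :: real^'n) \<longleftrightarrow> (\<exists>i. r \<le> \<bar>y $ i\<bar>)"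
  using infnorm_less_cart[of y r] by (simp add: not_less[symmetric])

lemma polytope_cube: "polytope (cube r :: (real^'n) set)"
proof -
  have "(cube r :: (real^'n) set) = cbox (\<chi> i. - r) (\<chi> i. r)"
    by (auto simp: cube_def infnorm_le_cart mem_box_cart abs_le_iff minus_le_iff)
  then show ?thesis by (simp add: polytope_interval)
qed

lemma compact_polyhedron_shell: "compact_polyhedron {y :: real^'n. s \<le> infnorm y \<and> infnorm y \<le> r}"
proof -
  let ?c = "\<lambda>i c. {y \<in> cube r. s \<le> c * (y :: real^'n) $ i}"
  have p: "polytope (?c i c)" for i c
  proof (rule polytope_le[OF polytope_cube])
    show "affine_map_on (cube r) (\<lambda>y::real^'n. s)"
      using affine_map_on_linear[of "\<lambda>x. 0" _ s] by (simp add: linear_iff)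
    show "affine_map_on (cube r) (\<lambda>y::real^'n. c * y $ i)"
      using affine_map_on_linear[of "\<lambda>y. c * y $ i" _ 0] by (simp add: linear_iff algebra_simps)
  qed
  have "{y :: real^'n. s \<le> infnorm y \<and> infnorm y \<le> r} = (\<Union>i\<in>UNIV. ?c i 1 \<union> ?c i (-1))"
  proof -
    have "s \<le> \<bar>t\<bar> \<longleftrightarrow> s \<le> t \<or> s \<le> - t" for t :: real by linarith
    then show ?thesis by (auto simp: cube_def le_infnorm_cart)
  qed
  moreover have "compact_polyhedron (\<Union>i\<in>UNIV. ?c i 1 \<union> ?c i (-1))"
    by (intro compact_polyhedron_UN compact_polyhedron_Un polytope_imp_compact_polyhedron p) simp
  ultimately show ?thesis by simp
qed

lemma open_open_cube: "open (open_cube r :: (real^'n) set)"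
proof -
  have "open {y :: real^'n. infnorm y < r}"
    by (intro open_Collect_less continuous_intros)
  then show ?thesis by (simp add: open_cube_def)
qed

section \<open>A centrally symmetric model of the connected sum\<close>

lemma embedding_openin_image:
  fixes f :: "'a::euclidean_space \<Rightarrow> 'b::euclidean_space"
  assumes "pl_map_on P f" "inj_on f P" "openin (top_of_set P) U"
  shows "openin (top_of_set (f ` P)) (f ` U)"
proof -
  have "compact P" using assms(1) pl_map_on_imp_compact_polyhedron compact_polyhedron_imp_compact by blast
  then obtain g where "homeomorphism P (f ` P) f g"
    using homeomorphism_compact[of P f "f ` P"] pl_map_on_continuous[OF assms(1)] assms(2) by blast
  then show ?thesis using assms(3) by (rule homeomorphism_imp_open_map)
qed

lemma openin_Un_closed:
  assumes "closed A" "closed B" "W \<subseteq> A \<union> B"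
    "openin (top_of_set A) (W \<inter> A)" "openin (top_of_set B) (W \<inter> B)"
  shows "openin (top_of_set (A \<union> B)) W"
proof -
  have "closedin (top_of_set A) (A - W)" "closedin (top_of_set B) (B - W)"
    using assms(4,5) unfolding closedin_def by (auto simp: Diff_Diff_Int Int_commute)
  then have "closed (A - W)" "closed (B - W)"
    using assms(1,2) closedin_closed_trans by blast+
  then have "closed ((A - W) \<union> (B - W))" by (rule closed_Un)
  then have "openin (top_of_set (A \<union> B)) ((A \<union> B) \<inter> - ((A - W) \<union> (B - W)))"
    by (intro openin_open_Int open_Compl)
  moreover have "(A \<union> B) \<inter> - ((A - W) \<union> (B - W)) = W" using assms(3) by blast
  ultimately show ?thesis by simp
qed

lemma open_cube_subset_cube: "open_cube r \<subseteq> cube r"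
  by (auto simp: open_cube_def cube_def)

lemma pl_discD:
  assumes "pl_disc M k"
  shows "pl_map_on (cube 2) k" "inj_on k (cube 2)" "k ` cube 2 \<subseteq> M" "openin (top_of_set M) (k ` open_cube 2)"
  using assms by (auto simp: pl_disc_def pl_embedding_def)

lemma pl_disc_open_image:
  assumes k: "pl_disc M k" and U: "open U" "U \<subseteq> open_cube 2"
  shows "openin (top_of_set M) (k ` U)"
proof -
  have sub: "U \<subseteq> cube 2" using U open_cube_subset_cube by blast
  have "openin (top_of_set (cube 2)) U" using U(1) sub by (simp add: open_openin_trans open_subset)
  then have "openin (top_of_set (k ` cube 2)) (k ` U)"
    by (rule embedding_openin_image[OF pl_discD(1,2)[OF k]])
  then have "openin (top_of_set (k ` open_cube 2)) (k ` U)"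
    by (rule openin_subset_trans) (use U(2) open_cube_subset_cube in blast)+
  then show ?thesis using pl_discD(4)[OF k] by (rule openin_trans)
qed

lemma infnorm_scaleR: "0 \<le> c \<Longrightarrow> infnorm (c *\<^sub>R x) = c * infnorm (x :: 'a::euclidean_space)"
  by (simp add: infnorm_mul)

text \<open>Charts are constructed on small cubes, whereas \<open>pl_disc\<close> fixes the radius
  2.\<close>

lemma pl_disc_rescale:
  fixes k :: "real^'n \<Rightarrow> 'a::euclidean_space"
  assumes r: "0 < r" and k: "pl_map_on (cube r) k" "inj_on k (cube r)" "k ` cube r \<subseteq> N"
    and op: "openin (top_of_set N) (k ` open_cube r)"
  shows "pl_disc N (\<lambda>z. k ((r/2) *\<^sub>R z))"
proof -
  have c: "(r/2) *\<^sub>R z \<in> cube r \<longleftrightarrow> z \<in> cube 2" for z :: "real^'n"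
    using r by (simp add: cube_def infnorm_scaleR field_simps)
  have o: "(r/2) *\<^sub>R z \<in> open_cube r \<longleftrightarrow> z \<in> open_cube 2" for z :: "real^'n"
    using r by (simp add: open_cube_def infnorm_scaleR field_simps)
  have "(\<lambda>z. (r/2) *\<^sub>R z) ` open_cube 2 = (open_cube r :: (real^'n) set)"
  proof
    show "(\<lambda>z. (r/2) *\<^sub>R z) ` open_cube 2 \<subseteq> (open_cube r :: (real^'n) set)" using o by blast
    show "open_cube r \<subseteq> (\<lambda>z. (r/2) *\<^sub>R z) ` (open_cube 2 :: (real^'n) set)"
    proof
      fix y :: "real^'n" assume "y \<in> open_cube r"
      moreover have y: "y = (r/2) *\<^sub>R ((2/r) *\<^sub>R y)" using r by simp
      ultimately have "(2/r) *\<^sub>R y \<in> open_cube 2" using o by metis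
      then show "y \<in> (\<lambda>z. (r/2) *\<^sub>R z) ` open_cube 2" using y by (intro image_eqI)
    qed
  qed
  then have "(\<lambda>z. k ((r/2) *\<^sub>R z)) ` open_cube 2 = k ` open_cube r" by (metis image_image)
  moreover have "pl_map_on (cube 2) (\<lambda>z. k ((r/2) *\<^sub>R z))"
    by (rule pl_map_on_compose[OF pl_map_on_scaleR[OF pl_map_on_id[OF polytope_imp_compact_polyhedron[OF polytope_cube]]] k(1)])
      (use c in blast)
  moreover have "inj_on (\<lambda>z. k ((r/2) *\<^sub>R z)) (cube 2)"
  proof (rule inj_onI)
    fix x y :: "real^'n" assume "x \<in> cube 2" "y \<in> cube 2" "k ((r/2) *\<^sub>R x) = k ((r/2) *\<^sub>R y)"
    then have "(r/2) *\<^sub>R x = (r/2) *\<^sub>R y" using k(2) c by (metis inj_onD)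
    then show "x = y" using r by simp
  qed
  moreover have "(\<lambda>z. k ((r/2) *\<^sub>R z)) ` cube 2 \<subseteq> N" using k(3) c by blast
  ultimately show ?thesis using op unfolding pl_disc_def pl_embedding_def by simp
qed

lemma small_cube:
  assumes "0 < e"
  obtains r where "0 < r" "r \<le> 2" "cube r \<subseteq> ball (0 :: real^'n) e"
proof
  let ?s = "sqrt (real DIM(real^'n))"
  \<comment> \<open>The Euclidean norm is at most \<open>?s\<close> times the maximum norm; the
    factor 2 makes the final bound strict.\<close>
  define r where "r = min 2 (e / (2 * ?s))"
  have s: "?s > 0" by simp
  show "0 < r" "r \<le> 2" using assms s by (simp_all add: r_def)
  show "cube r \<subseteq> ball (0 :: real^'n) e"
  proof
    fix z :: "real^'n" assume z: "z \<in> cube r"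
    have "norm z \<le> ?s * infnorm z" by (rule norm_le_infnorm)
    also have "\<dots> \<le> ?s * r" using z s by (intro mult_left_mono) (auto simp: cube_def)
    also have "\<dots> \<le> ?s * (e / (2 * ?s))" using s by (intro mult_left_mono) (auto simp: r_def)
    also have "\<dots> < e" using s assms by simp
    finally show "z \<in> ball 0 e" by simp
  qed
qed

text \<open>On the collar \<open>1 \<le> infnorm y \<le> 2\<close> the summands \<open>clamp_part y\<close> and \<open>y - clamp_part y\<close> of \<open>y\<close>
  are piecewise linear and trade places: the first one is \<open>y\<close> on the inner boundary and \<open>0\<close> on the
  outer one.\<close>

definition clamp_part :: "real^'n \<Rightarrow> real^'n" where
  "clamp_part y = (\<chi> i. max (- (2 - infnorm y)) (min (2 - infnorm y) (y $ i)))"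

lemma clamp_part_inner: "infnorm y = 1 \<Longrightarrow> clamp_part y = y"
  using infnorm_le_cart[of y 1] by (simp add: clamp_part_def vec_eq_iff abs_le_iff)

lemma clamp_part_outer: "infnorm y = 2 \<Longrightarrow> clamp_part y = 0"
  by (simp add: clamp_part_def vec_eq_iff)

lemma diff_clamp_part_cube: "y \<in> cube 2 \<Longrightarrow> y - clamp_part y \<in> cube 2"
  unfolding cube_def mem_Collect_eq infnorm_le_cart[of "y - clamp_part y"]
proof
  fix i assume "infnorm y \<le> 2"
  moreover have "y $ i \<le> infnorm y" "- (y $ i) \<le> infnorm y"
    using component_le_infnorm_cart[of y i] by linarith+
  moreover define s where "s = infnorm y"
  ultimately have "\<bar>y $ i - max (- (2 - s)) (min (2 - s) (y $ i))\<bar> \<le> 2" by linarith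
  then show "\<bar>(y - clamp_part y) $ i\<bar> \<le> 2"
    by (simp add: clamp_part_def s_def)
qed

lemma pl_map_on_clamp_part: "pl_map_on (cube 2) clamp_part"
proof (rule pl_map_on_vec)
  have c: "compact_polyhedron (cube 2 :: (real^'n) set)" by (rule polytope_imp_compact_polyhedron[OF polytope_cube])
  then show "compact_polyhedron (cube 2 :: (real^'n) set)" .
  show "pl_map_on (cube 2) (\<lambda>y :: real^'n. clamp_part y $ i)" for i
    unfolding clamp_part_def
    by (simp del: minus_diff_eq, intro pl_map_on_max pl_map_on_min pl_map_on_uminus pl_map_on_diff pl_map_on_const pl_map_on_infnorm
        pl_map_on_nth pl_map_on_id c)
qed

section \<open>One half of the double\<close>

text \<open>The two summands of \<open>y\<close> are stored in separate factors, so they can be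
  recovered and added to give \<open>y\<close> back. On the inner boundary only the standard sphere
  coordinate survives, on the outer one only the position in \<open>M\<close>.\<close>

definition neck :: "(real^'n \<Rightarrow> 'a::euclidean_space) \<Rightarrow> real^'n \<Rightarrow> 'a \<times> (real^'n) \<times> real" where
  "neck h y = (h (y - clamp_part y) - h 0, clamp_part y, infnorm y - 1)"

lemma neck_inner: "infnorm y = 1 \<Longrightarrow> neck h y = (0, y, 0)"
  by (simp add: neck_def clamp_part_inner)

lemma neck_outer: "infnorm y = 2 \<Longrightarrow> neck h y = (h y - h 0, 0, 1)"
  by (simp add: neck_def clamp_part_outer)

lemma inj_on_neck:
  assumes "inj_on h (cube 2)"
  shows "inj_on (neck h) (cube 2)"
proof (rule inj_onI)
  fix x y assume xy: "x \<in> cube 2" "y \<in> cube 2" "neck h x = neck h y"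
  then have "h (x - clamp_part x) = h (y - clamp_part y)" "clamp_part x = clamp_part y"
    by (auto simp: neck_def)
  then have "x - clamp_part x = y - clamp_part y" using inj_onD[OF assms] xy diff_clamp_part_cube by blast
  then show "x = y" using \<open>clamp_part x = clamp_part y\<close> by simp
qed

lemma pl_map_on_neck:
  assumes "pl_map_on (cube 2) h"
  shows "pl_map_on (cube 2) (neck h)"
proof -
  have c: "compact_polyhedron (cube 2 :: (real^'n) set)" by (rule polytope_imp_compact_polyhedron[OF polytope_cube])
  have "pl_map_on (cube 2) (\<lambda>y. h (y - clamp_part y))"
    by (rule pl_map_on_compose[OF pl_map_on_diff[OF pl_map_on_id[OF c] pl_map_on_clamp_part] assms])
      (use diff_clamp_part_cube in blast)
  then show ?thesis unfolding neck_def
    by (intro pl_map_on_Pair pl_map_on_diff pl_map_on_const pl_map_on_infnorm pl_map_on_id pl_map_on_clamp_part c)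
qed

text \<open>The constants outside the disc, 0 and height 1, are the values of \<open>neck\<close> at
  \<open>infnorm y = 2\<close>, so the two formulas fit together on the outer boundary.\<close>

definition half_embedding :: "(real^'n \<Rightarrow> 'a::euclidean_space) \<Rightarrow> 'a \<Rightarrow> 'a \<times> (real^'n) \<times> real" where
  "half_embedding h p = (if p \<in> h ` cube 2 then neck h (inv_into (cube 2) h p) else (p - h 0, 0, 1))"

definition punctured :: "'a set \<Rightarrow> (real^'n \<Rightarrow> 'a::euclidean_space) \<Rightarrow> 'a set" where
  "punctured M h = M - h ` open_cube 1"

definition half_space :: "'a set \<Rightarrow> (real^'n \<Rightarrow> 'a::euclidean_space) \<Rightarrow> ('a \<times> (real^'n) \<times> real) set" where
  "half_space M h = half_embedding h ` punctured M h"

definition double :: "'a set \<Rightarrow> (real^'n \<Rightarrow> 'a::euclidean_space) \<Rightarrow> ('a \<times> (real^'n) \<times> real) set" where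
  "double M h = half_space M h \<union> uminus ` half_space M h"

abbreviation height :: "'a \<times> (real^'n) \<times> real \<Rightarrow> real" where
  "height x \<equiv> snd (snd x)"

lemma uminus_double: "uminus ` double M h = double M h"
  by (auto simp: double_def image_Un image_image)

context
  fixes M :: "'a::euclidean_space set" and h :: "real^'n \<Rightarrow> 'a"
  assumes M: "closed_pl_manifold TYPE('n) M" and h: "pl_disc M h"
begin

private lemmas hD = pl_discD[OF h]

lemma half_embedding_disc: "y \<in> cube 2 \<Longrightarrow> half_embedding h (h y) = neck h y"
  using hD(2) by (simp add: half_embedding_def)

lemma half_embedding_outside: "p \<notin> h ` open_cube 2 \<Longrightarrow> half_embedding h p = (p - h 0, 0, 1)"
proof (cases "p \<in> h ` cube 2")
  case True
  assume "p \<notin> h ` open_cube 2"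
  then obtain y where "p = h y" "infnorm y = 2" using True by (force simp: cube_def open_cube_def)
  then show ?thesis using half_embedding_disc[of y] neck_outer[of y h] by (simp add: cube_def)
qed (simp add: half_embedding_def)

lemma compact_M: "compact M"
  using M compact_polyhedron_imp_compact unfolding closed_pl_manifold_def by blast

lemma disc_in_punctured: "y \<in> cube 2 \<Longrightarrow> h y \<in> punctured M h \<longleftrightarrow> 1 \<le> infnorm y"
proof -
  assume y: "y \<in> cube 2"
  have "h y \<in> h ` open_cube 1 \<longleftrightarrow> y \<in> open_cube 1"
  proof
    assume "h y \<in> h ` open_cube 1"
    then obtain z where z: "z \<in> open_cube 1" "h y = h z" by blast
    then have "z \<in> cube 2" by (simp add: open_cube_def cube_def)
    then show "y \<in> open_cube 1" using inj_onD[OF hD(2) z(2) y] z(1) by simp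
  qed simp
  then show ?thesis using y hD(3) by (auto simp: punctured_def open_cube_def)
qed

lemma punctured_cases:
  assumes "p \<in> punctured M h"
  obtains y where "y \<in> cube 2" "1 \<le> infnorm y" "p = h y" | "p \<notin> h ` cube 2"
  using assms disc_in_punctured by blast

text \<open>The complement of the closed disc is not compact, so its closure is taken as one piece
  and the collar as the other. On the closure, including its points on the outer boundary of the
  collar, the map is a translation into height 1.\<close>

lemma pl_map_on_half_embedding: "pl_map_on (punctured M h) (half_embedding h)"
proof -
  let ?A = "closure (M - h ` cube 2)"
  let ?S = "{y :: real^'n. 1 \<le> infnorm y \<and> infnorm y \<le> 2}"
  have Mc: "compact_polyhedron M" using M unfolding closed_pl_manifold_def by blast
  have A: "compact_polyhedron ?A"
    by (intro compact_polyhedron_closure_Diff Mc compact_polyhedron_image hD)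
  have Asub: "?A \<subseteq> M - h ` open_cube 2"
  proof (rule closure_minimal)
    show "M - h ` cube 2 \<subseteq> M - h ` open_cube 2" using open_cube_subset_cube by blast
    have "closedin (top_of_set M) (M - h ` open_cube 2)"
      using hD(4) openin_imp_subset[OF hD(4)] by (simp add: closedin_def double_diff)
    then show "closed (M - h ` open_cube 2)" using compact_M closedin_closed_trans compact_imp_closed by blast
  qed
  have S: "compact_polyhedron ?S" by (rule compact_polyhedron_shell)
  have Sc: "?S \<subseteq> cube 2" by (auto simp: cube_def)
  have eq: "punctured M h = ?A \<union> h ` ?S"
  proof
    show "punctured M h \<subseteq> ?A \<union> h ` ?S"
    proof
      fix p assume p: "p \<in> punctured M h"
      then show "p \<in> ?A \<union> h ` ?S"
      proof (cases rule: punctured_cases)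
        case (1 y)
        then show ?thesis by (auto simp: cube_def)
      next
        case 2
        then have "p \<in> M - h ` cube 2" using p by (simp add: punctured_def)
        then show ?thesis using closure_subset by blast
      qed
    qed
    have "open_cube 1 \<subseteq> (open_cube 2 :: (real^'n) set)" by (auto simp: open_cube_def)
    then have "?A \<subseteq> punctured M h" using Asub unfolding punctured_def by blast
    moreover have "h ` ?S \<subseteq> punctured M h" using disc_in_punctured Sc by blast
    ultimately show "?A \<union> h ` ?S \<subseteq> punctured M h" by blast
  qed
  have "pl_map_on ?A (\<lambda>p. p - h 0)" by (intro pl_map_on_diff pl_map_on_id pl_map_on_const A)
  then have "pl_map_on ?A (\<lambda>p. (p - h 0, 0, 1) :: 'a \<times> (real^'n) \<times> real)"
    by (intro pl_map_on_Pair pl_map_on_const A)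
  then have 1: "pl_map_on ?A (half_embedding h)"
    by (rule pl_map_on_cong) (use Asub half_embedding_outside in auto)
  have hS: "pl_map_on ?S h" "inj_on h ?S" using pl_map_on_subset[OF hD(1) S Sc] inj_on_subset[OF hD(2) Sc] by auto
  have inv: "inv_into (cube 2) h (h y) = y" if "y \<in> ?S" for y
    using that Sc hD(2) by (simp add: subset_iff)
  have "pl_map_on (h ` ?S) (inv_into (cube 2) h)"
    using hS inv by (rule pl_map_on_inverse)
  then have "pl_map_on (h ` ?S) (\<lambda>p. neck h (inv_into (cube 2) h p))"
    by (rule pl_map_on_compose[OF _ pl_map_on_neck[OF hD(1)]]) (use inv Sc in auto)
  then have 2: "pl_map_on (h ` ?S) (half_embedding h)"
    by (rule pl_map_on_cong) (use Sc in \<open>auto simp: half_embedding_def\<close>)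
  show ?thesis unfolding eq using 1 2 by (rule pl_map_on_Un)
qed

lemma height_half_embedding: "p \<in> punctured M h \<Longrightarrow> 0 \<le> height (half_embedding h p)"
proof (erule punctured_cases)
  fix y assume "y \<in> cube 2" "1 \<le> infnorm y" "p = h y"
  then show ?thesis using half_embedding_disc[of y] by (simp add: neck_def)
qed (simp add: half_embedding_def)

lemma height_half_embedding_eq_0:
  assumes "p \<in> punctured M h" "height (half_embedding h p) = 0"
  obtains y where "infnorm y = 1" "p = h y" "half_embedding h p = (0, y, 0)"
  using assms(1)
proof (cases rule: punctured_cases)
  case (1 y)
  then have "infnorm y = 1" using assms(2) half_embedding_disc[of y] by (simp add: neck_def)
  then show ?thesis using 1 that half_embedding_disc[of y] neck_inner[of y h] by auto
next
  case 2
  then show ?thesis using assms(2) by (simp add: half_embedding_def)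
qed

text \<open>A collar point can agree with an outside point only at height 1, hence on the outer
  boundary, where the collar formula returns a point of the disc.\<close>

lemma inj_on_half_embedding: "inj_on (half_embedding h) (punctured M h)"
proof (rule inj_onI)
  have ne: "half_embedding h (h y) \<noteq> half_embedding h q" if "y \<in> cube 2" "q \<notin> h ` cube 2" for y q
  proof
    assume eq: "half_embedding h (h y) = half_embedding h q"
    then have e: "neck h y = (q - h 0, 0, 1)" using that half_embedding_disc by (simp add: half_embedding_def)
    then have "infnorm y = 2" by (simp add: neck_def)
    then have "q = h y" using e neck_outer[of y h] by simp
    then show False using that by blast
  qed
  fix p q assume p: "p \<in> punctured M h" and q: "q \<in> punctured M h" and eq: "half_embedding h p = half_embedding h q"
  show "p = q" using p
  proof (cases rule: punctured_cases)
    case (1 y)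
    note y = 1
    show ?thesis using q
    proof (cases rule: punctured_cases)
      case (1 z)
      then show ?thesis using y eq half_embedding_disc inj_onD[OF inj_on_neck[OF hD(2)], of y z] by auto
    next
      case 2
      then show ?thesis using ne[of y q] y eq by simp
    qed
  next
    case 2
    note p2 = 2
    show ?thesis using q
    proof (cases rule: punctured_cases)
      case (1 z)
      then show ?thesis using ne[of z p] p2 eq by simp
    next
      case 2
      then show ?thesis using p2 eq by (simp add: half_embedding_def)
    qed
  qed
qed

lemma compact_polyhedron_half_space: "compact_polyhedron (half_space M h)"
  unfolding half_space_def by (rule compact_polyhedron_image[OF pl_map_on_half_embedding])

lemma compact_polyhedron_double: "compact_polyhedron (double M h)"
proof -
  have "compact_polyhedron (uminus ` half_space M h)"
    by (intro compact_polyhedron_image pl_map_on_uminus pl_map_on_id compact_polyhedron_half_space)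
  then show ?thesis unfolding double_def using compact_polyhedron_half_space by (intro compact_polyhedron_Un)
qed

lemma height_half_space: "x \<in> half_space M h \<Longrightarrow> 0 \<le> height x"
  using height_half_embedding unfolding half_space_def by blast

lemma sphere_in_half_space: "infnorm y = 1 \<Longrightarrow> (0, y, 0) \<in> half_space M h"
  unfolding half_space_def using half_embedding_disc[of y] neck_inner[of y h] disc_in_punctured[of y]
  by (intro image_eqI[of _ _ "h y"]) (simp_all add: cube_def)

lemma double_height_0: "{x \<in> double M h. height x = 0} = {(0, y, 0) |y. infnorm y = 1}"
proof
  have *: "\<exists>y. infnorm y = 1 \<and> x = (0, y, 0)" if "x \<in> half_space M h" "height x = 0" for x
    using that height_half_embedding_eq_0 unfolding half_space_def by (metis imageE)
  have **: "\<exists>y. infnorm y = 1 \<and> x = (0, y, 0)" if x: "x \<in> uminus ` half_space M h" "height x = 0" for x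
  proof -
    have "- x \<in> half_space M h" "height (- x) = 0" using x by auto
    then obtain y where "infnorm y = 1" "- x = (0, y, 0)" using * by blast
    then have "infnorm (- y) = 1" "x = (0, - y, 0)" by (auto simp: infnorm_neg prod_eq_iff)
    then show ?thesis by blast
  qed
  show "{x \<in> double M h. height x = 0} \<subseteq> {(0, y, 0) |y. infnorm y = 1}"
    using * ** unfolding double_def by blast
  show "{(0, y, 0) |y. infnorm y = 1} \<subseteq> {x \<in> double M h. height x = 0}"
    using sphere_in_half_space unfolding double_def by auto
qed

lemma zero_notin_double: "0 \<notin> double M h"
proof
  assume "0 \<in> double M h"
  then have "0 \<in> {x \<in> double M h. height x = 0}" by simp
  then obtain y :: "real^'n" where "infnorm y = 1" "(0 :: 'a \<times> (real^'n) \<times> real) = (0, y, 0)"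
    unfolding double_height_0 by blast
  then show False by (simp add: zero_prod_def infnorm_0)
qed

text \<open>The inclusions are the half embedding and its negative. Heights of the first are
  nonnegative and of the second nonpositive, so identified points have height 0 and lie on the
  standard sphere, where negation is the gluing.\<close>

lemma connected_sum_double: "connected_sum M h M h uminus (double M h)"
proof -
  let ?P = "M - h ` open_cube 1" and ?j = "half_embedding h"
  have P: "punctured M h = ?P" by (simp add: punctured_def)
  have e1: "pl_embedding ?P (double M h) ?j"
    using pl_map_on_half_embedding inj_on_half_embedding unfolding pl_embedding_def P
    by (auto simp: double_def half_space_def P)
  have e2: "pl_embedding ?P (double M h) (\<lambda>p. - ?j p)"
    using pl_map_on_uminus[OF pl_map_on_half_embedding] inj_on_half_embedding unfolding pl_embedding_def P
    by (auto simp: double_def half_space_def P inj_on_def)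
  have un: "?j ` ?P \<union> (\<lambda>p. - ?j p) ` ?P = double M h"
    by (simp add: double_def half_space_def P image_image)
  have s: "cube_sphere = {y :: real^'n. 1 \<le> infnorm y \<and> infnorm y \<le> 1}" by (auto simp: cube_sphere_def)
  have "compact_polyhedron (cube_sphere :: (real^'n) set)" unfolding s by (rule compact_polyhedron_shell)
  then have sig: "pl_homeomorphism cube_sphere cube_sphere (uminus :: real^'n \<Rightarrow> real^'n)"
    unfolding pl_homeomorphism_def
    by (intro conjI pl_map_on_uminus pl_map_on_id bij_betw_byWitness[where f' = uminus])
      (auto simp: cube_sphere_def infnorm_neg)
  have glue: "?j p = - ?j q \<longleftrightarrow> (\<exists>y\<in>cube_sphere. p = h y \<and> q = h (- y))" if p: "p \<in> ?P" and q: "q \<in> ?P" for p q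
  proof
    assume eq: "?j p = - ?j q"
    then have "height (?j p) = - height (?j q)" by simp
    then have 0: "height (?j p) = 0" "height (?j q) = 0"
      using height_half_embedding[of p] height_half_embedding[of q] p q P by auto
    obtain y where y: "infnorm y = 1" "p = h y" "?j p = (0, y, 0)"
      using height_half_embedding_eq_0[of p] 0 p P by metis
    obtain z where z: "infnorm z = 1" "q = h z" "?j q = (0, z, 0)"
      using height_half_embedding_eq_0[of q] 0 q P by metis
    have "y = - z" using eq y z by simp
    then have "q = h (- y)" using z by simp
    then show "\<exists>y\<in>cube_sphere. p = h y \<and> q = h (- y)" using y by (auto simp: cube_sphere_def)
  next
    assume "\<exists>y\<in>cube_sphere. p = h y \<and> q = h (- y)"
    then obtain y where y: "infnorm y = 1" "p = h y" "q = h (- y)" by (auto simp: cube_sphere_def)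
    then show "?j p = - ?j q"
      using half_embedding_disc[of y] half_embedding_disc[of "- y"] neck_inner[of y h] neck_inner[of "- y" h]
      by (simp add: cube_def infnorm_neg)
  qed
  show ?thesis unfolding connected_sum_def using h sig e1 e2 un glue by blast
qed

section \<open>Charts of the double\<close>

lemma openin_double_half:
  assumes "openin (top_of_set M) U"
  shows "openin (top_of_set (half_space M h)) (half_embedding h ` (U \<inter> punctured M h))"
  unfolding half_space_def
proof (rule embedding_openin_image[OF pl_map_on_half_embedding inj_on_half_embedding])
  obtain T where "open T" "U = M \<inter> T" using assms by (auto simp: openin_open)
  then have "U \<inter> punctured M h = punctured M h \<inter> T" by (auto simp: punctured_def)
  then show "openin (top_of_set (punctured M h)) (U \<inter> punctured M h)" using \<open>open T\<close> by auto
qed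

text \<open>Openness in a union of two closed sets can be tested on each of them, and each half is a
  copy of the punctured manifold.\<close>

lemma openin_doubleI:
  assumes "W \<subseteq> double M h" "openin (top_of_set M) U" "openin (top_of_set M) U'"
    "W \<inter> half_space M h = half_embedding h ` (U \<inter> punctured M h)"
    "W \<inter> uminus ` half_space M h = uminus ` half_embedding h ` (U' \<inter> punctured M h)"
  shows "openin (top_of_set (double M h)) W"
  unfolding double_def
proof (rule openin_Un_closed)
  have c: "compact (half_space M h)" by (rule compact_polyhedron_imp_compact[OF compact_polyhedron_half_space])
  show "closed (half_space M h)" using c by (rule compact_imp_closed)
  show "closed (uminus ` half_space M h)" using c by (intro compact_imp_closed compact_negations)
  show "W \<subseteq> half_space M h \<union> uminus ` half_space M h" using assms(1) by (simp add: double_def)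
  show "openin (top_of_set (half_space M h)) (W \<inter> half_space M h)" using openin_double_half[OF assms(2)] assms(4) by simp
  have "homeomorphism (half_space M h) (uminus ` half_space M h) uminus uminus"
    by (auto simp: homeomorphism_def image_image intro!: continuous_intros)
  then show "openin (top_of_set (uminus ` half_space M h)) (W \<inter> uminus ` half_space M h)"
    unfolding assms(5) using openin_double_half[OF assms(3)] by (rule homeomorphism_imp_open_map)
qed

text \<open>A chart of \<open>M\<close> is shrunk until it misses the closed unit disc. Its image
  then has positive height and stays away from the opposite half, so it is open in the
  double.\<close>

lemma double_chart_upper:
  assumes "x \<in> double M h" "0 < height x"
  shows "\<exists>k :: real^'n \<Rightarrow> _. pl_disc (double M h) k \<and> k 0 = x"
proof -
  let ?j = "half_embedding h"
  have "x \<in> half_space M h" using assms height_half_space[of "- x"] by (fastforce simp: double_def)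
  then obtain p where p: "p \<in> punctured M h" "x = ?j p" by (auto simp: half_space_def)
  have pM: "p \<in> M" using p by (simp add: punctured_def)
  \<comment> \<open>The interior of the disc has been removed, and its boundary has height
    0.\<close>
  have "p \<notin> h ` cube 1"
  proof
    assume "p \<in> h ` cube 1"
    then obtain y where y: "p = h y" "y \<in> cube 1" by blast
    then have "1 \<le> infnorm y" using disc_in_punctured[of y] p by (simp add: cube_def)
    then have "infnorm y = 1" using y by (simp add: cube_def)
    then show False using y p(2) assms(2) half_embedding_disc[of y] neck_inner[of y h] by (simp add: cube_def)
  qed
  obtain k :: "real^'n \<Rightarrow> 'a" where k: "pl_disc M k" "k 0 = p"
    using M pM unfolding closed_pl_manifold_def by blast
  note kD = pl_discD[OF k(1)]
  have c1: "cube 1 \<subseteq> (cube 2 :: (real^'n) set)" by (auto simp: cube_def)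
  have "compact (h ` cube 1)"
    by (intro compact_continuous_image continuous_on_subset[OF pl_map_on_continuous[OF hD(1)] c1]
        polytope_imp_compact polytope_cube)
  then have "open (- (h ` cube 1))" by (simp add: compact_imp_closed open_Compl)
  then have "openin (top_of_set (cube 2)) (cube 2 \<inter> k -` (- (h ` cube 1)))"
    by (rule continuous_openin_preimage_gen[OF pl_map_on_continuous[OF kD(1)]])
  then obtain T where T: "open T" "cube 2 \<inter> k -` (- (h ` cube 1)) = cube 2 \<inter> T" by (auto simp: openin_open)
  have "0 \<in> T" using T(2) k(2) \<open>p \<notin> h ` cube 1\<close> by (auto simp: cube_def infnorm_0)
  then obtain e where e: "e > 0" "ball 0 e \<subseteq> T" using T(1) open_contains_ball by blast
  obtain r where r: "0 < r" "r \<le> 2" "cube r \<subseteq> ball (0 :: real^'n) e" using small_cube[OF e(1)] by metis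
  have cr2: "cube r \<subseteq> (cube 2 :: (real^'n) set)" using r by (auto simp: cube_def)
  have kr: "k ` cube r \<subseteq> M - h ` cube 1"
  proof
    fix q assume "q \<in> k ` cube r"
    then obtain z where z: "z \<in> cube r" "q = k z" by blast
    then have "z \<in> cube 2 \<inter> T" using cr2 r e by blast
    then have "z \<in> cube 2 \<inter> k -` (- (h ` cube 1))" unfolding T(2) .
    then have "z \<in> cube 2" "q \<notin> h ` cube 1" using z(2) by simp_all
    moreover have "q \<in> M" using kD(3) z(2) \<open>z \<in> cube 2\<close> by (simp add: image_subset_iff)
    ultimately show "q \<in> M - h ` cube 1" by simp
  qed
  have kP: "k ` cube r \<subseteq> punctured M h" using kr open_cube_subset_cube unfolding punctured_def by blast
  have pl: "pl_map_on (cube r) k"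
    by (rule pl_map_on_subset[OF kD(1) polytope_imp_compact_polyhedron[OF polytope_cube] cr2])
  have pos: "0 < height (?j q)" if q: "q \<in> k ` cube r" for q
  proof -
    have "height (?j q) \<noteq> 0"
    proof
      assume "height (?j q) = 0"
      then obtain y where "infnorm y = 1" "q = h y" using height_half_embedding_eq_0[of q] q kP by blast
      then have "q \<in> h ` cube 1" by (auto simp: cube_def)
      then show False using kr q by blast
    qed
    then show ?thesis using height_half_embedding[of q] q kP by force
  qed
  have "pl_disc (double M h) (\<lambda>z. ?j (k ((r/2) *\<^sub>R z)))"
  proof (rule pl_disc_rescale[OF r(1), where k = "\<lambda>z. ?j (k z)"])
    show "pl_map_on (cube r) (\<lambda>z. ?j (k z))"
      by (rule pl_map_on_compose[OF pl pl_map_on_half_embedding kP])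
    have "inj_on (?j \<circ> k) (cube r)"
      by (intro comp_inj_on inj_on_subset[OF kD(2) cr2] inj_on_subset[OF inj_on_half_embedding kP])
    then show "inj_on (\<lambda>z. ?j (k z)) (cube r)" by (simp add: o_def)
    show sub: "(\<lambda>z. ?j (k z)) ` cube r \<subseteq> double M h" using kP by (auto simp: double_def half_space_def)
    show "openin (top_of_set (double M h)) ((\<lambda>z. ?j (k z)) ` open_cube r)"
    proof (rule openin_doubleI)
      have kU: "k ` open_cube r \<subseteq> k ` cube r" using open_cube_subset_cube by blast
      show "(\<lambda>z. ?j (k z)) ` open_cube r \<subseteq> double M h" using sub open_cube_subset_cube by blast
      show "openin (top_of_set M) (k ` open_cube r)"
        by (rule pl_disc_open_image[OF k(1) open_open_cube]) (use r in \<open>auto simp: open_cube_def\<close>)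
      show "openin (top_of_set M) {}" by simp
      have "k ` open_cube r \<inter> punctured M h = k ` open_cube r" using kU kP by blast
      then show "(\<lambda>z. ?j (k z)) ` open_cube r \<inter> half_space M h = ?j ` (k ` open_cube r \<inter> punctured M h)"
        using kU kP unfolding half_space_def by auto
      have "False" if "z \<in> open_cube r" "?j (k z) \<in> uminus ` half_space M h" for z
      proof -
        have "0 < height (?j (k z))" using pos that kU by blast
        moreover have "- ?j (k z) \<in> half_space M h" using that(2) by auto
        ultimately show False using height_half_space[of "- ?j (k z)"] by simp
      qed
      then show "(\<lambda>z. ?j (k z)) ` open_cube r \<inter> uminus ` half_space M h = uminus ` ?j ` ({} \<inter> punctured M h)"
        by blast
    qed
  qed
  then show ?thesis using k(2) p(2) by (intro exI[of _ "\<lambda>z. ?j (k ((r/2) *\<^sub>R z))"]) simp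
qed

end

text \<open>Near a point \<open>y0\<close> of the cube sphere, \<open>infnorm (y0 + z) - 1\<close> is the maximum \<open>\<mu> z\<close> of the
  outward components of \<open>z\<close>, and translating along the sum \<open>w\<close> of the outward normals reflects the
  outer side of the sphere onto the inner one.\<close>

lemma cube_sphere_reflection:
  fixes y0 :: "real^'n"
  assumes y0: "infnorm y0 = 1"
  obtains \<mu> :: "real^'n \<Rightarrow> real" and R :: "real^'n \<Rightarrow> real^'n" and r where
    "0 < r" "r \<le> 1/6" "\<And>P f. pl_map_on P f \<Longrightarrow> pl_map_on P (\<lambda>z :: real^'n. \<mu> (f z))"
    "\<And>P f. pl_map_on P f \<Longrightarrow> pl_map_on P (\<lambda>z :: real^'n. R (f z))"
    "continuous_on UNIV R" "R 0 = 0" "\<mu> 0 = 0" "\<And>z. \<mu> z = 0 \<Longrightarrow> R z = z" "\<And>z. R (R z) = z"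
    "\<And>z. \<mu> (R z) = - \<mu> z" "\<And>z. \<bar>\<mu> z\<bar> \<le> infnorm z" "\<And>z. infnorm (R z) \<le> 3 * infnorm z"
    "\<And>z. infnorm z \<le> 3 * r \<Longrightarrow> infnorm (y0 + z) = 1 + \<mu> z"
proof -
  define I where "I = {i. \<bar>y0 $ i\<bar> = 1}"
  have le1: "\<bar>y0 $ i\<bar> \<le> 1" for i using y0 component_le_infnorm_cart[of y0 i] by simp
  have "\<exists>i. 1 \<le> \<bar>y0 $ i\<bar>" using le_infnorm_cart[of 1 y0] y0 by simp
  then have I: "I \<noteq> {}" "finite I" using le1 unfolding I_def by (auto intro: order_antisym)
  have sq: "y0 $ i * y0 $ i = 1" if "i \<in> I" for i using that by (auto simp: I_def abs_if split: if_splits)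
  define w :: "real^'n" where "w = (\<chi> i. if i \<in> I then y0 $ i else 0)"
  define \<mu> :: "real^'n \<Rightarrow> real" where "\<mu> z = Max ((\<lambda>i. y0 $ i * z $ i) ` I)" for z
  define R where "R z = z - (2 * \<mu> z) *\<^sub>R w" for z
  \<comment> \<open>Half the smallest distance to 1 of an inactive component, so that inactive
    components cannot take over the maximum near \<open>y0\<close>. The inserted 1 covers the case
    in which all components are active.\<close>
  define e where "e = Min (insert 1 ((\<lambda>i. 1 - \<bar>y0 $ i\<bar>) ` (- I))) / 2"
  have e: "0 < e" "e \<le> 1/2" "\<And>i. i \<notin> I \<Longrightarrow> 2 * e \<le> 1 - \<bar>y0 $ i\<bar>"
  proof -
    have "1 - \<bar>y0 $ i\<bar> > 0" if "i \<notin> I" for i using le1[of i] that by (simp add: I_def)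
    then show "0 < e" unfolding e_def by (simp add: Min_gr_iff)
    have "Min (insert 1 ((\<lambda>i. 1 - \<bar>y0 $ i\<bar>) ` (- I))) \<le> 1" by (rule Min_le) auto
    then show "e \<le> 1/2" by (simp add: e_def)
    show "2 * e \<le> 1 - \<bar>y0 $ i\<bar>" if "i \<notin> I" for i
    proof -
      have "Min (insert 1 ((\<lambda>i. 1 - \<bar>y0 $ i\<bar>) ` (- I))) \<le> 1 - \<bar>y0 $ i\<bar>" by (rule Min_le) (use that in auto)
      then show ?thesis by (simp add: e_def)
    qed
  qed
  have ge: "y0 $ i * z $ i \<le> \<mu> z" if "i \<in> I" for i z unfolding \<mu>_def using that I by (intro Max_ge) auto
  have attain: "\<exists>i\<in>I. \<mu> z = y0 $ i * z $ i" for z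
  proof -
    have "\<mu> z \<in> (\<lambda>i. y0 $ i * z $ i) ` I" unfolding \<mu>_def using I by (intro Max_in) auto
    then show ?thesis by auto
  qed
  have absI: "\<bar>y0 $ i * z $ i\<bar> \<le> infnorm z" if "i \<in> I" for i z
    using that component_le_infnorm_cart[of z i] by (simp add: I_def abs_mult)
  have mu_le: "\<bar>\<mu> z\<bar> \<le> infnorm z" for z using attain[of z] absI by metis
  \<comment> \<open>On active components \<open>y0 $ i\<close> has square 1, so subtracting
    \<open>c *\<^sub>R w\<close> lowers every linear form in the maximum by exactly
    \<open>c\<close>. With \<open>c\<close> equal to twice the maximum its sign is reversed.\<close>
  have mu_shift: "\<mu> (z - c *\<^sub>R w) = \<mu> z - c" for z c
  proof -
    have *: "y0 $ i * (z - c *\<^sub>R w) $ i = y0 $ i * z $ i - c" if "i \<in> I" for i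
      using sq[OF that] that by (simp add: w_def algebra_simps)
    show ?thesis
    proof (rule order_antisym)
      obtain i where "i \<in> I" "\<mu> (z - c *\<^sub>R w) = y0 $ i * (z - c *\<^sub>R w) $ i" using attain by blast
      then show "\<mu> (z - c *\<^sub>R w) \<le> \<mu> z - c" using * ge[of i z] by simp
      obtain i where "i \<in> I" "\<mu> z = y0 $ i * z $ i" using attain by blast
      then show "\<mu> z - c \<le> \<mu> (z - c *\<^sub>R w)" using * ge[of i "z - c *\<^sub>R w"] by simp
    qed
  qed
  have mu_R: "\<mu> (R z) = - \<mu> z" for z unfolding R_def mu_shift by simp
  have RR: "R (R z) = z" for z using mu_R[of z] by (simp add: R_def)
  have w1: "\<bar>w $ i\<bar> \<le> 1" for i using le1 by (simp add: w_def)
  have R_le: "infnorm (R z) \<le> 3 * infnorm z" for z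
    unfolding infnorm_le_cart
  proof
    fix i
    have "\<bar>R z $ i\<bar> \<le> \<bar>z $ i\<bar> + \<bar>2 * \<mu> z\<bar> * \<bar>w $ i\<bar>" by (simp add: R_def abs_mult[symmetric])
    also have "\<bar>2 * \<mu> z\<bar> * \<bar>w $ i\<bar> \<le> \<bar>2 * \<mu> z\<bar> * 1" by (intro mult_left_mono w1) simp
    finally show "\<bar>R z $ i\<bar> \<le> 3 * infnorm z" using component_le_infnorm_cart[of z i] mu_le[of z] by simp
  qed
  have near: "infnorm (y0 + z) = 1 + \<mu> z" if z: "infnorm z \<le> e" for z
  proof (rule order_antisym)
    have actv: "\<bar>(y0 + z) $ i\<bar> = 1 + y0 $ i * z $ i" if i: "i \<in> I" for i
    proof -
      have "\<bar>(y0 + z) $ i\<bar> = \<bar>y0 $ i\<bar> * \<bar>(y0 + z) $ i\<bar>" using i by (simp add: I_def)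
      also have "\<dots> = \<bar>1 + y0 $ i * z $ i\<bar>" using sq[OF i] by (simp add: abs_mult[symmetric] algebra_simps)
      finally show ?thesis using absI[OF i, of z] z e(2) by linarith
    qed
    show "infnorm (y0 + z) \<le> 1 + \<mu> z" unfolding infnorm_le_cart
    proof
      fix i
      show "\<bar>(y0 + z) $ i\<bar> \<le> 1 + \<mu> z"
      proof (cases "i \<in> I")
        case True
        then show ?thesis using actv ge by simp
      next
        case False
        have "\<bar>(y0 + z) $ i\<bar> \<le> \<bar>y0 $ i\<bar> + \<bar>z $ i\<bar>" by simp
        then show ?thesis using e(3)[OF False] component_le_infnorm_cart[of z i] mu_le[of z] z by linarith
      qed
    qed
    obtain i where "i \<in> I" "\<mu> z = y0 $ i * z $ i" using attain by blast
    then show "1 + \<mu> z \<le> infnorm (y0 + z)" using actv[of i] component_le_infnorm_cart[of "y0 + z" i] by simp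
  qed
  have pl_mu: "pl_map_on P (\<lambda>z. \<mu> (f z))" if "pl_map_on P f" for P and f :: "real^'n \<Rightarrow> real^'n"
    unfolding \<mu>_def
  proof (rule pl_map_on_Max[OF I(2,1)])
    show "pl_map_on P (\<lambda>z. y0 $ i * f z $ i)" for i
      using pl_map_on_scaleR[OF pl_map_on_nth[OF that, of i], of "y0 $ i"] by simp
  qed
  have pl_R: "pl_map_on P (\<lambda>z. R (f z))" if f: "pl_map_on P f" for P and f :: "real^'n \<Rightarrow> real^'n"
  proof -
    have "pl_map_on P (\<lambda>z. 2 * \<mu> (f z))" using pl_map_on_scaleR[OF pl_mu[OF f], of 2] by simp
    then show ?thesis unfolding R_def by (intro pl_map_on_diff pl_map_on_real_scaleR f)
  qed
  have cont: "continuous_on UNIV R"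
  proof -
    have "continuous_on UNIV (\<lambda>z :: real^'n. Max ((\<lambda>i. y0 $ i * z $ i) ` J))" if "finite J" "J \<noteq> {}" for J
      using that
    proof (induction J rule: finite_ne_induct)
      case (singleton i)
      show ?case by (simp, intro continuous_intros)
    next
      case (insert i J)
      then have "(\<lambda>z :: real^'n. Max ((\<lambda>i. y0 $ i * z $ i) ` insert i J)) =
          (\<lambda>z. max (y0 $ i * z $ i) (Max ((\<lambda>i. y0 $ i * z $ i) ` J)))" by simp
      then show ?case using insert by (simp only:) (intro continuous_intros)
    qed
    from this[OF I(2,1)] have "continuous_on UNIV \<mu>" unfolding \<mu>_def .
    then show ?thesis unfolding R_def by (intro continuous_intros)
  qed
  have mu0: "\<mu> 0 = 0" using attain[of 0] by simp
  have fix0: "R z = z" if "\<mu> z = 0" for z using that by (simp add: R_def)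
  \<comment> \<open>\<open>R\<close> enlarges the maximum norm by a factor of at most 3, hence the
    radius \<open>e/3\<close>.\<close>
  show ?thesis
    by (rule that[of "e/3" \<mu> R])
      (use e(1,2) pl_mu pl_R cont mu0 fix0 RR mu_R mu_le R_le near in auto)
qed

context
  fixes M :: "'a::euclidean_space set" and h :: "real^'n \<Rightarrow> 'a"
  assumes M: "closed_pl_manifold TYPE('n) M" and h: "pl_disc M h"
begin

private lemmas discD = pl_discD[OF h]

text \<open>Outside the sphere, \<open>y0 + z\<close> is already a collar point of the upper half.
  Inside, \<open>R\<close> reflects \<open>z\<close> outward, so that \<open>- (y0 + R z)\<close> is
  a collar point whose image is then negated. On the sphere \<open>R z = z\<close> and both rules
  give \<open>(0, y0 + z, 0)\<close>; the height of the result is \<open>\<mu> z\<close> throughout,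
  which separates the two cases.\<close>

lemma double_chart_waist:
  fixes y0 :: "real^'n"
  assumes y0: "infnorm y0 = 1"
  shows "\<exists>k :: real^'n \<Rightarrow> _. pl_disc (double M h) k \<and> k 0 = (0, y0, 0)"
proof -
  let ?j = "half_embedding h"
  obtain \<mu> :: "real^'n \<Rightarrow> real" and R :: "real^'n \<Rightarrow> real^'n" and r where
    r: "0 < r" "r \<le> 1/6" and pl_mu: "\<And>P f. pl_map_on P f \<Longrightarrow> pl_map_on P (\<lambda>z :: real^'n. \<mu> (f z))" and
    pl_R: "\<And>P f. pl_map_on P f \<Longrightarrow> pl_map_on P (\<lambda>z :: real^'n. R (f z))" and
    contR: "continuous_on UNIV R" and R0: "R 0 = 0" and mu0: "\<mu> 0 = 0" and fixR: "\<And>z. \<mu> z = 0 \<Longrightarrow> R z = z" and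
    RR: "\<And>z. R (R z) = z" and mu_R: "\<And>z. \<mu> (R z) = - \<mu> z" and mu_le: "\<And>z. \<bar>\<mu> z\<bar> \<le> infnorm z" and
    R_le: "\<And>z. infnorm (R z) \<le> 3 * infnorm z" and
    near: "\<And>z. infnorm z \<le> 3 * r \<Longrightarrow> infnorm (y0 + z) = 1 + \<mu> z"
    by (rule cube_sphere_reflection[OF y0]) (rule that)
  let ?up = "\<lambda>z. y0 + z" and ?down = "\<lambda>z. - (y0 + R z)"
  define K where "K z = (if 0 \<le> \<mu> z then neck h (?up z) else - neck h (?down z))" for z
  have up: "infnorm (?up z) = 1 + \<mu> z" if "z \<in> cube r" for z
    by (rule near) (use that r in \<open>auto simp: cube_def\<close>)
  have down: "infnorm (?down z) = 1 - \<mu> z" if "z \<in> cube r" for z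
  proof -
    have "infnorm (R z) \<le> 3 * r" using R_le[of z] that by (simp add: cube_def)
    then show ?thesis using near[of "R z"] mu_R[of z] by (simp add: infnorm_neg del: minus_add_distrib)
  qed
  have mu6: "\<bar>\<mu> z\<bar> \<le> 1/6" if "z \<in> cube r" for z using mu_le[of z] that r by (simp add: cube_def)
  have up2: "?up z \<in> cube 2" and down2: "?down z \<in> cube 2" if "z \<in> cube r" for z
    using up[OF that] down[OF that] mu6[OF that] by (simp_all add: cube_def del: minus_add_distrib)
  have Kneg: "K z = - neck h (?down z)" if "z \<in> cube r" "\<mu> z \<le> 0" for z
  proof (cases "\<mu> z = 0")
    case True
    have "infnorm (?up z) = 1" "infnorm (?down z) = 1" using up down that(1) True by simp_all
    then show ?thesis unfolding K_def using neck_inner[of "?up z" h] neck_inner[of "?down z" h] fixR[OF True] True by simp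
  next
    case False
    then show ?thesis unfolding K_def using that by simp
  qed
  have hK: "height (K z) = \<mu> z" if "z \<in> cube r" for z
    using up[OF that] down[OF that] by (cases "0 \<le> \<mu> z") (simp_all add: K_def neck_def del: minus_add_distrib)
  have Kup: "K z = ?j (h (?up z))" "h (?up z) \<in> punctured M h" if "z \<in> cube r" "0 \<le> \<mu> z" for z
    using that up[OF that(1)] up2[OF that(1)] half_embedding_disc[OF M h, of "?up z"] disc_in_punctured[OF M h, of "?up z"]
    by (simp_all add: K_def)
  have Kdown: "K z = - ?j (h (?down z))" "h (?down z) \<in> punctured M h" if "z \<in> cube r" "\<mu> z \<le> 0" for z
    using Kneg[OF that] that down[OF that(1)] down2[OF that(1)] half_embedding_disc[OF M h, of "?down z"]
      disc_in_punctured[OF M h, of "?down z"]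
    by (simp_all del: minus_add_distrib)
  have cc: "compact_polyhedron (cube r :: (real^'n) set)" by (rule polytope_imp_compact_polyhedron[OF polytope_cube])
  note idr = pl_map_on_id[OF cc]
  have pl: "pl_map_on (cube r) K"
  proof -
    let ?P = "{z \<in> cube r. 0 \<le> \<mu> z}" and ?Q = "{z \<in> cube r. \<mu> z \<le> 0}"
    have P: "compact_polyhedron ?P" by (rule compact_polyhedron_le[OF pl_map_on_const[OF cc] pl_mu[OF idr]])
    have Q: "compact_polyhedron ?Q" by (rule compact_polyhedron_le[OF pl_mu[OF idr] pl_map_on_const[OF cc]])
    have "pl_map_on ?P (\<lambda>z. neck h (?up z))"
    proof (rule pl_map_on_compose[OF _ pl_map_on_neck[OF discD(1)]])
      show "pl_map_on ?P ?up" by (rule pl_map_on_add[OF pl_map_on_const[OF P] pl_map_on_id[OF P]])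
      show "?up ` ?P \<subseteq> cube 2" using up2 by blast
    qed
    then have 1: "pl_map_on ?P K" by (rule pl_map_on_cong) (simp add: K_def)
    have "pl_map_on ?Q (\<lambda>z. neck h (?down z))"
    proof (rule pl_map_on_compose[OF _ pl_map_on_neck[OF discD(1)]])
      show "pl_map_on ?Q ?down" by (intro pl_map_on_uminus pl_map_on_add pl_map_on_const pl_R pl_map_on_id Q)
      show "?down ` ?Q \<subseteq> cube 2" using down2 by blast
    qed
    then have "pl_map_on ?Q (\<lambda>z. - neck h (?down z))" by (rule pl_map_on_uminus)
    then have 2: "pl_map_on ?Q K" by (rule pl_map_on_cong) (use Kneg in auto)
    have "cube r = ?P \<union> ?Q" by auto
    then show ?thesis using pl_map_on_Un[OF 1 2] by simp
  qed
  have inj: "inj_on K (cube r)"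
  proof (rule inj_onI)
    fix z z' assume z: "z \<in> cube r" "z' \<in> cube r" "K z = K z'"
    then have mu: "\<mu> z = \<mu> z'" using hK by metis
    show "z = z'"
    proof (cases "0 \<le> \<mu> z")
      case True
      then have "neck h (?up z) = neck h (?up z')" using z mu by (simp add: K_def)
      then have "?up z = ?up z'" using inj_onD[OF inj_on_neck[OF discD(2)]] up2 z by blast
      then show ?thesis by simp
    next
      case False
      then have "neck h (?down z) = neck h (?down z')" using z mu by (simp add: K_def)
      then have "?down z = ?down z'" using inj_onD[OF inj_on_neck[OF discD(2)]] down2 z by blast
      then have "R (R z) = R (R z')" by simp
      then show ?thesis using RR by simp
    qed
  qed
  have sub: "K ` cube r \<subseteq> double M h"
  proof
    fix x assume "x \<in> K ` cube r"
    then obtain z where z: "z \<in> cube r" "x = K z" by blast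
    show "x \<in> double M h"
    proof (cases "0 \<le> \<mu> z")
      case True
      then show ?thesis using Kup[OF z(1)] z(2) by (auto simp: double_def half_space_def)
    next
      case False
      then show ?thesis using Kdown[OF z(1)] z(2) by (auto simp: double_def half_space_def)
    qed
  qed
  \<comment> \<open>These are the images of the open cube under \<open>?up\<close> and
    \<open>?down\<close>. The second is written as a preimage, which makes its openness follow from
    the continuity of \<open>R\<close>.\<close>
  let ?B = "?up ` open_cube r" and ?C = "{y. R (- y - y0) \<in> open_cube r}"
  have oc: "z \<in> cube r" if "z \<in> open_cube r" for z using that open_cube_subset_cube by blast
  have "openin (top_of_set (double M h)) (K ` open_cube r)"
  proof (rule openin_doubleI[OF M h])
    show "K ` open_cube r \<subseteq> double M h" using sub oc by blast
    have "open ?B" by (rule open_translation) (rule open_open_cube)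
    moreover have "infnorm (?up z) < 2" if "z \<in> open_cube r" for z
      using up[OF oc[OF that]] mu6[OF oc[OF that]] by simp
    then have "?B \<subseteq> open_cube 2" by (auto simp: open_cube_def)
    ultimately show "openin (top_of_set M) (h ` ?B)" by (rule pl_disc_open_image[OF h])
    have "continuous_on UNIV (\<lambda>y. R (- y - y0))"
      by (rule continuous_on_compose2[OF contR]) (auto intro!: continuous_intros)
    then have "open ((\<lambda>y. R (- y - y0)) -` open_cube r)" by (simp add: open_vimage open_open_cube)
    then have "open ?C" by (simp add: vimage_def)
    moreover have down_inv: "?down (R (- y - y0)) = y" for y using RR by simp
    have "infnorm y < 2" if "y \<in> ?C" for y
    proof -
      have z: "R (- y - y0) \<in> cube r" using that oc by simp
      show ?thesis using down[OF z] mu6[OF z] unfolding down_inv by simp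
    qed
    then have "?C \<subseteq> open_cube 2" by (auto simp: open_cube_def)
    ultimately show "openin (top_of_set M) (h ` ?C)" by (rule pl_disc_open_image[OF h])
    show "K ` open_cube r \<inter> half_space M h = ?j ` (h ` ?B \<inter> punctured M h)"
    proof
      show "K ` open_cube r \<inter> half_space M h \<subseteq> ?j ` (h ` ?B \<inter> punctured M h)"
      proof
        fix x assume "x \<in> K ` open_cube r \<inter> half_space M h"
        then obtain z where z: "z \<in> open_cube r" "x = K z" "0 \<le> height x"
          using height_half_space[OF M h] by blast
        then have "0 \<le> \<mu> z" using hK[OF oc] by simp
        then show "x \<in> ?j ` (h ` ?B \<inter> punctured M h)" using Kup[OF oc[OF z(1)]] z by blast
      qed
      show "?j ` (h ` ?B \<inter> punctured M h) \<subseteq> K ` open_cube r \<inter> half_space M h"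
      proof
        fix x assume "x \<in> ?j ` (h ` ?B \<inter> punctured M h)"
        then obtain z where z: "z \<in> open_cube r" "x = ?j (h (?up z))" "h (?up z) \<in> punctured M h" by blast
        then have "1 \<le> infnorm (?up z)" using disc_in_punctured[OF M h up2[OF oc]] by blast
        then have "0 \<le> \<mu> z" using up[OF oc[OF z(1)]] by simp
        then have "x = K z" using Kup[OF oc[OF z(1)]] z by simp
        then show "x \<in> K ` open_cube r \<inter> half_space M h" using z unfolding half_space_def by blast
      qed
    qed
    show "K ` open_cube r \<inter> uminus ` half_space M h = uminus ` ?j ` (h ` ?C \<inter> punctured M h)"
    proof
      show "K ` open_cube r \<inter> uminus ` half_space M h \<subseteq> uminus ` ?j ` (h ` ?C \<inter> punctured M h)"
      proof
        fix x assume x: "x \<in> K ` open_cube r \<inter> uminus ` half_space M h"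
        then obtain z where z: "z \<in> open_cube r" "x = K z" by blast
        have "height x \<le> 0" using x height_half_space[OF M h] by auto
        then have "\<mu> z \<le> 0" using hK[OF oc[OF z(1)]] z by simp
        note Kd = Kdown[OF oc[OF z(1)] this]
        have "?down z \<in> ?C" using RR z(1) by simp
        then show "x \<in> uminus ` ?j ` (h ` ?C \<inter> punctured M h)" using Kd z(2) by blast
      qed
      show "uminus ` ?j ` (h ` ?C \<inter> punctured M h) \<subseteq> K ` open_cube r \<inter> uminus ` half_space M h"
      proof
        fix x assume "x \<in> uminus ` ?j ` (h ` ?C \<inter> punctured M h)"
        then obtain y where y: "y \<in> ?C" "x = - ?j (h y)" "h y \<in> punctured M h" by blast
        let ?z = "R (- y - y0)"
        have z: "?z \<in> open_cube r" using y by simp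
        have "1 \<le> infnorm (?down ?z)" using disc_in_punctured[OF M h down2[OF oc[OF z]]] y(3) unfolding down_inv by blast
        then have "\<mu> ?z \<le> 0" using down[OF oc[OF z]] by simp
        then have "x = K ?z" using Kdown[OF oc[OF z]] y unfolding down_inv by simp
        then show "x \<in> K ` open_cube r \<inter> uminus ` half_space M h" using z y unfolding half_space_def by blast
      qed
    qed
  qed
  then have "pl_disc (double M h) (\<lambda>z. K ((r/2) *\<^sub>R z))" using pl_disc_rescale[OF r(1) pl inj sub] by blast
  moreover have "K ((r/2) *\<^sub>R 0) = (0, y0, 0)" using mu0 neck_inner[OF y0, of h] by (simp add: K_def)
  ultimately show ?thesis by (intro exI[of _ "\<lambda>z. K ((r/2) *\<^sub>R z)"] conjI)
qed

theorem closed_pl_manifold_double: "closed_pl_manifold TYPE('n) (double M h)"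
  unfolding closed_pl_manifold_def
proof (intro conjI ballI)
  show "compact_polyhedron (double M h)" by (rule compact_polyhedron_double[OF M h])
  have neg: "\<exists>k :: real^'n \<Rightarrow> _. pl_disc (double M h) k \<and> k 0 = x"
    if ex: "\<exists>k :: real^'n \<Rightarrow> _. pl_disc (double M h) k \<and> k 0 = - x" for x
  proof -
    obtain k :: "real^'n \<Rightarrow> _" where k: "pl_disc (double M h) k" "k 0 = - x" using ex by blast
    note kD = pl_discD[OF k(1)]
    have "homeomorphism (double M h) (double M h) uminus uminus"
      using uminus_double[of M h] by (auto simp: homeomorphism_def intro!: continuous_intros)
    then have "openin (top_of_set (double M h)) (uminus ` k ` open_cube 2)"
      using kD(4) by (rule homeomorphism_imp_open_map)
    moreover have "(\<lambda>z. - k z) ` cube 2 \<subseteq> double M h" using kD(3) uminus_double[of M h] by blast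
    moreover have "inj_on (\<lambda>z. - k z) (cube 2)" using kD(2) by (simp add: inj_on_def)
    ultimately have "pl_disc (double M h) (\<lambda>z. - k z)"
      using pl_map_on_uminus[OF kD(1)] by (simp add: pl_disc_def pl_embedding_def image_image)
    then show ?thesis using k(2) by (intro exI[of _ "\<lambda>z. - k z"]) simp
  qed
  fix x assume x: "x \<in> double M h"
  consider "0 < height x" | "height x = 0" | "0 < height (- x)" by (simp, linarith)
  then show "\<exists>k :: real^'n \<Rightarrow> _. pl_disc (double M h) k \<and> k 0 = x"
  proof cases
    case 1
    then show ?thesis using double_chart_upper[OF M h x] by blast
  next
    case 2
    then have "x \<in> {(0, y, 0) |y. infnorm y = 1}" using x double_height_0[OF M h] by blast
    then show ?thesis using double_chart_waist by blast
  next
    case 3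
    have "- x \<in> double M h" using x uminus_double[of M h] by blast
    then show ?thesis using neg double_chart_upper[OF M h _ 3] by blast
  qed
qed

end

section \<open>The Borsuk-Ulam property\<close>

lemma interior_cube: "interior (cube r :: (real^'n) set) = open_cube r"
proof -
  have "(cube r :: (real^'n) set) = cbox (\<chi> i. - r) (\<chi> i. r)"
    by (auto simp: cube_def infnorm_le_cart mem_box_cart abs_le_iff minus_le_iff)
  moreover have "(open_cube r :: (real^'n) set) = box (\<chi> i. - r) (\<chi> i. r)"
    by (auto simp: open_cube_def infnorm_less_cart mem_box_cart abs_less_iff minus_less_iff)
  ultimately show ?thesis by simp
qed

section \<open>Manifolds and cube spheres as locally Euclidean sets\<close>

lemma locally_euclidean_homeomorphic:
  assumes X: "locally_euclidean TYPE('b::euclidean_space) d X" and fg: "homeomorphism X Y f g"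
  shows "locally_euclidean TYPE('b) d Y"
  unfolding locally_euclidean_def
proof
  fix y assume y: "y \<in> Y"
  then have "g y \<in> X" using homeomorphism_image2[OF fg] by blast
  then obtain W Q p q and U :: "'b set" where W: "g y \<in> W" "openin (top_of_set X) W" "affine U" "aff_dim U = int d"
    "openin (top_of_set U) Q" "homeomorphism W Q p q"
    using locally_euclideanE[OF X] by metis
  have WX: "W \<subseteq> X" using openin_imp_subset[OF W(2)] .
  have "y \<in> f ` W" using W(1) homeomorphism_apply2[OF fg y] by (metis imageI)
  moreover have "openin (top_of_set Y) (f ` W)" by (rule homeomorphism_imp_open_map[OF fg W(2)])
  moreover have "homeomorphism W (f ` W) f g" by (rule homeomorphism_of_subsets[OF fg WX order_refl refl])
  then have "f ` W homeomorphic Q"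
    using W(6) homeomorphic_def homeomorphic_sym homeomorphic_trans by metis
  ultimately show "\<exists>W (U::'b set) Q. y \<in> W \<and> openin (top_of_set Y) W \<and>
     affine U \<and> aff_dim U = int d \<and> openin (top_of_set U) Q \<and> W homeomorphic Q"
    using W(3-5) by blast
qed

lemma closed_pl_manifold_locally_euclidean:
  assumes "closed_pl_manifold TYPE('n::finite) M"
  shows "locally_euclidean TYPE(real^'n) CARD('n) M"
  unfolding locally_euclidean_def
proof
  fix x assume "x \<in> M"
  then obtain k :: "real^'n \<Rightarrow> _" where k: "pl_disc M k" "k 0 = x"
    using assms unfolding closed_pl_manifold_def by blast
  note kD = pl_discD[OF k(1)]
  have "compact (cube 2 :: (real^'n) set)" by (simp add: polytope_imp_compact polytope_cube)
  then obtain g where "homeomorphism (cube 2) (k ` cube 2) k g"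
    using homeomorphism_compact[OF _ pl_map_on_continuous[OF kD(1)] refl kD(2)] by blast
  then have "homeomorphism (open_cube 2) (k ` open_cube 2) k g"
    by (rule homeomorphism_of_subsets[OF _ open_cube_subset_cube order_refl refl])
  then have "k ` open_cube 2 homeomorphic (open_cube 2 :: (real^'n) set)"
    using homeomorphic_def homeomorphic_sym by blast
  moreover have "x \<in> k ` open_cube 2" using k(2) by (force simp: open_cube_def infnorm_0)
  moreover have "openin (top_of_set UNIV) (open_cube 2 :: (real^'n) set)" by (simp add: open_open_cube)
  ultimately show "\<exists>W (U::(real^'n) set) Q. x \<in> W \<and> openin (top_of_set M) W \<and>
     affine U \<and> aff_dim U = int CARD('n) \<and> openin (top_of_set U) Q \<and> W homeomorphic Q"
    using kD(4) by (intro exI[of _ "k ` open_cube 2"] exI[of _ UNIV] exI[of _ "open_cube 2"]) (simp add: aff_dim_UNIV)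
qed

text \<open>The coordinates numbered \<open>0\<close> to \<open>d\<close> are free, which makes this
  the boundary of a cube of dimension \<open>d + 1\<close>, a sphere of dimension
  \<open>d\<close>.\<close>

definition sphere_flag :: "('n::finite \<Rightarrow> nat) \<Rightarrow> nat \<Rightarrow> (real^'n) set" where
  "sphere_flag idx d = {y. infnorm y = 1 \<and> (\<forall>i. d < idx i \<longrightarrow> y $ i = 0)}"

text \<open>The set is the relative frontier of a section of the cube by a subspace of dimension
  \<open>d + 1\<close>. Removing the antipode of \<open>x\<close> leaves a neighbourhood of
  \<open>x\<close> homeomorphic to an affine space of dimension \<open>d\<close>.\<close>

lemma locally_euclidean_sphere_flag:
  fixes idx :: "'n::finite \<Rightarrow> nat"
  assumes idx: "bij_betw idx UNIV {0..<CARD('n)}" and d: "d < CARD('n)"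
  shows "locally_euclidean TYPE(real^'n) d (sphere_flag idx d)"
proof -
  let ?V = "{y :: real^'n. \<forall>i. d < idx i \<longrightarrow> y $ i = 0}"
  let ?D = "(\<lambda>i. axis i (1::real)) ` {i. idx i \<le> d} :: (real^'n) set"
  have V: "?V = {y. \<forall>b\<in>Basis. b \<notin> ?D \<longrightarrow> y \<bullet> b = 0}"
    by (auto simp: Basis_vec_def inner_axis axis_eq_axis not_le image_iff)
  have "idx ` {i. idx i \<le> d} = {0..d}"
    using idx d by (auto simp: bij_betw_def image_iff set_eq_iff) (metis atLeastLessThan_iff imageE le_eq_less_or_eq le_less_trans rangeI zero_le)
  moreover have "inj_on idx {i. idx i \<le> d}" using idx by (auto simp: bij_betw_def intro: inj_on_subset)
  ultimately have "card {i. idx i \<le> d} = Suc d" by (metis card_image card_atLeastAtMost diff_zero)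
  moreover have "inj_on (\<lambda>i. axis i (1::real) :: real^'n) {i. idx i \<le> d}" by (auto simp: inj_on_def axis_eq_axis)
  ultimately have "card ?D = Suc d" by (simp add: card_image)
  moreover have "?D \<subseteq> Basis" by (auto simp: Basis_vec_def)
  ultimately have dimV: "dim ?V = Suc d" unfolding V by (simp add: dim_substandard)
  have subV: "subspace ?V" unfolding V by (rule subspace_substandard)
  have int: "interior (cube 1) \<inter> ?V \<noteq> {}"
  proof -
    have "0 \<in> interior (cube 1) \<inter> ?V" by (simp add: interior_cube open_cube_def infnorm_0)
    then show ?thesis by blast
  qed
  have cvx: "convex (cube 1 :: (real^'n) set)" by (rule polytope_imp_convex[OF polytope_cube])
  let ?C = "cube 1 \<inter> ?V"
  have ri: "rel_interior ?C = open_cube 1 \<inter> ?V"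
    using rel_interior_convex_Int_affine[OF cvx subspace_imp_affine[OF subV] int] by (simp add: interior_cube)
  have clo: "closed ?C" by (intro closed_Int polytope_imp_closed polytope_cube closed_subspace subV)
  have fr: "rel_frontier ?C = sphere_flag idx d"
    unfolding rel_frontier_def closure_closed[OF clo] ri
    by (auto simp: sphere_flag_def cube_def open_cube_def)
  have "aff_dim (?V \<inter> cube 1) = aff_dim ?V"
    by (rule aff_dim_convex_Int_nonempty_interior[OF subspace_imp_convex[OF subV]]) (use int in blast)
  then have dimC: "aff_dim ?C = int d + 1" using aff_dim_subspace[OF subV] dimV by (simp add: Int_commute)
  obtain T :: "(real^'n) set" where T: "subspace T" "dim T = d"
    using choose_subspace_of_subspace[of d "UNIV :: (real^'n) set"] d by auto
  show ?thesis unfolding locally_euclidean_def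
  proof
    fix x assume x: "x \<in> sphere_flag idx d"
    have ax: "- x \<in> sphere_flag idx d" using x by (simp add: sphere_flag_def infnorm_neg)
    have "x \<noteq> 0" using x by (auto simp: sphere_flag_def infnorm_0)
    then have "x + x \<noteq> 0" by (simp flip: scaleR_2)
    then have ne: "x \<noteq> - x" by (metis add.right_inverse)
    have "rel_frontier ?C - {- x} homeomorphic T"
    proof (rule homeomorphic_punctured_sphere_affine_gen)
      show "convex ?C" by (intro convex_Int cvx subspace_imp_convex subV)
      show "bounded ?C" using polytope_imp_bounded[OF polytope_cube[of 1]] bounded_Int by blast
      show "- x \<in> rel_frontier ?C" using ax fr by simp
      show "affine T" by (rule subspace_imp_affine[OF T(1)])
      show "aff_dim ?C = aff_dim T + 1" using dimC aff_dim_subspace[OF T(1)] T(2) by simp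
    qed
    then have "sphere_flag idx d - {- x} homeomorphic T" unfolding fr .
    moreover have "openin (top_of_set (sphere_flag idx d)) (sphere_flag idx d - {- x})" by (rule openin_delete) simp
    ultimately show "\<exists>W (U::(real^'n) set) Q. x \<in> W \<and> openin (top_of_set (sphere_flag idx d)) W \<and>
       affine U \<and> aff_dim U = int d \<and> openin (top_of_set U) Q \<and> W homeomorphic Q"
      using x ne subspace_imp_affine[OF T(1)] aff_dim_subspace[OF T(1)] T(2)
      by (intro exI[of _ "sphere_flag idx d - {- x}"] exI[of _ T]) simp
  qed
qed

section \<open>The flag inside a symmetric triangulation\<close>

text \<open>\<open>limit\<close> says that the waist is approached from above, and by
  \<open>sym\<close> also from below; it is what makes the upper half end exactly at the waist.
  \<open>sign\<close> is the compatibility of the triangulation with all coordinate hyperplanes of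
  the flag.\<close>

locale antipodal_flag =
  fixes N :: "('a::euclidean_space \<times> (real^'n) \<times> real) set" and idx :: "'n::finite \<Rightarrow> nat"
    and V :: "('a \<times> (real^'n) \<times> real) set set"
  assumes idx: "bij_betw idx UNIV {0..<CARD('n)}"
    and sym: "uminus ` N = N"
    and eu: "locally_euclidean TYPE(real^'n) CARD('n) N"
    and waist: "{x \<in> N. height x = 0} = {(0, y, 0) |y. infnorm y = 1}"
    and limit: "\<And>y e. infnorm y = 1 \<Longrightarrow> 0 < e \<Longrightarrow> \<exists>x\<in>N. dist x (0, y, 0) < e \<and> 0 < height x"
    and V: "geometric_complex V" "body V = N" "\<And>s. s \<in> V \<Longrightarrow> uminus ` s \<in> V"
    and sign: "\<And>s i. s \<in> V \<Longrightarrow> (\<forall>v\<in>s. 0 \<le> fst (snd v) $ i) \<or> (\<forall>v\<in>s. fst (snd v) $ i \<le> 0)"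
      "\<And>s. s \<in> V \<Longrightarrow> (\<forall>v\<in>s. 0 \<le> height v) \<or> (\<forall>v\<in>s. height v \<le> 0)"
begin

text \<open>The coordinates that cut out the flag: \<open>coord CARD('n)\<close> is the height, the lower ones come from
  \<open>real^'n\<close>.\<close>

definition coord :: "nat \<Rightarrow> 'a \<times> (real^'n) \<times> real \<Rightarrow> real" where
  "coord j x = (if j < CARD('n) then fst (snd x) $ (inv_into UNIV idx j) else height x)"

definition layer :: "nat \<Rightarrow> ('a \<times> (real^'n) \<times> real) set" where
  "layer d = {x\<in>N. \<forall>j. d < j \<and> j \<le> CARD('n) \<longrightarrow> coord j x = 0}"

definition layer_complex :: "nat \<Rightarrow> ('a \<times> (real^'n) \<times> real) set set" where
  "layer_complex d = {s\<in>V. s \<subseteq> layer d}"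

definition hemisphere :: "nat \<Rightarrow> ('a \<times> (real^'n) \<times> real) set set" where
  "hemisphere d = {s\<in>layer_complex d. card s = Suc d \<and> (\<forall>v\<in>s. 0 \<le> coord d v)}"

lemma coord_linear: "linear (coord j)"
  unfolding coord_def by (cases "j < CARD('n)") (simp_all add: linear_iff)

lemma coord_uminus: "coord j (- x) = - coord j x"
  using linear_neg[OF coord_linear] by simp

lemma coord_sign: "s \<in> V \<Longrightarrow> (\<forall>v\<in>s. 0 \<le> coord j v) \<or> (\<forall>v\<in>s. coord j v \<le> 0)"
  using sign unfolding coord_def by (cases "j < CARD('n)") auto

lemma inv_idx: "inv_into UNIV idx (idx i) = i" "j < CARD('n) \<Longrightarrow> idx (inv_into UNIV idx j) = j" "idx i < CARD('n)"
proof -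
  show "inv_into UNIV idx (idx i) = i" using idx by (intro inv_into_f_f) (auto simp: bij_betw_def)
  show "j < CARD('n) \<Longrightarrow> idx (inv_into UNIV idx j) = j" using idx by (intro f_inv_into_f) (auto simp: bij_betw_def)
  show "idx i < CARD('n)" using idx by (auto simp: bij_betw_def)
qed

lemma layer_top: "layer CARD('n) = N"
  by (auto simp: layer_def)

lemma layer_sphere:
  assumes "d < CARD('n)"
  shows "layer d = (\<lambda>y. (0, y, 0)) ` sphere_flag idx d"
proof (intro set_eqI iffI)
  fix x assume x: "x \<in> layer d"
  then have "coord CARD('n) x = 0" using assms by (simp add: layer_def)
  then have "x \<in> {x \<in> N. height x = 0}" using x by (simp add: coord_def layer_def)
  then obtain y where y: "infnorm y = 1" "x = (0, y, 0)" unfolding waist by blast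
  have "y $ i = 0" if "d < idx i" for i
  proof -
    have "coord (idx i) x = 0" using x that inv_idx(3)[of i] by (simp add: layer_def)
    then show ?thesis using y inv_idx by (simp add: coord_def)
  qed
  then show "x \<in> (\<lambda>y. (0, y, 0)) ` sphere_flag idx d" using y by (auto simp: sphere_flag_def)
next
  fix x :: "'a \<times> (real^'n) \<times> real"
  assume "x \<in> (\<lambda>y. (0, y, 0)) ` sphere_flag idx d"
  then obtain y where y: "infnorm y = 1" "\<And>i. d < idx i \<Longrightarrow> y $ i = 0" "x = (0, y, 0)" by (auto simp: sphere_flag_def)
  then have "x \<in> {x \<in> N. height x = 0}" unfolding waist by blast
  then have "x \<in> N" by blast
  moreover have "coord j x = 0" if "d < j" "j \<le> CARD('n)" for j using y that inv_idx by (simp add: coord_def)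
  ultimately show "x \<in> layer d" by (simp add: layer_def)
qed

lemma layer_uminus: "x \<in> layer d \<Longrightarrow> - x \<in> layer d"
  using sym by (auto simp: layer_def coord_uminus)

lemma layer_pred: "1 \<le> d \<Longrightarrow> d \<le> CARD('n) \<Longrightarrow> x \<in> layer (d - 1) \<longleftrightarrow> x \<in> layer d \<and> coord d x = 0"
proof -
  assume d: "1 \<le> d" "d \<le> CARD('n)"
  have "d - 1 < j \<longleftrightarrow> d < j \<or> j = d" for j using d by auto
  then show ?thesis using d by (auto simp: layer_def)
qed

lemma layer_complex_uminus: "s \<in> layer_complex d \<Longrightarrow> uminus ` s \<in> layer_complex d"
  using V(3) layer_uminus by (auto simp: layer_complex_def)

lemma layer_complex_pred:
  "1 \<le> d \<Longrightarrow> d \<le> CARD('n) \<Longrightarrow> s \<in> layer_complex (d - 1) \<longleftrightarrow> s \<in> layer_complex d \<and> (\<forall>v\<in>s. coord d v = 0)"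
  using layer_pred by (auto simp: layer_complex_def subset_iff)

lemma geometric_layer_complex: "geometric_complex (layer_complex d)"
  using V(1) unfolding geometric_complex_def layer_complex_def by auto

lemma layer_complex_finite: "s \<in> layer_complex d \<Longrightarrow> finite s"
  using V(1) aff_independent_finite unfolding geometric_complex_def layer_complex_def by blast

lemma layer_complex_down: "s \<in> layer_complex d \<Longrightarrow> t \<subseteq> s \<Longrightarrow> t \<in> layer_complex d"
  using geometric_layer_complex[of d] unfolding geometric_complex_def by blast

lemma hull_coord_pos:
  assumes "z \<in> convex hull s" "0 < coord j z"
  shows "\<exists>v\<in>s. 0 < coord j v"
proof (rule ccontr)
  assume "\<not> (\<exists>v\<in>s. 0 < coord j v)"
  then have "coord j ` s \<subseteq> {..0}" by force
  then have "convex hull (coord j ` s) \<subseteq> {..0}" by (intro hull_minimal) simp_all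
  then show False using assms convex_hull_linear_image[OF coord_linear, of j s] by force
qed

text \<open>A coordinate does not change sign on the vertices of a simplex. If it vanishes at a
  convex combination, all its weighted values at the vertices vanish, so the vertices outside the
  layer have weight 0 and the point lies in the face spanned by the others.\<close>

lemma body_layer_complex: "body (layer_complex d) = layer d"
proof
  show "body (layer_complex d) \<subseteq> layer d"
  proof
    fix x assume "x \<in> body (layer_complex d)"
    then obtain s where s: "s \<in> V" "s \<subseteq> layer d" "x \<in> convex hull s" by (auto simp: body_def layer_complex_def)
    have "x \<in> N" using s V(2) by (auto simp: body_def)
    moreover have "coord j x = 0" if j: "d < j" "j \<le> CARD('n)" for j
    proof -
      have "coord j ` s \<subseteq> {0}" using s(2) j by (auto simp: layer_def)
      then have "convex hull (coord j ` s) \<subseteq> {0}" by (intro hull_minimal) simp_all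
      then show ?thesis using s(3) convex_hull_linear_image[OF coord_linear, of j s] by force
    qed
    ultimately show "x \<in> layer d" by (simp add: layer_def)
  qed
  show "layer d \<subseteq> body (layer_complex d)"
  proof
    fix x assume x: "x \<in> layer d"
    then have "x \<in> N" by (simp add: layer_def)
    then obtain s where s: "s \<in> V" "x \<in> convex hull s" using V(2) by (auto simp: body_def)
    have fs: "finite s" using s V(1) aff_independent_finite unfolding geometric_complex_def by blast
    then obtain c where c: "\<forall>v\<in>s. 0 \<le> c v" "sum c s = 1" "(\<Sum>v\<in>s. c v *\<^sub>R v) = x"
      using s(2) by (auto simp: convex_hull_finite)
    let ?t = "s \<inter> layer d"
    have zero: "c v = 0" if v: "v \<in> s - ?t" for v
    proof -
      have "v \<in> N" using v s(1) V(2) hull_inc[of v s convex] by (auto simp: body_def)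
      then obtain j where j: "d < j" "j \<le> CARD('n)" "coord j v \<noteq> 0" using v by (auto simp: layer_def)
      have "(\<Sum>v\<in>s. c v * coord j v) = coord j x"
        unfolding c(3)[symmetric] by (simp add: linear_sum[OF coord_linear] linear_scale[OF coord_linear])
      also have "\<dots> = 0" using x j by (simp add: layer_def)
      finally have sum0: "(\<Sum>v\<in>s. c v * coord j v) = 0" .
      have "c v * coord j v = 0"
      proof (cases "\<forall>v\<in>s. 0 \<le> coord j v")
        case True
        then show ?thesis using sum_nonneg_eq_0_iff[OF fs, of "\<lambda>v. c v * coord j v"] sum0 c(1) v by auto
      next
        case False
        then have "\<forall>v\<in>s. coord j v \<le> 0" using coord_sign[OF s(1), of j] by blast
        then have "\<And>v. v \<in> s \<Longrightarrow> 0 \<le> - (c v * coord j v)" using c(1) by (simp add: mult_nonneg_nonpos)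
        moreover have "(\<Sum>v\<in>s. - (c v * coord j v)) = 0" using sum0 by (simp add: sum_negf)
        ultimately have "- (c v * coord j v) = 0"
          using sum_nonneg_eq_0_iff[OF fs, of "\<lambda>v. - (c v * coord j v)"] v by blast
        then show ?thesis by simp
      qed
      then show ?thesis using j by simp
    qed
    have "sum c ?t = 1" using c(2) sum.mono_neutral_right[OF fs, of ?t c] zero by auto
    moreover have "(\<Sum>v\<in>?t. c v *\<^sub>R v) = x"
      using c(3) sum.mono_neutral_right[OF fs, of ?t "\<lambda>v. c v *\<^sub>R v"] zero by auto
    ultimately have "x \<in> convex hull ?t"
      using c(1) fs by (auto simp: convex_hull_finite)
    moreover have "?t \<in> layer_complex d" using s(1) V(1) by (auto simp: geometric_complex_def layer_complex_def)
    ultimately show "x \<in> body (layer_complex d)" by (auto simp: body_def)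
  qed
qed

lemma locally_euclidean_layer:
  assumes "d \<le> CARD('n)"
  shows "locally_euclidean TYPE(real^'n) d (body (layer_complex d))"
proof (cases "d = CARD('n)")
  case True
  then show ?thesis using eu by (simp add: body_layer_complex layer_top)
next
  case False
  then have d: "d < CARD('n)" using assms by simp
  have "homeomorphism (sphere_flag idx d) (layer d) (\<lambda>y. (0, y, 0)) (\<lambda>x. fst (snd x))"
    unfolding homeomorphism_def layer_sphere[OF d]
    by (auto simp: image_image intro!: continuous_intros)
  then show ?thesis unfolding body_layer_complex
    by (rule locally_euclidean_homeomorphic[OF locally_euclidean_sphere_flag[OF idx d]])
qed

lemma layer_complex_card_le: "d \<le> CARD('n) \<Longrightarrow> s \<in> layer_complex d \<Longrightarrow> card s \<le> Suc d"
  by (rule geometric_complex_card_le[OF geometric_layer_complex locally_euclidean_layer])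

text \<open>At the top this is \<open>limit\<close>. On a cube sphere it suffices to raise the
  coordinate \<open>d\<close> from 0, because some other component keeps the absolute value
  1.\<close>

lemma layer_limit:
  assumes d: "1 \<le> d" "d \<le> CARD('n)" and x: "x \<in> layer (d - 1)" and e: "0 < e"
  shows "\<exists>z\<in>layer d. dist z x < e \<and> 0 < coord d z"
proof -
  have "d - 1 < CARD('n)" using d by simp
  then obtain y where y: "y \<in> sphere_flag idx (d - 1)" "x = (0, y, 0)" using x layer_sphere by blast
  show ?thesis
  proof (cases "d = CARD('n)")
    case True
    then show ?thesis using limit[of y e] y e by (auto simp: sphere_flag_def layer_top coord_def)
  next
    case False
    then have dn: "d < CARD('n)" using d by simp
    let ?i = "inv_into UNIV idx d"
    have i: "idx ?i = d" using inv_idx(2)[OF dn] .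
    \<comment> \<open>A raise below 1 leaves the maximum norm at 1, and one below \<open>e\<close>
      stays in the required neighbourhood.\<close>
    define s where "s = min (1/2) (e/2)"
    have s: "0 < s" "s < 1" "s < e" using e by (auto simp: s_def)
    let ?y = "y + s *\<^sub>R axis ?i 1"
    have yi: "y $ ?i = 0" using y(1) i d by (simp add: sphere_flag_def)
    have comp: "?y $ k = (if k = ?i then s else y $ k)" for k using yi by (simp add: axis_def)
    have y1: "infnorm y = 1" using y(1) by (simp add: sphere_flag_def)
    have "infnorm ?y \<le> 1" unfolding infnorm_le_cart
      using comp s component_le_infnorm_cart[of y] y1 by (metis abs_of_pos less_imp_le)
    moreover have "1 \<le> infnorm ?y"
    proof -
      obtain k where k: "1 \<le> \<bar>y $ k\<bar>" using le_infnorm_cart[of 1 y] y1 by auto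
      then have "k \<noteq> ?i" using yi by auto
      then have "?y $ k = y $ k" using comp[of k] by (simp only: if_False)
      then have "1 \<le> \<bar>?y $ k\<bar>" using k by (simp only:)
      also have "\<dots> \<le> infnorm ?y" by (rule component_le_infnorm_cart)
      finally show ?thesis .
    qed
    moreover have "?y $ k = 0" if "d < idx k" for k
    proof -
      have "k \<noteq> ?i" using i that by auto
      then have "?y $ k = y $ k" using comp[of k] by (simp only: if_False)
      also have "\<dots> = 0" using y(1) that by (simp add: sphere_flag_def)
      finally show ?thesis .
    qed
    ultimately have "?y \<in> sphere_flag idx d" by (simp only: sphere_flag_def) auto
    then have "(0, ?y, 0) \<in> layer d" using layer_sphere[OF dn] by blast
    moreover have "dist (0, ?y, 0) x < e" using s y by (simp add: dist_Pair_Pair dist_norm norm_axis_1)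
    moreover have "0 < coord d (0, ?y, 0)" using comp[of ?i] s dn by (simp add: coord_def)
    ultimately show ?thesis by blast
  qed
qed

text \<open>A point with positive coordinate \<open>d\<close> near an interior point of
  \<open>r\<close> lies in a simplex that contains \<open>r\<close>. That simplex has a vertex with
  positive coordinate, hence one outside \<open>r\<close>, and the dimension bound leaves room for
  no more than one extra vertex.\<close>

lemma coface_on_positive_side:
  assumes d: "1 \<le> d" "d \<le> CARD('n)" and r: "r \<in> layer_complex (d - 1)" "card r = d"
  shows "\<exists>A\<in>layer_complex d. card A = Suc d \<and> r \<subseteq> A \<and> (\<exists>v\<in>A. 0 < coord d v)"
proof -
  have rd: "r \<in> layer_complex d" "\<forall>v\<in>r. coord d v = 0" using r layer_complex_pred d by blast+
  have "r \<noteq> {}" using r d by auto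
  then obtain x where x: "x \<in> rel_interior (convex hull r)"
    using rel_interior_eq_empty[of "convex hull r"] by auto
  have "x \<in> convex hull r" using x rel_interior_subset by blast
  then have xl: "x \<in> layer (d - 1)" using r(1) body_layer_complex[of "d - 1"] by (auto simp: body_def)
  obtain G where G: "openin (top_of_set (body (layer_complex d))) G" "x \<in> G"
    "\<And>y. y \<in> G \<Longrightarrow> \<exists>A\<in>layer_complex d. r \<subseteq> A \<and> y \<in> convex hull A"
    by (rule geometric_complex_star[OF geometric_layer_complex rd(1) x]) (rule that)
  obtain T where T: "open T" "G = layer d \<inter> T" using G(1) by (auto simp: openin_open body_layer_complex)
  have "x \<in> T" using G(2) T(2) by blast
  then obtain e where e: "0 < e" "ball x e \<subseteq> T" using T(1) open_contains_ball by blast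
  obtain z where z: "z \<in> layer d" "dist z x < e" "0 < coord d z" using layer_limit[OF d xl e(1)] by blast
  then have "z \<in> G" using e(2) T(2) by (auto simp: dist_commute)
  then obtain A where A: "A \<in> layer_complex d" "r \<subseteq> A" "z \<in> convex hull A" using G(3) by blast
  obtain v where v: "v \<in> A" "0 < coord d v" using hull_coord_pos[OF A(3) z(3)] by blast
  then have "r \<subset> A" using A(2) rd(2) by force
  then have "card r < card A" using psubset_card_mono layer_complex_finite[OF A(1)] by blast
  then have "card A = Suc d" using layer_complex_card_le[OF d(2) A(1)] r(2) by simp
  then show ?thesis using A v by blast
qed

text \<open>Each candidate \<open>r\<close> has two cofaces in the layer. If some vertex of
  \<open>r\<close> has a nonzero coordinate \<open>d\<close>, both cofaces lie on its side, which
  gives 2 or 0 in the hemisphere. If the coordinate vanishes on \<open>r\<close>, then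
  \<open>coface_on_positive_side\<close>, applied to \<open>r\<close> and to its antipode, puts one
  coface on each side. The union on the right consists of all simplices with \<open>d\<close>
  vertices in the lower layer.\<close>

lemma hemisphere_boundary:
  assumes d: "1 \<le> d" "d \<le> CARD('n)" and card: "card r = d"
  shows "odd (card {s\<in>hemisphere d. r \<subseteq> s}) \<longleftrightarrow> r \<in> hemisphere (d - 1) \<union> (`) uminus ` hemisphere (d - 1)"
proof -
  let ?S = "hemisphere (d - 1) \<union> (`) uminus ` hemisphere (d - 1)"
  have S_sub: "r \<in> layer_complex (d - 1)" if "r \<in> ?S"
    using that layer_complex_uminus by (auto simp: hemisphere_def)
  have sub_S: "r \<in> ?S" if r: "r \<in> layer_complex (d - 1)"
  proof (cases "\<forall>v\<in>r. 0 \<le> coord (d - 1) v")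
    case True
    then show ?thesis using r card d by (simp add: hemisphere_def)
  next
    case False
    then have "\<forall>v\<in>r. coord (d - 1) v \<le> 0" using coord_sign[of r "d - 1"] r by (auto simp: layer_complex_def)
    then have "uminus ` r \<in> hemisphere (d - 1)"
      using layer_complex_uminus[OF r] card d by (auto simp: hemisphere_def card_image coord_uminus)
    moreover have "r = uminus ` uminus ` r" by (simp add: image_image)
    ultimately show ?thesis by blast
  qed
  have S_iff: "r \<in> ?S \<longleftrightarrow> r \<in> layer_complex (d - 1)" using S_sub sub_S by blast
  show ?thesis
  proof (cases "r \<in> layer_complex d")
    case False
    then have "{s\<in>hemisphere d. r \<subseteq> s} = {}" using layer_complex_down by (auto simp: hemisphere_def)
    moreover have "r \<notin> layer_complex (d - 1)" using False layer_complex_pred[OF d] by blast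
    ultimately show ?thesis using S_iff by (metis card.empty even_zero)
  next
    case r: True
    define T where "T = {A\<in>layer_complex d. card A = Suc d \<and> r \<subseteq> A}"
    have T2: "card T = 2" unfolding T_def
      by (rule exactly_two_cofaces[OF geometric_layer_complex locally_euclidean_layer[OF d(2)] r card d(1)])
    have H: "{s\<in>hemisphere d. r \<subseteq> s} = {A\<in>T. \<forall>v\<in>A. 0 \<le> coord d v}" by (auto simp: T_def hemisphere_def)
    have Tsign: "(\<forall>v\<in>A. 0 \<le> coord d v) \<or> (\<forall>v\<in>A. coord d v \<le> 0)" "r \<subseteq> A" if "A \<in> T" for A
      using that coord_sign[of A d] by (auto simp: T_def layer_complex_def)
    consider v where "v \<in> r" "0 < coord d v" | v where "v \<in> r" "coord d v < 0" | "\<forall>v\<in>r. coord d v = 0"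
      by (metis linorder_neqE_linordered_idom)
    then show ?thesis
    proof cases
      case (1 v)
      have "\<forall>w\<in>A. 0 \<le> coord d w" if "A \<in> T" for A
        using Tsign[OF that] 1 by (meson not_less subsetD)
      then have "{A\<in>T. \<forall>v\<in>A. 0 \<le> coord d v} = T" by blast
      moreover have "r \<notin> layer_complex (d - 1)" using 1 layer_complex_pred[OF d] by force
      ultimately show ?thesis using S_iff H T2 by simp
    next
      case (2 v)
      have "\<not> (\<forall>w\<in>A. 0 \<le> coord d w)" if "A \<in> T" for A
        using Tsign(2)[OF that] 2 by (meson not_less subsetD)
      then have "{A\<in>T. \<forall>v\<in>A. 0 \<le> coord d v} = {}" by blast
      moreover have "r \<notin> layer_complex (d - 1)" using 2 layer_complex_pred[OF d] by force
      ultimately show ?thesis using S_iff H by (metis card.empty even_zero)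
    next
      case 3
      then have r': "r \<in> layer_complex (d - 1)" using layer_complex_pred[OF d] r by blast
      obtain A v where A: "A \<in> T" "v \<in> A" "0 < coord d v"
        using coface_on_positive_side[OF d r' card] by (auto simp: T_def)
      have "card (uminus ` r) = d" using card by (simp add: card_image)
      then obtain B w where B: "B \<in> layer_complex d" "card B = Suc d" "uminus ` r \<subseteq> B" "w \<in> B" "0 < coord d w"
        using coface_on_positive_side[OF d layer_complex_uminus[OF r']] by blast
      have "r \<subseteq> uminus ` B" using image_mono[OF B(3), of uminus] by (simp add: image_image)
      then have B': "uminus ` B \<in> T" "- w \<in> uminus ` B" "coord d (- w) < 0"
        using B layer_complex_uminus by (auto simp: T_def card_image coord_uminus)
      have Apos: "\<forall>v\<in>A. 0 \<le> coord d v" using Tsign(1)[OF A(1)] A(2,3) by force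
      have Bneg: "\<not> (\<forall>v\<in>uminus ` B. 0 \<le> coord d v)" using B'(2,3) by force
      have "A \<noteq> uminus ` B" using Apos Bneg by blast
      then have "T = {A, uminus ` B}"
        using T2 A(1) B'(1) by (auto simp: card_2_iff)
      then have "{A\<in>T. \<forall>v\<in>A. 0 \<le> coord d v} = {A}" using Apos Bneg by blast
      then show ?thesis using H S_iff r' by simp
    qed
  qed
qed

text \<open>A simplex in both halves has vanishing coordinate \<open>d\<close> and would have one
  vertex too many for the layer below; for \<open>d = 0\<close> its vertex would be the zero vector,
  which is not on the sphere.\<close>

lemma hemisphere_disjoint:
  assumes d: "d \<le> CARD('n)"
  shows "hemisphere d \<inter> (`) uminus ` hemisphere d = {}"
proof (rule ccontr)
  assume "hemisphere d \<inter> (`) uminus ` hemisphere d \<noteq> {}"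
  then obtain s t where s: "s \<in> hemisphere d" "t \<in> hemisphere d" "s = uminus ` t" by blast
  have zero: "\<forall>v\<in>s. coord d v = 0"
  proof
    fix v assume v: "v \<in> s"
    then obtain w where "w \<in> t" "v = - w" using s(3) by blast
    then have "coord d v \<le> 0" using s(2) by (simp add: hemisphere_def coord_uminus)
    then show "coord d v = 0" using s(1) v by (force simp: hemisphere_def)
  qed
  have sd: "s \<in> layer_complex d" "card s = Suc d" using s(1) by (auto simp: hemisphere_def)
  show False
  proof (cases "d = 0")
    case True
    have "s \<noteq> {}" using sd(2) by auto
    then obtain v where v: "v \<in> s" by blast
    then have "v \<in> layer 0" using sd(1) True by (auto simp: layer_complex_def)
    then obtain y where y: "y \<in> sphere_flag idx 0" "v = (0, y, 0)" using layer_sphere[of 0] by auto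
    have "y $ i = 0" for i
    proof (cases "idx i = 0")
      case i0: True
      have "coord 0 v = y $ inv_into UNIV idx 0" using y(2) by (simp add: coord_def)
      then show ?thesis using zero v True i0 inv_idx(1)[of i] by simp
    next
      case False
      then show ?thesis using y(1) by (simp add: sphere_flag_def)
    qed
    then have "y = 0" by (simp add: vec_eq_iff)
    then show False using y(1) by (simp add: sphere_flag_def infnorm_0)
  next
    case False
    then have "s \<in> layer_complex (d - 1)" using layer_complex_pred[of d s] sd(1) zero d by simp
    then have "card s \<le> Suc (d - 1)" using layer_complex_card_le[of "d - 1" s] d by simp
    then show False using sd(2) False by simp
  qed
qed

lemma hemisphere_0: "hemisphere 0 = {{(0, axis (inv_into UNIV idx 0) 1, 0)}}"
proof -
  let ?i = "inv_into UNIV idx 0"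
  let ?p = "(0, axis ?i 1, 0) :: 'a \<times> (real^'n) \<times> real"
  have idx0: "idx i = 0 \<longleftrightarrow> i = ?i" for i using inv_idx(1)[of i] inv_idx(2)[of 0] by auto
  have inf: "infnorm (axis ?i 1 :: real^'n) = 1"
  proof (rule order_antisym)
    show "infnorm (axis ?i 1 :: real^'n) \<le> 1" by (simp add: infnorm_le_cart axis_def)
    show "1 \<le> infnorm (axis ?i 1 :: real^'n)" unfolding le_infnorm_cart by (rule exI[of _ ?i]) (simp add: axis_def)
  qed
  have "axis ?i 1 \<in> sphere_flag idx 0" using inf idx0 by (auto simp: sphere_flag_def axis_def)
  then have p: "?p \<in> layer 0" using layer_sphere[of 0] by simp
  have uniq: "v = ?p" if v: "v \<in> layer 0" "0 \<le> coord 0 v" for v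
  proof -
    obtain y where y: "infnorm y = 1" "\<And>i. 0 < idx i \<Longrightarrow> y $ i = 0" "v = (0, y, 0)"
      using v(1) layer_sphere[of 0] by (auto simp: sphere_flag_def)
    have y0: "0 \<le> y $ ?i" using v(2) y(3) by (simp add: coord_def)
    obtain k where k: "1 \<le> \<bar>y $ k\<bar>" using le_infnorm_cart[of 1 y] y(1) by auto
    then have "idx k = 0" using y(2)[of k] by force
    then have "k = ?i" using idx0 by simp
    then have "y $ ?i = 1" using k y0 component_le_infnorm_cart[of y ?i] y(1) by simp
    moreover have "y $ i = 0" if "i \<noteq> ?i" for i using y(2)[of i] idx0[of i] that by blast
    ultimately have "y = axis ?i 1" by (simp add: vec_eq_iff axis_def)
    then show ?thesis using y(3) by simp
  qed
  have "{?p} \<in> hemisphere 0"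
  proof -
    have "?p \<in> body (layer_complex 0)" using p by (simp add: body_layer_complex)
    then obtain s where s: "s \<in> layer_complex 0" "?p \<in> convex hull s" by (auto simp: body_def)
    then have "s \<noteq> {}" by auto
    then have "card s = 1" using layer_complex_card_le[OF _ s(1)] layer_complex_finite[OF s(1)]
      by (simp add: le_Suc_eq)
    then obtain q where "s = {q}" by (auto simp: card_1_singleton_iff)
    then have "s = {?p}" using s(2) by simp
    then show ?thesis using s(1) by (simp add: hemisphere_def coord_def axis_def)
  qed
  moreover have "s = {?p}" if "s \<in> hemisphere 0" for s
  proof -
    have s: "card s = 1" "s \<subseteq> layer 0" "\<forall>v\<in>s. 0 \<le> coord 0 v"
      using that by (auto simp: hemisphere_def layer_complex_def)
    then obtain q where "s = {q}" by (auto simp: card_1_singleton_iff)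
    then show ?thesis using uniq[of q] s by simp
  qed
  ultimately show ?thesis by blast
qed

theorem no_antipodal_labelling:
  assumes nc: "\<And>s. s \<in> V \<Longrightarrow> no_complementary l s"
    and odd: "\<And>v. v \<in> N \<Longrightarrow> l (- v) = - l v"
    and le: "\<And>v. v \<in> N \<Longrightarrow> \<bar>l v\<bar> \<le> int CARD('n)"
  shows False
proof -
  have HV: "s \<in> V" if "s \<in> hemisphere d" for s d using that by (simp add: hemisphere_def layer_complex_def)
  have VN: "v \<in> N" if "s \<in> V" "v \<in> s" for s v
    using that V(2) hull_inc[of v s convex] by (auto simp: body_def)
  have "odd (card {s \<in> hemisphere CARD('n) \<union> (`) uminus ` hemisphere CARD('n). fan_simplex l s})"
  proof (rule Fan_lemma[where n = "CARD('n)"])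
    show "finite (hemisphere d)" for d
      using V(1) by (simp add: hemisphere_def layer_complex_def geometric_complex_def)
    show "card s = Suc d" if "s \<in> hemisphere d" for s d using that by (simp add: hemisphere_def)
    show "no_complementary l s" if "s \<in> hemisphere d" for s d using nc HV[OF that] by blast
    show "l (- v) = - l v" if "s \<in> hemisphere d" "v \<in> s" for s d v using odd VN HV that by blast
    show "odd (card {s\<in>hemisphere d. r \<subseteq> s}) \<longleftrightarrow> r \<in> hemisphere (d - 1) \<union> (`) uminus ` hemisphere (d - 1)"
      if "1 \<le> d" "d \<le> CARD('n)" "card r = d" for d r
      by (rule hemisphere_boundary[OF that])
    show "hemisphere d \<inter> (`) uminus ` hemisphere d = {}" if "d \<le> CARD('n)" for d by (rule hemisphere_disjoint[OF that])
    show "hemisphere 0 = {{(0, axis (inv_into UNIV idx 0) 1, 0)}}" by (rule hemisphere_0)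
  qed simp
  then have "{s \<in> hemisphere CARD('n) \<union> (`) uminus ` hemisphere CARD('n). fan_simplex l s} \<noteq> {}"
    by (metis card.empty even_zero)
  then obtain s where s: "s \<in> hemisphere CARD('n) \<union> (`) uminus ` hemisphere CARD('n)" "fan_simplex l s" by blast
  have sV: "s \<in> V" using s(1) HV V(3) by blast
  have cs: "card s = Suc CARD('n)" using s(1) by (auto simp: hemisphere_def card_image)
  have "inj_on (abs \<circ> l) s"
    using s(2) no_complementary_inj_abs[OF nc[OF sV]] by (intro comp_inj_on) (auto simp: fan_simplex_def)
  then have "card ((abs \<circ> l) ` s) = Suc CARD('n)" using cs by (metis card_image)
  moreover have "(abs \<circ> l) ` s \<subseteq> {1..int CARD('n)}"
    using le[OF VN[OF sV]] nc[OF sV] by (force simp: no_complementary_def)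
  then have "card ((abs \<circ> l) ` s) \<le> card {1..int CARD('n)}" by (rule card_mono[rotated]) simp
  ultimately show False by simp
qed

end

section \<open>The labelling defined by a map without coincidence\<close>

theorem borsuk_ulam_property:
  fixes N :: "('a::euclidean_space \<times> (real^'n) \<times> real) set"
  assumes N: "compact_polyhedron N" and sym: "uminus ` N = N"
    and eu: "locally_euclidean TYPE(real^'n) CARD('n) N"
    and waist: "{x \<in> N. height x = 0} = {(0, y, 0) |y. infnorm y = 1}"
    and limit: "\<And>y e. infnorm y = 1 \<Longrightarrow> 0 < e \<Longrightarrow> \<exists>x\<in>N. dist x (0, y, 0) < e \<and> 0 < height x"
    and g: "continuous_on N (g :: _ \<Rightarrow> real^'n)"
  shows "\<exists>x\<in>N. g (- x) = g x"
proof (rule ccontr)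
  assume no: "\<not> (\<exists>x\<in>N. g (- x) = g x)"
  have negN: "- x \<in> N" if "x \<in> N" for x using that sym by blast
  define f where "f x = g x - g (- x)" for x
  have fneg: "f (- x) = - f x" for x by (simp add: f_def)
  have contf: "continuous_on N f"
    unfolding f_def
    by (intro continuous_intros g continuous_on_compose2[OF g]) (use negN in \<open>auto intro!: continuous_intros\<close>)
  have cN: "compact N" by (rule compact_polyhedron_imp_compact[OF N])
  have f0: "0 < infnorm (f x)" if "x \<in> N" for x
    using no that by (simp add: f_def infnorm_pos_lt) metis
  have "\<exists>e>0. \<forall>x\<in>N. e \<le> infnorm (f x)"
  proof (cases "N = {}")
    case True
    then show ?thesis by (intro exI[of _ 1]) simp
  next
    case False
    have "continuous_on N (\<lambda>x. infnorm (f x))" by (intro continuous_intros contf)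
    then obtain x where "x \<in> N" "\<And>y. y \<in> N \<Longrightarrow> infnorm (f x) \<le> infnorm (f y)"
      using continuous_attains_inf[OF cN False] by blast
    then show ?thesis using f0 by blast
  qed
  \<comment> \<open>The bound \<open>e\<close> keeps the largest component away from 0. Uniform
    continuity turns it into the mesh \<open>\<delta>\<close>, below which that component cannot
    change sign between adjacent vertices.\<close>
  then obtain e where e: "0 < e" "\<And>x. x \<in> N \<Longrightarrow> e \<le> infnorm (f x)" by blast
  obtain \<delta> where \<delta>: "0 < \<delta>" "\<And>x x'. x \<in> N \<Longrightarrow> x' \<in> N \<Longrightarrow> dist x' x < \<delta> \<Longrightarrow> dist (f x') (f x) < e"
    using compact_uniformly_continuous[OF contf cN] e(1) unfolding uniformly_continuous_on_def by metis
  have "0 \<notin> N"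
  proof
    assume "0 \<in> N"
    then have "0 \<in> {x \<in> N. height x = 0}" by simp
    then obtain y :: "real^'n" where "infnorm y = 1" "(0 :: 'a \<times> (real^'n) \<times> real) = (0, y, 0)"
      unfolding waist by blast
    then show False by (simp add: zero_prod_def infnorm_0)
  qed
  \<comment> \<open>Normals of the hyperplanes that cut out the flag: the height, and each component
    of \<open>real^'n\<close>.\<close>
  let ?L = "insert (0, 0, 1) (range (\<lambda>i. (0, axis i 1, 0))) :: ('a \<times> (real^'n) \<times> real) set"
  have finL: "finite ?L" by simp
  obtain V where VV: "geometric_complex V" "body V = N" "\<And>s. s \<in> V \<Longrightarrow> uminus ` s \<in> V"
    "\<And>s u v. s \<in> V \<Longrightarrow> u \<in> s \<Longrightarrow> v \<in> s \<Longrightarrow> dist u v < \<delta>"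
    "\<And>s a. s \<in> V \<Longrightarrow> a \<in> ?L \<Longrightarrow> (\<forall>v\<in>s. 0 \<le> a \<bullet> v) \<or> (\<forall>v\<in>s. a \<bullet> v \<le> 0)"
    by (rule symmetric_triangulation[OF N sym \<open>0 \<notin> N\<close> \<delta>(1) finL]) (rule that)
  obtain idx :: "'n \<Rightarrow> nat" where idx: "bij_betw idx UNIV {0..<CARD('n)}"
    using ex_bij_betw_finite_nat[OF finite, of "UNIV :: 'n set"] by blast
  interpret antipodal_flag N idx V
  proof
    show "(\<forall>v\<in>s. 0 \<le> fst (snd v) $ i) \<or> (\<forall>v\<in>s. fst (snd v) $ i \<le> 0)" if s: "s \<in> V" for s i
      using VV(5)[OF s, of "(0, axis i 1, 0)"] by (simp add: inner_prod_def inner_axis')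
    show "(\<forall>v\<in>s. 0 \<le> height v) \<or> (\<forall>v\<in>s. height v \<le> 0)" if s: "s \<in> V" for s
      using VV(5)[OF s, of "(0, 0, 1)"] by (simp add: inner_prod_def)
  qed (fact idx sym eu waist limit VV)+
  define I where "I x = (SOME i. \<bar>f x $ i\<bar> = infnorm (f x))" for x
  have I: "\<bar>f x $ I x\<bar> = infnorm (f x)" for x
  proof -
    obtain i where "infnorm (f x) \<le> \<bar>f x $ i\<bar>" using le_infnorm_cart[of "infnorm (f x)" "f x"] by auto
    then have "\<bar>f x $ i\<bar> = infnorm (f x)" using component_le_infnorm_cart[of "f x" i] by simp
    then show ?thesis unfolding I_def by (rule someI)
  qed
  \<comment> \<open>Both choices use the same predicate, since \<open>f\<close> at antipodal points
    differs only in sign; ties are therefore broken equally.\<close>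
  have I_neg: "I (- x) = I x" for x unfolding I_def fneg by (simp add: infnorm_neg)
  \<comment> \<open>The numbering \<open>idx\<close> starts at 0, and 0 carries no sign; adding 1
    makes the absolute values run from 1 to \<open>CARD('n)\<close>.\<close>
  define l where "l x = (if 0 < f x $ I x then 1 else - 1) * (int (idx (I x)) + 1)" for x
  have injidx: "idx i = idx j \<Longrightarrow> i = j" for i j using idx by (auto simp: bij_betw_def dest: injD)
  have VN: "v \<in> N" if "s \<in> V" "v \<in> s" for s v
    using that VV(2) hull_inc[of v s convex] by (auto simp: body_def)
  have "l (- v) = - l v" if v: "v \<in> N" for v
  proof -
    have "f v $ I v \<noteq> 0" using f0[OF v] I[of v] by auto
    then show ?thesis by (auto simp: l_def I_neg fneg)
  qed
  moreover have "\<bar>l v\<bar> \<le> int CARD('n)" for v using inv_idx(3)[of "I v"] by (simp add: l_def abs_mult)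
  moreover have "no_complementary l s" if s: "s \<in> V" for s
    unfolding no_complementary_def
  proof (intro ballI conjI)
    fix u assume u: "u \<in> s"
    show "l u \<noteq> 0" by (simp add: l_def)
    fix v assume v: "v \<in> s"
    show "l u \<noteq> - l v"
    proof
      assume eq: "l u = - l v"
      then have "\<bar>l u\<bar> = \<bar>l v\<bar>" by simp
      then have "idx (I u) = idx (I v)" by (auto simp: l_def abs_mult split: if_splits)
      then have Ieq: "I u = I v" by (rule injidx)
      \<comment> \<open>Opposite labels give components in the same place with opposite signs, each
        of size at least \<open>e\<close>, so they differ by more than the mesh allows.\<close>
      have opp: "0 < f u $ I u \<longleftrightarrow> \<not> 0 < f v $ I v" using eq Ieq by (auto simp: l_def split: if_splits)
      have "dist (f u) (f v) < e" using \<delta>(2)[OF VN[OF s v] VN[OF s u]] VV(4)[OF s u v] by simp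
      then have "\<bar>f u $ I u - f v $ I u\<bar> < e" using component_le_norm_cart[of "f u - f v" "I u"] by (simp add: dist_norm)
      moreover have "e \<le> \<bar>f u $ I u\<bar>" "e \<le> \<bar>f v $ I v\<bar>" using e(2) VN[OF s] u v I by simp_all
      ultimately show False using opp e(1) unfolding Ieq by (auto simp: abs_if split: if_splits)
    qed
  qed
  ultimately show False by (intro no_antipodal_labelling[of l]) auto
qed

section \<open>Simplicial and central symmetry\<close>

lemma simplicial_uminus:
  fixes N :: "'a::euclidean_space set"
  assumes "compact_polyhedron N" "uminus ` N = N" "0 \<notin> N"
  shows "simplicial_self_map N uminus"
proof -
  \<comment> \<open>The mesh bound 1 and the empty set of normals are arbitrary; what matters is the
    invariance under the antipode.\<close>
  obtain V where V: "geometric_complex V" "body V = N" "\<And>s. s \<in> V \<Longrightarrow> uminus ` s \<in> V"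
    "\<And>s u v. s \<in> V \<Longrightarrow> u \<in> s \<Longrightarrow> v \<in> s \<Longrightarrow> dist u v < 1"
    "\<And>s a. s \<in> V \<Longrightarrow> a \<in> {} \<Longrightarrow> (\<forall>v\<in>s. 0 \<le> a \<bullet> v) \<or> (\<forall>v\<in>s. a \<bullet> v \<le> 0)"
    by (rule symmetric_triangulation[OF assms zero_less_one finite.emptyI]) (rule that)
  have fin: "finite V" and ind: "\<And>A. A \<in> V \<Longrightarrow> \<not> affine_dependent A" and down: "\<And>A B. A \<in> V \<Longrightarrow> B \<subseteq> A \<Longrightarrow> B \<in> V"
    and int: "\<And>A B. A \<in> V \<Longrightarrow> B \<in> V \<Longrightarrow> convex hull A \<inter> convex hull B \<subseteq> convex hull (A \<inter> B)"
    using V(1) by (auto simp: geometric_complex_def)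
  let ?K = "(\<lambda>s. convex hull s) ` V"
  have "simplicial_complex ?K" unfolding simplicial_complex_def
  proof (intro conjI ballI allI impI)
    show "finite ?K" using fin by simp
    fix S assume "S \<in> ?K"
    then obtain A where "A \<in> V" "S = convex hull A" by blast
    \<comment> \<open>The empty vertex set is allowed and gives the simplex of dimension -1, so the
      dimension is an integer.\<close>
    then show "\<exists>n. n simplex S" using ind unfolding simplex_def by (intro exI[of _ "int (card A) - 1"]) auto
  next
    fix F S assume "S \<in> ?K \<and> F face_of S"
    then obtain A where A: "A \<in> V" "F face_of convex hull A" by blast
    then obtain c where "c \<subseteq> A" "F = convex hull c"
      using face_of_convex_hull_affine_independent[OF ind[OF A(1)]] by blast
    then show "F \<in> ?K" using down A(1) by blast
  next
    fix S S' assume "S \<in> ?K \<and> S' \<in> ?K"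
    then obtain A B where AB: "A \<in> V" "B \<in> V" "S = convex hull A" "S' = convex hull B" by blast
    have "convex hull (A \<inter> B) \<subseteq> convex hull A" "convex hull (A \<inter> B) \<subseteq> convex hull B"
      by (simp_all add: hull_mono)
    then have "S \<inter> S' = convex hull (A \<inter> B)" using int[OF AB(1,2)] AB(3,4) by blast
    then show "S \<inter> S' face_of S"
      using face_of_convex_hull_affine_independent[OF ind[OF AB(1)]] AB(3) by blast
  qed
  moreover have "\<Union>?K = N" using V(2) by (simp add: body_def)
  moreover have "affine_map_on S uminus" for S :: "'a set"
    using affine_map_on_linear[of uminus S 0] by (simp add: linear_iff)
  moreover have "uminus ` S \<in> ?K" if "S \<in> ?K" for S
  proof -
    have "\<exists>A\<in>V. S = convex hull A" using that by blast
    then obtain A where A: "A \<in> V" "S = convex hull A" by blast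
    have "linear (uminus :: 'a \<Rightarrow> 'a)" by (simp add: linear_iff)
    then have "uminus ` S = convex hull (uminus ` A)" unfolding A(2) by (rule convex_hull_linear_image)
    then show ?thesis using V(3)[OF A(1)] by blast
  qed
  ultimately show ?thesis unfolding simplicial_self_map_def by blast
qed

text \<open>Listing the coordinates with respect to the standard basis is linear, so it commutes
  with negation. A continuous injection of a compact set into a Hausdorff space is an
  embedding.\<close>

lemma centrally_symmetric_uminus:
  fixes N :: "'a::euclidean_space set"
  assumes "compact N" "uminus ` N = N"
  shows "centrally_symmetric N uminus"
proof -
  obtain b where b: "bij_betw b {0..<DIM('a)} (Basis :: 'a set)"
    using ex_bij_betw_nat_finite[of "Basis :: 'a set"] by auto
  define e where "e x i = (if i < DIM('a) then x \<bullet> b i else 0)" for x :: 'a and i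
  let ?X = "top_of_set N" and ?Y = "Euclidean_space DIM('a)"
  have cont: "continuous_map ?X ?Y e"
    unfolding Euclidean_space_def continuous_map_in_subtopology continuous_map_componentwise_UNIV
  proof (intro conjI allI)
    have "continuous_on N (\<lambda>x. e x i)" for i by (cases "i < DIM('a)") (simp_all add: e_def continuous_intros)
    then show "continuous_map ?X euclideanreal (\<lambda>x. e x i)" for i by simp
  qed (auto simp: e_def)
  have "inj_on e (topspace ?X)"
  proof (rule inj_onI)
    fix x y assume eq: "e x = e y"
    show "x = y"
    proof (rule euclidean_eqI)
      fix u :: 'a assume "u \<in> Basis"
      then obtain i where "i < DIM('a)" "u = b i" using b by (force simp: bij_betw_def)
      then show "x \<bullet> u = y \<bullet> u" using fun_cong[OF eq, of i] by (simp add: e_def)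
    qed
  qed
  moreover have "closed_map ?X ?Y e"
    by (rule continuous_imp_closed_map_gen[OF _ Hausdorff_imp_kc_space[OF Hausdorff_Euclidean_space] cont])
      (use assms(1) in \<open>simp add: compact_space_subtopology\<close>)
  ultimately have "embedding_map ?X ?Y e" using cont by (intro injective_closed_imp_embedding_map)
  moreover have neg: "e (- x) = (\<lambda>i. - e x i)" for x by (auto simp: e_def)
  moreover have "(\<lambda>v i. - v i) ` e ` N = e ` N"
  proof -
    have "(\<lambda>v i. - v i) ` e ` N = e ` uminus ` N" by (simp add: image_image neg)
    then show ?thesis using assms(2) by simp
  qed
  ultimately show ?thesis unfolding centrally_symmetric_def by blast
qed

text \<open>This supplies the assumption \<open>limit\<close> of the flag argument: scaling
  \<open>y\<close> outward moves its image along the collar to positive height.\<close>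

lemma double_above_waist:
  fixes M :: "'a::euclidean_space set" and h :: "real^'n \<Rightarrow> 'a"
  assumes M: "closed_pl_manifold TYPE('n) M" and h: "pl_disc M h" and y: "infnorm y = 1" and e: "0 < e"
  shows "\<exists>x\<in>double M h. dist x (0, y, 0) < e \<and> 0 < height x"
proof -
  have cont: "continuous_on (cube 2) (neck h)" by (rule pl_map_on_continuous[OF pl_map_on_neck[OF pl_discD(1)[OF h]]])
  have y2: "y \<in> cube 2" using y by (simp add: cube_def)
  obtain d where d: "0 < d" "\<And>z. z \<in> cube 2 \<Longrightarrow> dist z y < d \<Longrightarrow> dist (neck h z) (neck h y) < e"
    using cont y2 e unfolding continuous_on_iff by metis
  \<comment> \<open>The factor \<open>1 + s\<close> must not leave the cube of radius 2, and the
    displacement \<open>s * norm y\<close> must stay below \<open>d\<close>.\<close>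
  define s where "s = min 1 (d / (2 * (norm y + 1)))"
  have s: "0 < s" "s \<le> 1" using d(1) by (auto simp: s_def add_nonneg_pos)
  let ?z = "(1 + s) *\<^sub>R y"
  have inf: "infnorm ?z = 1 + s" using s y by (simp add: infnorm_scaleR)
  then have z2: "?z \<in> cube 2" using s by (simp add: cube_def)
  have "?z - y = s *\<^sub>R y" by (simp add: algebra_simps)
  then have "dist ?z y = s * norm y" using s by (simp add: dist_norm)
  also have "\<dots> \<le> (d / (2 * (norm y + 1))) * norm y" by (intro mult_right_mono) (auto simp: s_def)
  also have "\<dots> < d"
  proof -
    have "norm y / (norm y + 1) < 2" by (simp add: divide_simps add_nonneg_pos)
    then have "d / 2 * (norm y / (norm y + 1)) < d / 2 * 2" using d(1) by (intro mult_strict_left_mono) auto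
    then show ?thesis by simp
  qed
  finally have "dist (neck h ?z) (0, y, 0) < e" using d(2)[OF z2] neck_inner[OF y, of h] by simp
  moreover have "0 < height (neck h ?z)" using inf s by (simp add: neck_def)
  moreover have "h ?z \<in> punctured M h" using disc_in_punctured[OF M h z2] inf s by simp
  then have "neck h ?z \<in> half_space M h"
    unfolding half_space_def by (intro image_eqI[of _ _ "h ?z"] half_embedding_disc[OF M h z2, symmetric])
  then have "neck h ?z \<in> double M h" by (simp add: double_def)
  ultimately show ?thesis by blast
qed

theorem corollary1:
  fixes M :: "'a::euclidean_space set"
  assumes "closed_pl_manifold TYPE('n::finite) M"
  shows "\<forall>h :: real^'n \<Rightarrow> 'a. pl_disc M h \<longrightarrow>
           (\<exists>\<sigma> (N :: ('a \<times> (real^'n) \<times> real) set) T.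
              connected_sum M h M h \<sigma> N \<and>
              free_involution N T \<and> centrally_symmetric N T \<and> BUT_manifold TYPE('n) N T)"
proof (intro allI impI)
  fix h :: "real^'n \<Rightarrow> 'a" assume h: "pl_disc M h"
  let ?N = "double M h"
  note Mh = assms h
  have sym: "uminus ` ?N = ?N" by (rule uminus_double)
  have cp: "compact_polyhedron ?N" by (rule compact_polyhedron_double[OF Mh])
  have man: "closed_pl_manifold TYPE('n) ?N" by (rule closed_pl_manifold_double[OF Mh])
  have zero: "0 \<notin> ?N" by (rule zero_notin_double[OF Mh])
  have free: "free_involution ?N uminus" unfolding free_involution_def
  proof (intro conjI ballI)
    show "continuous_on ?N uminus" by (intro continuous_intros)
    fix x assume x: "x \<in> ?N"
    show "- x \<in> ?N" using sym x by blast
    have "x \<noteq> 0" using x zero by blast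
    then have "x + x \<noteq> 0" by (simp flip: scaleR_2)
    then show "- x \<noteq> x" by (metis add.right_inverse)
  qed simp
  have "\<exists>x\<in>?N. g (- x) = g x" if "continuous_on ?N g" for g :: "_ \<Rightarrow> real^'n"
    by (rule borsuk_ulam_property[OF cp sym closed_pl_manifold_locally_euclidean[OF man]
          double_height_0[OF Mh] double_above_waist[OF Mh] that])
  then have "BUT_manifold TYPE('n) ?N uminus"
    unfolding BUT_manifold_def using man free simplicial_uminus[OF cp sym zero] by blast
  moreover have "centrally_symmetric ?N uminus"
    by (rule centrally_symmetric_uminus[OF compact_polyhedron_imp_compact[OF cp] sym])
  ultimately show "\<exists>\<sigma> (N :: ('a \<times> (real^'n) \<times> real) set) T.
              connected_sum M h M h \<sigma> N \<and>
              free_involution N T \<and> centrally_symmetric N T \<and> BUT_manifold TYPE('n) N T"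
    using connected_sum_double[OF Mh] free by blast
qed

end
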